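(* There is a constant $c>0$ such that the following holds. Let $s\ge1$ be an integer and let $A$ be an $n\times n$ matrix in which each color (entry value) appears at most $\Delta$ times, where $\Delta\le(s-c\sqrt{s})\,n$. Then there is a transversal of $A$ in which each color appears no more than $s$ times, and such a transversal can be constructed in (randomized) polynomial time.
   Context: A transversal of an $n\times n$ matrix $A$ is given by a permutation $\pi$ of $[n]$, i.e. the choice of the entries $A(i,\pi(i))$, $i=1,\dots,n$; a color appears $m$ times in the transversal if exactly $m$ indices $i$ have $A(i,\pi(i))$ equal to that color. *)

theory Defs
  imports
    "HOL-Probability.Probability"
    "HOL-Computational_Algebra.Polynomial"
    "Jordan_Normal_Form.Matrix"
begin

section \<open>Transversals\<close>

text \<open>Rows and columns are indexed by \<open>0, \<dots>, n - 1\<close>, as for library matrices.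
  Only the values of \<open>\<pi>\<close> on \<open>{..<n}\<close> matter.\<close>

definition is_transversal :: "nat \<Rightarrow> (nat \<Rightarrow> nat) \<Rightarrow> bool" where
  "is_transversal n \<pi> \<longleftrightarrow> bij_betw \<pi> {..<n} {..<n}"

definition appearances :: "'c mat \<Rightarrow> 'c \<Rightarrow> nat" where
  "appearances A a = card {(i, j). i < dim_row A \<and> j < dim_col A \<and> A $$ (i, j) = a}"

definition transversal_appearances :: "'c mat \<Rightarrow> (nat \<Rightarrow> nat) \<Rightarrow> 'c \<Rightarrow> nat" where
  "transversal_appearances A \<pi> a = card {i. i < dim_row A \<and> A $$ (i, \<pi> i) = a}"

definition good_transversal :: "nat \<Rightarrow> 'c mat \<Rightarrow> (nat \<Rightarrow> nat) \<Rightarrow> bool" where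
  "good_transversal s A \<pi> \<longleftrightarrow>
     is_transversal (dim_row A) \<pi> \<and> (\<forall>a. transversal_appearances A \<pi> a \<le> s)"

section \<open>Randomized computation\<close>

text \<open>The machine model is a while language over finitely many infinite arrays of natural
  numbers (a random access machine with structured control), whose only source of randomness
  is a fair coin. Elementary statements and control steps have unit cost; an expression has
  a fixed size in the program text. The only arithmetic operations are addition and
  truncated subtraction. Hence each step increases the maximal bit length in memory by at most
  a constant, and unit cost time is polynomially related to the time of
  a probabilistic Turing machine (multiplication at unit cost would break this).\<close>

type_synonym vname = string
type_synonym state = "vname \<Rightarrow> nat \<Rightarrow> nat"

datatype aexp = Lit nat | Elem vname aexp | Add aexp aexp | Sub aexp aexp

datatype bexp = Less aexp aexp | Neg bexp | Conj bexp bexp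

datatype com =
    Skip
  | Assign vname aexp aexp
  | Flip vname aexp
  | Seq com com
  | Cond bexp com com
  | Loop bexp com

primrec aval :: "aexp \<Rightarrow> state \<Rightarrow> nat" where
  "aval (Lit k) \<sigma> = k"
| "aval (Elem x e) \<sigma> = \<sigma> x (aval e \<sigma>)"
| "aval (Add e1 e2) \<sigma> = aval e1 \<sigma> + aval e2 \<sigma>"
| "aval (Sub e1 e2) \<sigma> = aval e1 \<sigma> - aval e2 \<sigma>"

primrec bval :: "bexp \<Rightarrow> state \<Rightarrow> bool" where
  "bval (Less e1 e2) \<sigma> \<longleftrightarrow> aval e1 \<sigma> < aval e2 \<sigma>"
| "bval (Neg b) \<sigma> \<longleftrightarrow> \<not> bval b \<sigma>"
| "bval (Conj b1 b2) \<sigma> \<longleftrightarrow> bval b1 \<sigma> \<and> bval b2 \<sigma>"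

definition update :: "vname \<Rightarrow> nat \<Rightarrow> nat \<Rightarrow> state \<Rightarrow> state" where
  "update x k v \<sigma> = \<sigma>(x := (\<sigma> x)(k := v))"

text \<open>One step of the small-step semantics; \<open>Assign x i e\<close> means \<open>x[i] := e\<close>, and
  \<open>Flip x i\<close> stores a fresh fair random bit in \<open>x[i]\<close>. Halted configurations
  \<open>(Skip, \<sigma>)\<close> are absorbing.\<close>

fun step :: "com \<times> state \<Rightarrow> (com \<times> state) pmf" where
  "step (Skip, \<sigma>) = return_pmf (Skip, \<sigma>)"
| "step (Assign x i e, \<sigma>) = return_pmf (Skip, update x (aval i \<sigma>) (aval e \<sigma>) \<sigma>)"
| "step (Flip x i, \<sigma>) =
     map_pmf (\<lambda>b. (Skip, update x (aval i \<sigma>) (of_bool b) \<sigma>)) (bernoulli_pmf (1 / 2))"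
| "step (Seq c1 c2, \<sigma>) =
     (if c1 = Skip then return_pmf (c2, \<sigma>)
      else map_pmf (\<lambda>(c1', \<sigma>'). (Seq c1' c2, \<sigma>')) (step (c1, \<sigma>)))"
| "step (Cond b c1 c2, \<sigma>) = return_pmf (if bval b \<sigma> then c1 else c2, \<sigma>)"
| "step (Loop b c, \<sigma>) = return_pmf (Cond b (Seq c (Loop b c)) Skip, \<sigma>)"

primrec run :: "nat \<Rightarrow> com \<times> state \<Rightarrow> (com \<times> state) pmf" where
  "run 0 cf = return_pmf cf"
| "run (Suc k) cf = bind_pmf (run k cf) step"

text \<open>The expectation of the number \<open>T\<close> of steps before halting, as
  \<open>E T = (\<Sum>k. P (T > k))\<close>; it is infinite if the program diverges with
  positive probability.\<close>

definition expected_time :: "com \<Rightarrow> state \<Rightarrow> ennreal" where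
  "expected_time P \<sigma> =
     (\<Sum>k. ennreal (measure_pmf.prob (run k (P, \<sigma>)) {cf. fst cf \<noteq> Skip}))"

text \<open>A Las Vegas computation: the expected time is at most \<open>t\<close> (so the program halts with
  probability one), and whenever the program halts, its output is correct.\<close>

definition computes_in_expected_time :: "com \<Rightarrow> state \<Rightarrow> (state \<Rightarrow> bool) \<Rightarrow> nat \<Rightarrow> bool" where
  "computes_in_expected_time P \<sigma> Q t \<longleftrightarrow>
     expected_time P \<sigma> \<le> of_nat t \<and>
     (\<forall>k \<tau>. (Skip, \<tau>) \<in> set_pmf (run k (P, \<sigma>)) \<longrightarrow> Q \<tau>)"

text \<open>The input is \<open>n\<close>, \<open>s\<close> and the matrix in row-major order; all other memory is zero.\<close>

definition input_state :: "nat \<Rightarrow> nat mat \<Rightarrow> state" where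
  "input_state s A = (\<lambda>x k.
     if x = ''n'' \<and> k = 0 then dim_row A
     else if x = ''s'' \<and> k = 0 then s
     else if x = ''A'' \<and> k < dim_row A * dim_col A
       then A $$ (k div dim_col A, k mod dim_col A)
     else 0)"

definition output_perm :: "state \<Rightarrow> nat \<Rightarrow> nat" where
  "output_perm \<tau> i = \<tau> ''pi'' i"

end

theory Submission
  imports Defs
begin

text \<open>Start with a uniformly random permutation. While some color occurs more than \<open>s\<close> times,
  pick a uniformly random set of \<open>k\<close> cells of that color in the current transversal, where
  \<open>k\<close> is the integer part of \<open>sqrt s\<close>, and resample only these cells by random exchanges of
  their rows with other rows. An overfull color contains at least \<open>(s + 1) choose k\<close> such sets, so
  the effective probability of each one shrinks by this factor; with \<open>\<Delta> \<le> (s - 20 sqrt s) n\<close> the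
  Lovasz local lemma condition then holds although resampling all \<open>s + 1\<close> cells would be too costly.

  The resampling operators of sets of cells without common rows and columns commute. Hence the
  expected number of rounds is at most the potential \<open>\<Phi> = (\<Sum>H. w ^ card H * A_H 1)\<close>, where \<open>H\<close> runs over the
  heaps of flaws with a unique last element, \<open>A_H\<close> is the product of the resampling operators along
  \<open>H\<close>, and \<open>w = 1 / ((s + 1) choose k)\<close>: adding the flaw resampled in one round below a heap gives a
  heap again, and this map is injective for a fixed overfull color. Each operator scales the
  uniform measure by a constant, so the mean of \<open>\<Phi>\<close> over all permutations is a
  generating function of heaps, which the local lemma condition bounds by \<open>n\<^sup>2\<close>.\<close>

section \<open>Commuting flaws\<close>

text \<open>The size \<open>k\<close> is squeezed from both sides. Up to constants, a given set of
  \<open>k\<close> cells lies in a uniform permutation with probability n^-k, its choice in a round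
  is discounted by (s choose k), and it clashes mainly with the 2 n k (\<Delta> choose k-1) sets
  meeting one of its rows or columns. The product is about (\<Delta> / (n s))^(k-1) times 2 k^2 / s.
  As \<Delta> / (n s) is at most 1 - 20 / sqrt s, the power drops to a small constant only if
  \<open>k\<close> is of order sqrt s, whereas k^2 <= s keeps the other factor bounded and makes the
  replacement of n and s by n - k and s + 1 - k cost only a factor 1 - 1 / sqrt s each. The
  potential is controlled in the mean over all permutations and not at a given one; this is why the
  program starts from a uniform permutation. Working in \<open>ennreal\<close> lets the infinite sum
  over heaps be formed before anything is known about its convergence. The case s >= n is separate:
  there every permutation is good. Existence of the transversal is read off from the algorithm,
  which could not halt in finite expected time without a correct output.\<close>

text \<open>\<open>act f h \<sigma>\<close> is the expectation of \<open>h\<close> after resampling \<open>f\<close> in the state \<open>\<sigma>\<close>, and \<open>0\<close> if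
  \<open>f\<close> is not present in \<open>\<sigma>\<close>.\<close>

locale commuting_flaws =
  fixes F :: "'f set" and dep :: "'f \<Rightarrow> 'f \<Rightarrow> bool" and color :: "'f \<Rightarrow> 'c"
    and act :: "'f \<Rightarrow> ('s \<Rightarrow> ennreal) \<Rightarrow> 's \<Rightarrow> ennreal" and w :: ennreal
  assumes finite_F: "finite F"
    and dep_sym: "dep f g \<Longrightarrow> dep g f"
    and color_dep: "color f = color g \<Longrightarrow> dep f g"
    and act_commute: "f \<in> F \<Longrightarrow> g \<in> F \<Longrightarrow> \<not> dep f g \<Longrightarrow> act f (act g h) = act g (act f h)"
    and act_one: "f \<in> F \<Longrightarrow> act f (\<lambda>_. 1) \<sigma> \<le> 1"
    and act_mono: "f \<in> F \<Longrightarrow> (\<And>\<sigma>. h \<sigma> \<le> h' \<sigma>) \<Longrightarrow> act f h \<sigma> \<le> act f h' \<sigma>"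
    and act_add: "f \<in> F \<Longrightarrow> act f (\<lambda>\<sigma>. h \<sigma> + h' \<sigma>) \<sigma> = act f h \<sigma> + act f h' \<sigma>"
    and act_scale: "f \<in> F \<Longrightarrow> act f (\<lambda>\<sigma>. c * h \<sigma>) \<sigma> = c * act f h \<sigma>"
    and act_SUP: "f \<in> F \<Longrightarrow> (\<And>\<sigma>. incseq (\<lambda>m::nat. H m \<sigma>)) \<Longrightarrow>
      act f (\<lambda>\<sigma>. SUP m. H m \<sigma>) \<sigma> = (SUP m. act f (H m) \<sigma>)"
begin

lemma act_sum:
  assumes "finite I" "f \<in> F"
  shows "act f (\<lambda>\<sigma>. \<Sum>i\<in>I. c i * H i \<sigma>) \<sigma> = (\<Sum>i\<in>I. c i * act f (H i) \<sigma>)"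
  using assms
proof (induction I rule: finite_induct)
  case empty
  then show ?case using act_scale[of f 0 "\<lambda>_. 0" \<sigma>] by simp
next
  case (insert i I)
  then show ?case by (simp add: act_add act_scale)
qed

definition indep :: "'f set \<Rightarrow> bool" where
  "indep L \<longleftrightarrow> (\<forall>f\<in>L. \<forall>g\<in>L. f \<noteq> g \<longrightarrow> \<not> dep f g)"

text \<open>\<open>Finite_Set.fold\<close> forms the product without choosing an order. It has the
  intended meaning for independent subsets of \<open>F\<close>, whose operators commute.\<close>

definition layer :: "'f set \<Rightarrow> ('s \<Rightarrow> ennreal) \<Rightarrow> 's \<Rightarrow> ennreal" where
  "layer L h = Finite_Set.fold act h L"

text \<open>An inner operator acts later in time: the head of the list is the latest layer, and each
  further layer is wrapped around it as an earlier event.\<close>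

primrec stack :: "'f set list \<Rightarrow> ('s \<Rightarrow> ennreal) \<Rightarrow> 's \<Rightarrow> ennreal" where
  "stack [] h = h"
| "stack (L # Ls) h = stack Ls (layer L h)"

definition weight :: "'f set list \<Rightarrow> nat" where
  "weight U = sum_list (map card U)"

definition nbrs :: "'f set \<Rightarrow> 'f set" where
  "nbrs L = {g \<in> F. \<exists>f\<in>L. dep f g}"

text \<open>Heaps in Foata normal form, read backwards in time: a pyramid is a flaw \<open>f\<close>, resampled last,
  with a list of independent layers, each flaw of a layer clashing with one in the previous layer.\<close>

primrec chains :: "nat \<Rightarrow> 'f set \<Rightarrow> 'f set list set" where
  "chains 0 L = {[]}"
| "chains (Suc m) L = insert [] (\<Union>L' \<in> {L'. L' \<noteq> {} \<and> L' \<subseteq> nbrs L \<and> indep L'}. (#) L' ` chains m L')"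

definition touches :: "'f \<Rightarrow> 'f set list \<Rightarrow> bool" where
  "touches K U \<longleftrightarrow> (\<exists>M\<in>set U. \<exists>g\<in>M. dep K g)"

text \<open>\<open>push K U\<close> makes \<open>K\<close> the first flaw in time: it lands directly behind the last layer that it
  clashes with.\<close>

primrec push :: "'f \<Rightarrow> 'f set list \<Rightarrow> 'f set list" where
  "push K [] = [{K}]"
| "push K (L # Ls) = (if touches K (L # Ls) then L # push K Ls else insert K L # Ls)"

definition has_color :: "'c \<Rightarrow> 'f set list \<Rightarrow> bool" where
  "has_color a U \<longleftrightarrow> (\<exists>M\<in>set U. \<exists>g\<in>M. color g = a)"

text \<open>Inverse of \<open>push\<close> given only the color of the pushed flaw. A layer that
  becomes empty is dropped, because \<open>push\<close> must have created it.\<close>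

primrec pop :: "'c \<Rightarrow> 'f set list \<Rightarrow> 'f set list" where
  "pop a [] = []"
| "pop a (L # Ls) =
    (if has_color a Ls then L # pop a Ls
     else if {g \<in> L. color g \<noteq> a} = {} then Ls else {g \<in> L. color g \<noteq> a} # Ls)"

primrec last_of_color :: "'c \<Rightarrow> 'f set list \<Rightarrow> 'f" where
  "last_of_color a [] = undefined"
| "last_of_color a (L # Ls) =
    (if has_color a Ls then last_of_color a Ls else (SOME g. g \<in> L \<and> color g = a))"

definition good_layers :: "'f set list \<Rightarrow> bool" where
  "good_layers U \<longleftrightarrow> (\<forall>L\<in>set U. L \<noteq> {} \<and> L \<subseteq> F \<and> indep L)"

lemma Cons_chains:
  "M # U \<in> chains (Suc m) L \<longleftrightarrow> M \<noteq> {} \<and> M \<subseteq> nbrs L \<and> indep M \<and> U \<in> chains m M"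
  by auto

lemma dep_commute: "dep f g \<longleftrightarrow> dep g f"
  using dep_sym by blast

lemma dep_refl: "dep f f"
  by (rule color_dep) simp

lemma chains_good: "U \<in> chains m L \<Longrightarrow> good_layers U"
proof (induction m arbitrary: U L)
  case (Suc m)
  then show ?case
    by (auto simp: good_layers_def nbrs_def) blast+
qed (auto simp: good_layers_def)

lemma finite_sub: "L \<subseteq> F \<Longrightarrow> finite L"
  using finite_F by (rule finite_subset[rotated])

lemma finite_nbrs: "finite (nbrs L)"
  using finite_F by (auto simp: nbrs_def)

lemma finite_chains: "finite (chains m L)"
proof (induction m arbitrary: L)
  case (Suc m)
  have "finite {L'. L' \<noteq> {} \<and> L' \<subseteq> nbrs L \<and> indep L'}"
    by (rule finite_subset[of _ "Pow (nbrs L)"]) (auto simp: finite_nbrs)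
  with Suc show ?case by auto
qed auto

lemma chains_mono: "L \<subseteq> M \<Longrightarrow> chains m L \<subseteq> chains m M"
proof (cases m)
  case (Suc m')
  assume "L \<subseteq> M"
  then have "nbrs L \<subseteq> nbrs M" by (auto simp: nbrs_def)
  then have "(\<Union>L' \<in> {L'. L' \<noteq> {} \<and> L' \<subseteq> nbrs L \<and> indep L'}. (#) L' ` chains m' L')
    \<subseteq> (\<Union>L' \<in> {L'. L' \<noteq> {} \<and> L' \<subseteq> nbrs M \<and> indep L'}. (#) L' ` chains m' L')"
    by (intro UN_mono) auto
  then show ?thesis using Suc by (simp add: insert_mono subset_insertI2)
qed auto

lemma chains_Suc_mono: "chains m L \<subseteq> chains (Suc m) L"
proof (induction m arbitrary: L)
  case (Suc m)
  show ?case
  proof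
    fix U assume "U \<in> chains (Suc m) L"
    then consider "U = []" | L' V where "U = L' # V" "L' \<noteq> {}" "L' \<subseteq> nbrs L" "indep L'" "V \<in> chains m L'"
      by auto
    then show "U \<in> chains (Suc (Suc m)) L"
    proof cases
      case 2
      then have "V \<in> chains (Suc m) L'" using Suc.IH by blast
      with 2 show ?thesis
        by (simp add: Cons_chains del: chains.simps)
    qed auto
  qed
qed auto

lemma singleton_chains:
  assumes "K \<in> F" "touches K [L]"
  shows "[{K}] \<in> chains (Suc m) L"
proof -
  have "{K} \<subseteq> nbrs L" "indep {K}" "[] \<in> chains m {K}"
    using assms by (auto simp: touches_def nbrs_def indep_def dep_commute) (cases m, auto)
  then show ?thesis by (simp add: Cons_chains del: chains.simps)
qed

text \<open>The clash with \<open>L # U\<close> keeps the base \<open>L\<close> intact: if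
  \<open>K\<close> clashes with no layer of \<open>U\<close>, it must clash with \<open>L\<close>
  and so may join the first layer of \<open>U\<close>. Enlarging that layer only enlarges its
  neighborhood, so the layers behind it stay admissible. The height grows by one when
  \<open>K\<close> opens a new last layer.\<close>

lemma push_chains:
  assumes "U \<in> chains m L" "K \<in> F" "touches K (L # U)"
  shows "push K U \<in> chains (Suc m) L"
  using assms
proof (induction m arbitrary: U L)
  case 0
  then show ?case using singleton_chains[of K L 0] by simp
next
  case (Suc m)
  show ?case
  proof (cases U)
    case Nil
    then show ?thesis using Suc.prems singleton_chains[of K L "Suc m"] by simp
  next
    case (Cons M V)
    then have M: "M \<noteq> {}" "M \<subseteq> nbrs L" "indep M" "V \<in> chains m M"
      using Suc.prems by auto
    show ?thesis
    proof (cases "touches K U")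
      case True
      then have "push K V \<in> chains (Suc m) M"
        using Suc.IH[OF M(4) Suc.prems(2)] Cons by simp
      then show ?thesis
        using M(1-3) True Cons by (simp add: Cons_chains del: chains.simps)
    next
      case False
      then have "K \<in> nbrs L"
        using Suc.prems by (auto simp: touches_def nbrs_def simp: dep_commute)
      moreover have "indep (insert K M)"
        using M(3) False Cons by (auto simp: indep_def touches_def simp: dep_commute)
      moreover have "V \<in> chains (Suc m) (insert K M)"
        using M(4) chains_mono[of M "insert K M" m] chains_Suc_mono[of m "insert K M"] by blast
      ultimately show ?thesis
        using M(2) False Cons by (simp add: Cons_chains del: chains.simps)
    qed
  qed
qed

lemma comp_fun_commute_on_indep:
  assumes "L \<subseteq> F" "indep L"
  shows "comp_fun_commute_on L act"
proof
  fix x y assume "x \<in> L" "y \<in> L"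
  then show "act y \<circ> act x = act x \<circ> act y"
    using assms act_commute by (cases "x = y") (auto simp: fun_eq_iff indep_def subset_eq)
qed

lemma layer_insert:
  assumes "insert K L \<subseteq> F" "indep (insert K L)" "K \<notin> L"
  shows "layer (insert K L) h = act K (layer L h)" "layer (insert K L) h = layer L (act K h)"
proof -
  interpret comp_fun_commute_on "insert K L" act
    by (rule comp_fun_commute_on_indep[OF assms(1,2)])
  have fin: "finite L"
    using finite_sub[of L] assms(1) by simp
  show "layer (insert K L) h = act K (layer L h)"
    unfolding layer_def by (rule fold_insert[OF subset_refl fin assms(3)])
  show "layer (insert K L) h = layer L (act K h)"
    unfolding layer_def by (rule fold_insert2[OF subset_refl fin assms(3)])
qed

lemma layer_commute:
  assumes "L \<subseteq> F" "indep L" "K \<in> F" "\<not> touches K [L]"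
  shows "act K (layer L h) = layer L (act K h)"
proof -
  have "K \<notin> L" "indep (insert K L)"
    using assms by (auto simp: touches_def indep_def dep_refl simp: dep_commute)
  then show ?thesis
    using layer_insert[of K L h] assms by auto
qed

lemma touches_Cons: "touches K (L # U) \<longleftrightarrow> touches K [L] \<or> touches K U"
  by (auto simp: touches_def)

lemma good_layers_Cons:
  "good_layers (L # U) \<longleftrightarrow> L \<noteq> {} \<and> L \<subseteq> F \<and> indep L \<and> good_layers U"
  by (auto simp: good_layers_def)

lemma stack_commute:
  assumes "good_layers U" "K \<in> F" "\<not> touches K U"
  shows "act K (stack U h) = stack U (act K h)"
  using assms
proof (induction U arbitrary: h)
  case (Cons L U)
  then show ?case
    using layer_commute[of L K h] touches_Cons[of K L U]
    by (auto simp: good_layers_Cons)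
qed simp

text \<open>On its way into the heap \<open>K\<close> passes only layers that it does not clash
  with, and its operator commutes with theirs; so the product is the one with \<open>K\<close>
  performed first in time.\<close>

lemma stack_push:
  assumes "good_layers U" "K \<in> F"
  shows "stack (push K U) h = act K (stack U h)"
  using assms
proof (induction U arbitrary: h)
  case Nil
  then show ?case
    using layer_insert[of K "{}" h] by (simp add: layer_def indep_def)
next
  case (Cons L U)
  show ?case
  proof (cases "touches K (L # U)")
    case True
    then show ?thesis using Cons by (simp add: good_layers_Cons)
  next
    case False
    have "K \<notin> L" "indep (insert K L)"
      using Cons.prems False by (auto simp: touches_def indep_def dep_refl good_layers_Cons simp: dep_commute)
    then have "stack (push K (L # U)) h = stack U (act K (layer L h))"
      using Cons.prems False layer_insert(1)[of K L h] by (simp add: good_layers_Cons)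
    also have "\<dots> = act K (stack U (layer L h))"
      using Cons.prems False by (intro stack_commute[symmetric]) (auto simp: good_layers_Cons touches_Cons[of K L U])
    finally show ?thesis by simp
  qed
qed

lemma layer_mono:
  assumes "L \<subseteq> F" "indep L" "\<And>\<sigma>. h \<sigma> \<le> h' \<sigma>"
  shows "layer L h \<sigma> \<le> layer L h' \<sigma>"
proof -
  have "finite L" using assms(1) by (rule finite_sub)
  then show ?thesis using assms
  proof (induction L arbitrary: \<sigma>)
    case empty
    then show ?case by (simp add: layer_def)
  next
    case (insert K L)
    have "indep L" using insert.prems by (auto simp: indep_def)
    then show ?case
      using insert by (auto simp: layer_insert(1) intro!: act_mono)
  qed
qed

lemma stack_mono:
  assumes "good_layers U" "\<And>\<sigma>. h \<sigma> \<le> h' \<sigma>"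
  shows "stack U h \<sigma> \<le> stack U h' \<sigma>"
  using assms
proof (induction U arbitrary: h h')
  case (Cons L U)
  show ?case
    unfolding stack.simps by (rule Cons.IH) (use Cons.prems in \<open>auto simp: good_layers_Cons intro!: layer_mono\<close>)
qed simp

lemma weight_push:
  assumes "good_layers U" "K \<in> F"
  shows "weight (push K U) = Suc (weight U)"
  using assms
proof (induction U)
  case (Cons L U)
  have "finite L"
    using Cons.prems by (auto simp: good_layers_Cons intro: finite_sub)
  moreover have "\<not> touches K (L # U) \<Longrightarrow> K \<notin> L"
    by (auto simp: touches_def dep_refl)
  ultimately show ?case
    using Cons by (auto simp: weight_def good_layers_Cons)
qed (simp add: weight_def)

lemma has_color_push: "has_color (color K) (push K U)"
  by (induction U) (auto simp: has_color_def)

lemma not_touches_no_color: "\<not> touches K U \<Longrightarrow> \<not> has_color (color K) U"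
  by (metis color_dep has_color_def touches_def)

text \<open>By \<open>color_dep\<close> flaws of one color clash pairwise, so \<open>push\<close>
  places \<open>K\<close> in or behind no layer that precedes another flaw of its color. Hence the
  last layer of the list containing that color contains it exactly once, namely as \<open>K\<close>,
  and the color alone recovers both \<open>K\<close> and \<open>U\<close>.\<close>

lemma pop_push:
  assumes "good_layers U"
  shows "pop (color K) (push K U) = U" "last_of_color (color K) (push K U) = K"
proof -
  have "pop (color K) (push K U) = U \<and> last_of_color (color K) (push K U) = K"
    using assms
  proof (induction U)
    case (Cons L U)
    show ?case
    proof (cases "touches K (L # U)")
      case True
      then show ?thesis using Cons has_color_push[of K U] by (auto simp: good_layers_Cons)
    next
      case False
      then have "\<not> has_color (color K) (L # U)"
        by (rule not_touches_no_color)
      then have nc: "\<not> has_color (color K) U" "\<And>g. g \<in> L \<Longrightarrow> color g \<noteq> color K"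
        by (auto simp: has_color_def)
      have eq: "{g \<in> insert K L. color g \<noteq> color K} = L"
        using nc by auto
      have "(SOME g. g \<in> insert K L \<and> color g = color K) = K"
        by (rule some_equality) (use nc in auto)
      with False nc eq Cons.prems show ?thesis
        by (auto simp: good_layers_Cons)
    qed
  qed (auto simp: has_color_def)
  then show "pop (color K) (push K U) = U" "last_of_color (color K) (push K U) = K"
    by auto
qed

section \<open>The potential: decrease in one round, and mean over all states\<close>

definition pyramids :: "nat \<Rightarrow> ('f \<times> 'f set list) set" where
  "pyramids m = Sigma F (\<lambda>f. chains m {f})"

definition pval :: "'f \<times> 'f set list \<Rightarrow> 's \<Rightarrow> ennreal" where
  "pval p \<sigma> = stack (snd p) (act (fst p) (\<lambda>_. 1)) \<sigma>"

text \<open>The bound \<open>m\<close> on the number of layers makes this a finite sum, through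
  which the operators can be moved; \<open>limit_potential\<close> removes it. The exponent is
  \<open>Suc\<close> because the base flaw is not part of the list of layers.\<close>

definition potential :: "nat \<Rightarrow> 's \<Rightarrow> ennreal" where
  "potential m \<sigma> = (\<Sum>p\<in>pyramids m. w ^ Suc (weight (snd p)) * pval p \<sigma>)"

lemma finite_pyramids: "finite (pyramids m)"
  unfolding pyramids_def using finite_F finite_chains by auto

lemma potential_mono: "incseq (\<lambda>m. potential m \<sigma>)"
proof (rule incseq_SucI)
  fix m
  have "pyramids m \<subseteq> pyramids (Suc m)"
    unfolding pyramids_def using chains_Suc_mono by (intro Sigma_mono) auto
  then show "potential m \<sigma> \<le> potential (Suc m) \<sigma>"
    unfolding potential_def by (intro sum_mono2 finite_pyramids) auto
qed

lemma potential_step: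
  fixes v :: "'f \<Rightarrow> ennreal"
  assumes v: "\<And>K. K \<in> Fa \<Longrightarrow> v K \<le> w" "sum v Fa \<le> 1"
    and Fa: "Fa \<subseteq> F" "\<And>K. K \<in> Fa \<Longrightarrow> color K = a"
  shows "(\<Sum>K\<in>Fa. v K * act K (potential m) \<sigma>) + w * (\<Sum>K\<in>Fa. act K (\<lambda>_. 1) \<sigma>)
    \<le> potential (Suc m) \<sigma>"
proof -
  define P where "P = pyramids m"
  define val where "val p = w ^ Suc (weight (snd p)) * pval p \<sigma>" for p
  define T where "T = (\<lambda>(K, (f, U)). touches K ({f} # U))"
  define D where "D = {x \<in> Fa \<times> P. T x}"
  define N where "N = {x \<in> Fa \<times> P. \<not> T x}"
  define \<phi> where "\<phi> = (\<lambda>(K::'f, (f::'f, U)). (f, push K U))"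
  define P0 where "P0 = {(f, U) \<in> P. \<not> has_color a ({f} # U)}"
  define S where "S = (\<lambda>K. (K, [] :: 'f set list)) ` Fa"
  have finP: "finite P" and finFa: "finite Fa"
    using finite_pyramids finite_sub[OF Fa(1)] by (auto simp: P_def)
  have finP0: "finite P0" by (rule finite_subset[OF _ finP]) (auto simp: P0_def)
  have inP: "f \<in> F" "U \<in> chains m {f}" "good_layers U" if "(f, U) \<in> P" for f U
    using that chains_good by (auto simp: P_def pyramids_def)
  have actval: "act K (potential m) \<sigma> = (\<Sum>p\<in>P. w ^ Suc (weight (snd p)) * act K (pval p) \<sigma>)" if "K \<in> Fa" for K
    unfolding potential_def P_def by (rule act_sum[OF finite_pyramids]) (use that Fa in auto)
  \<comment> \<open>If \<open>K\<close> clashes with the heap, it is pushed onto it; otherwise no flaw of the heap has color \<open>a\<close>.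
    Heaps consisting of a single flaw of color \<open>a\<close> arise in neither way and pay for the current round.\<close>
  have "(\<Sum>K\<in>Fa. v K * act K (potential m) \<sigma>) =
    (\<Sum>(K, p)\<in>Fa \<times> P. v K * (w ^ Suc (weight (snd p)) * act K (pval p) \<sigma>))"
    by (simp add: actval sum_distrib_left sum.cartesian_product)
  also have "Fa \<times> P = D \<union> N" by (auto simp: D_def N_def)
  also have "(\<Sum>(K, p)\<in>D \<union> N. v K * (w ^ Suc (weight (snd p)) * act K (pval p) \<sigma>)) =
    (\<Sum>(K, p)\<in>D. v K * (w ^ Suc (weight (snd p)) * act K (pval p) \<sigma>)) +
    (\<Sum>(K, p)\<in>N. v K * (w ^ Suc (weight (snd p)) * act K (pval p) \<sigma>))"
    by (rule sum.union_disjoint) (use finP finFa in \<open>auto simp: D_def N_def\<close>)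
  also have "(\<Sum>(K, p)\<in>D. v K * (w ^ Suc (weight (snd p)) * act K (pval p) \<sigma>)) \<le> (\<Sum>x\<in>D. val (\<phi> x))"
  proof (rule sum_mono)
    fix x assume "x \<in> D"
    then obtain K f U where x: "x = (K, (f, U))" "K \<in> Fa" "(f, U) \<in> P"
      by (auto simp: D_def)
    have "K \<in> F" using x Fa by auto
    have "val (\<phi> x) = w * w ^ Suc (weight U) * act K (pval (f, U)) \<sigma>"
      using inP[OF x(3)] \<open>K \<in> F\<close> by (simp add: x \<phi>_def val_def pval_def[abs_def] weight_push stack_push)
    then show "(case x of (K, p) \<Rightarrow> v K * (w ^ Suc (weight (snd p)) * act K (pval p) \<sigma>)) \<le> val (\<phi> x)"
      using v(1)[OF x(2)] by (simp add: x mult.assoc mult_right_mono)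
  qed
  also have "(\<Sum>x\<in>D. val (\<phi> x)) = sum val (\<phi> ` D)"
  proof (rule sum.reindex[symmetric, unfolded o_def], rule inj_onI)
    fix x y assume *: "x \<in> D" "y \<in> D" "\<phi> x = \<phi> y"
    obtain K f U where x: "x = (K, (f, U))" "K \<in> Fa" "(f, U) \<in> P"
      using * by (auto simp: D_def)
    obtain K' f' U' where y: "y = (K', (f', U'))" "K' \<in> Fa" "(f', U') \<in> P"
      using * by (auto simp: D_def)
    have "f = f'" "push K U = push K' U'" using * x y by (auto simp: \<phi>_def)
    then show "x = y"
      using pop_push[OF inP(3)[OF x(3)], of K] pop_push[OF inP(3)[OF y(3)], of K'] Fa(2)[OF x(2)] Fa(2)[OF y(2)] x y
      by auto
  qed
  also have "(\<Sum>(K, p)\<in>N. v K * (w ^ Suc (weight (snd p)) * act K (pval p) \<sigma>)) \<le>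
    (\<Sum>(K, p)\<in>N. v K * val p)"
  proof (rule sum_mono)
    fix x assume "x \<in> N"
    then obtain K f U where x: "x = (K, (f, U))" "K \<in> Fa" "(f, U) \<in> P" "\<not> touches K ({f} # U)"
      by (auto simp: N_def T_def)
    have KF: "K \<in> F" using x Fa by auto
    have nt: "\<not> touches K U" "\<not> dep K f" using x(4) by (auto simp: touches_def)
    \<comment> \<open>Without a clash the operator of \<open>K\<close> slides past the entire heap
      onto the constant 1, where it is at most 1.\<close>
    have "act K (pval (f, U)) \<sigma> = stack U (act f (act K (\<lambda>_. 1))) \<sigma>"
      using stack_commute[OF inP(3)[OF x(3)] KF nt(1)] act_commute[OF KF inP(1)[OF x(3)] nt(2)]
      by (simp add: pval_def[abs_def])
    also have "\<dots> \<le> pval (f, U) \<sigma>"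
      unfolding pval_def using inP[OF x(3)] KF
      by (auto intro!: stack_mono act_mono act_one)
    finally show "(case x of (K, p) \<Rightarrow> v K * (w ^ Suc (weight (snd p)) * act K (pval p) \<sigma>)) \<le>
      (case x of (K, p) \<Rightarrow> v K * val p)"
      by (auto simp: x val_def intro!: mult_left_mono)
  qed
  also have "(\<Sum>(K, p)\<in>N. v K * val p) \<le> (\<Sum>(K, p)\<in>Fa \<times> P0. v K * val p)"
  proof (rule sum_mono2)
    show "finite (Fa \<times> P0)" using finFa finP0 by simp
    show "N \<subseteq> Fa \<times> P0"
    proof
      fix x assume "x \<in> N"
      then obtain K f U where x: "x = (K, (f, U))" "K \<in> Fa" "(f, U) \<in> P" "\<not> touches K ({f} # U)"
        by (auto simp: N_def T_def)
      with not_touches_no_color[OF x(4)] Fa(2)[OF x(2)] show "x \<in> Fa \<times> P0"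
        by (auto simp: P0_def)
    qed
  qed auto
  also have "(\<Sum>(K, p)\<in>Fa \<times> P0. v K * val p) = sum v Fa * sum val P0"
    by (simp add: sum_product sum.cartesian_product)
  also have "\<dots> \<le> 1 * sum val P0"
    by (intro mult_right_mono v) auto
  finally have 1: "(\<Sum>K\<in>Fa. v K * act K (potential m) \<sigma>) \<le> sum val (\<phi> ` D) + sum val P0"
    by (simp add: add_mono)
  have 2: "w * (\<Sum>K\<in>Fa. act K (\<lambda>_. 1) \<sigma>) = sum val S"
    unfolding S_def by (subst sum.reindex) (auto simp: inj_on_def val_def pval_def weight_def sum_distrib_left)
  have hc: "has_color a U" if "(f, U) \<in> \<phi> ` D" for f U
  proof -
    obtain K V where "K \<in> Fa" "U = push K V"
      using \<open>(f, U) \<in> \<phi> ` D\<close> by (auto simp: \<phi>_def D_def)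
    then show ?thesis using has_color_push[of K V] Fa(2)[of K] by simp
  qed
  have nS: "U \<noteq> []" if "(f, U) \<in> \<phi> ` D" for f U
    using hc[OF that] by (auto simp: has_color_def)
  have P0: "\<not> has_color a U" "color f \<noteq> a" "(f, U) \<in> P" if "(f, U) \<in> P0" for f U
    using that by (auto simp: P0_def has_color_def)
  have fin: "finite (\<phi> ` D)" "finite P0" "finite S"
    using finP finFa finP0 by (auto simp: D_def S_def)
  \<comment> \<open>The three families are told apart by color: pushed heaps have color
    \<open>a\<close> in some layer, heaps in \<open>P0\<close> have it nowhere, and those in
    \<open>S\<close> have it in the base but have no layers.\<close>
  have "sum val (\<phi> ` D) + sum val P0 + sum val S = sum val (\<phi> ` D \<union> P0 \<union> S)"
  proof -
    have "\<phi> ` D \<inter> P0 = {}"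
      using hc P0(1) by (metis disjoint_iff prod.collapse)
    moreover have "p \<notin> \<phi> ` D \<and> p \<notin> P0" if "p \<in> S" for p
    proof -
      obtain K where K: "K \<in> Fa" "p = (K, [])" using \<open>p \<in> S\<close> by (auto simp: S_def)
      then show ?thesis using nS P0(2) Fa(2) by metis
    qed
    then have "(\<phi> ` D \<union> P0) \<inter> S = {}" by blast
    ultimately show ?thesis using fin by (simp add: sum.union_disjoint)
  qed
  also have "\<dots> \<le> sum val (pyramids (Suc m))"
  proof (rule sum_mono2[OF finite_pyramids])
    have "\<phi> ` D \<subseteq> pyramids (Suc m)"
    proof
      fix y assume "y \<in> \<phi> ` D"
      then obtain K f U where x: "y = (f, push K U)" "K \<in> Fa" "(f, U) \<in> P" "touches K ({f} # U)"
        by (auto simp: D_def \<phi>_def T_def)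
      then show "y \<in> pyramids (Suc m)"
        using push_chains[OF inP(2)[OF x(3)] _ x(4)] inP(1)[OF x(3)] Fa(1) by (auto simp: pyramids_def simp del: chains.simps)
    qed
    moreover have "P0 \<subseteq> pyramids (Suc m)"
      using chains_Suc_mono by (auto simp: P0_def P_def pyramids_def simp del: chains.simps)
    moreover have "S \<subseteq> pyramids (Suc m)"
      using Fa by (auto simp: S_def pyramids_def)
    ultimately show "\<phi> ` D \<union> P0 \<union> S \<subseteq> pyramids (Suc m)" by blast
  qed auto
  also have "\<dots> = potential (Suc m) \<sigma>" by (simp add: potential_def val_def)
  finally show ?thesis using 1 2
    by (metis (no_types, lifting) add_right_mono order_trans)
qed

definition limit_potential :: "'s \<Rightarrow> ennreal" where
  "limit_potential \<sigma> = (SUP m. potential m \<sigma>)"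

text \<open>Monotone convergence turns \<open>potential_step\<close> into a drift inequality with
  the same potential on both sides. By the last assumption, the single-flaw heaps of the treated
  color are worth at least 1, which is the guaranteed decrease per round.\<close>

lemma limit_potential_step:
  fixes v :: "'f \<Rightarrow> ennreal"
  assumes v: "\<And>K. K \<in> Fa \<Longrightarrow> v K \<le> w" "sum v Fa \<le> 1"
    and Fa: "Fa \<subseteq> F" "\<And>K. K \<in> Fa \<Longrightarrow> color K = a"
    and "1 \<le> w * (\<Sum>K\<in>Fa. act K (\<lambda>_. 1) \<sigma>)"
  shows "(\<Sum>K\<in>Fa. v K * act K limit_potential \<sigma>) + 1 \<le> limit_potential \<sigma>"
proof -
  have inc: "incseq (\<lambda>m. v K * act K (potential m) \<sigma>)" if "K \<in> Fa" for K
    using potential_mono that Fa by (auto simp: incseq_def intro!: mult_left_mono act_mono)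
  have "(\<Sum>K\<in>Fa. v K * act K limit_potential \<sigma>) = (\<Sum>K\<in>Fa. SUP m. v K * act K (potential m) \<sigma>)"
    unfolding limit_potential_def using Fa(1)
    by (intro sum.cong refl) (auto simp: act_SUP potential_mono SUP_mult_left_ennreal)
  also have "\<dots> = (SUP m. \<Sum>K\<in>Fa. v K * act K (potential m) \<sigma>)"
    by (rule ennreal_SUP_sum[symmetric]) (rule inc)
  finally have "(\<Sum>K\<in>Fa. v K * act K limit_potential \<sigma>) + 1 = (SUP m. (\<Sum>K\<in>Fa. v K * act K (potential m) \<sigma>) + 1)"
    by (simp add: ennreal_SUP_add_left)
  also have "\<dots> \<le> limit_potential \<sigma>"
    unfolding limit_potential_def
  proof (rule SUP_least)
    fix m
    have "(\<Sum>K\<in>Fa. v K * act K (potential m) \<sigma>) + 1 \<le> potential (Suc m) \<sigma>"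
      by (rule order_trans[OF add_left_mono[OF assms(5)] potential_step[OF v Fa]])
    then show "(\<Sum>K\<in>Fa. v K * act K (potential m) \<sigma>) + 1 \<le> (SUP m. potential m \<sigma>)"
      by (rule order_trans) (auto intro: SUP_upper)
  qed
  finally show ?thesis .
qed

text \<open>The local lemma condition enters here. The bound 2^|L| reproduces itself: forgetting
  independence, the next layer is any subset of the neighborhood of \<open>L\<close>, so by the
  product expansion the sum is at most (1 + 2 q)^|nbrs L| <= exp (2 q |nbrs L|) <= exp (|L| / 2) <=
  2^|L|, where q |nbrs L| <= |L| / 4.\<close>

lemma chains_sum:
  fixes q :: real
  assumes q: "0 \<le> q" "\<And>f. f \<in> F \<Longrightarrow> q * card (nbrs {f}) \<le> 1 / 4" and "L \<subseteq> F"
  shows "(\<Sum>U\<in>chains m L. q ^ weight U) \<le> 2 ^ card L"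
  using assms(3)
proof (induction m arbitrary: L)
  case 0
  then show ?case by (simp add: weight_def)
next
  case (Suc m)
  define Q where "Q = {L'. L' \<noteq> {} \<and> L' \<subseteq> nbrs L \<and> indep L'}"
  have finQ: "finite Q"
    by (rule finite_subset[of _ "Pow (nbrs L)"]) (auto simp: finite_nbrs Q_def)
  have finL: "finite L" using Suc.prems by (rule finite_sub)
  have "(\<Sum>U\<in>chains (Suc m) L. q ^ weight U) =
    1 + (\<Sum>U\<in>(\<Union>L'\<in>Q. (#) L' ` chains m L'). q ^ weight U)"
    unfolding chains.simps Q_def[symmetric] using finQ finite_chains
    by (subst sum.insert) (auto simp: weight_def)
  also have "(\<Sum>U\<in>(\<Union>L'\<in>Q. (#) L' ` chains m L'). q ^ weight U) =
    (\<Sum>L'\<in>Q. \<Sum>U\<in>(#) L' ` chains m L'. q ^ weight U)"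
    using finQ finite_chains by (intro sum.UNION_disjoint) auto
  also have "\<dots> = (\<Sum>L'\<in>Q. q ^ card L' * (\<Sum>U\<in>chains m L'. q ^ weight U))"
    by (intro sum.cong refl, subst sum.reindex)
      (auto simp: weight_def power_add sum_distrib_left inj_on_def)
  also have "\<dots> \<le> (\<Sum>L'\<in>Q. q ^ card L' * 2 ^ card L')"
    by (intro sum_mono mult_left_mono Suc.IH) (use q in \<open>auto simp: Q_def nbrs_def\<close>)
  also have "1 + \<dots> = (\<Sum>L'\<in>insert {} Q. (2 * q) ^ card L')"
    using finQ by (subst sum.insert) (auto simp: Q_def power_mult_distrib mult.commute)
  \<comment> \<open>Independence of the layers is given up here; the summand 1 of the empty list has
    become the empty subset.\<close>
  also have "\<dots> \<le> (\<Sum>L'\<in>Pow (nbrs L). (2 * q) ^ card L')"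
    by (rule sum_mono2) (use q in \<open>auto simp: Q_def finite_nbrs\<close>)
  also have "\<dots> = (\<Sum>L'\<in>Pow (nbrs L). (\<Prod>i\<in>L'. 2 * q) * (\<Prod>i\<in>nbrs L - L'. 1))"
    by (intro sum.cong) auto
  also have "\<dots> = (\<Prod>i\<in>nbrs L. 2 * q + 1)"
    by (rule prod_add[symmetric]) (rule finite_nbrs)
  also have "\<dots> = (1 + 2 * q) ^ card (nbrs L)" by (simp add: add.commute)
  also have "\<dots> \<le> exp (2 * q) ^ card (nbrs L)"
    by (intro power_mono) (use q in \<open>auto simp: exp_ge_add_one_self\<close>)
  also have "\<dots> = exp (2 * (q * card (nbrs L)))"
    by (simp add: exp_of_nat_mult[symmetric] algebra_simps)
  also have "q * card (nbrs L) \<le> real (card L) * (1 / 4)"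
  proof -
    have "nbrs L = (\<Union>f\<in>L. nbrs {f})" by (auto simp: nbrs_def)
    then have "card (nbrs L) \<le> (\<Sum>f\<in>L. card (nbrs {f}))"
      using card_UN_le[OF finL, of "\<lambda>f. nbrs {f}"] by simp
    then have "q * card (nbrs L) \<le> q * real (\<Sum>f\<in>L. card (nbrs {f}))"
      using q by (intro mult_left_mono of_nat_mono) auto
    also have "\<dots> = (\<Sum>f\<in>L. q * card (nbrs {f}))"
      by (simp add: sum_distrib_left)
    also have "\<dots> \<le> (\<Sum>f\<in>L. 1 / 4)"
      by (intro sum_mono q) (use Suc.prems in auto)
    finally show ?thesis by simp
  qed
  then have "exp (2 * (q * card (nbrs L))) \<le> exp (real (card L) * (1 / 2))"
    by simp
  also have "\<dots> = exp (1 / 2) ^ card L"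
    by (simp add: exp_of_nat_mult[symmetric])
  also have "\<dots> \<le> 2 ^ card L"
    by (intro power_mono exp_half_le2) auto
  finally show ?case by simp
qed

text \<open>Each operator multiplies the sum over \<Omega> by \<open>r\<close>, so a heap with W
  flaws contributes q^W |\<Omega>| whatever its shape. The factor 2 is \<open>chains_sum\<close> for
  the one-element base.\<close>

lemma sum_limit_potential:
  fixes q :: real
  assumes q: "0 \<le> q" "\<And>f. f \<in> F \<Longrightarrow> q * card (nbrs {f}) \<le> 1 / 4" "w * r = ennreal q"
    and \<Omega>: "finite \<Omega>" "\<And>f h. f \<in> F \<Longrightarrow> (\<Sum>\<sigma>\<in>\<Omega>. act f h \<sigma>) = r * (\<Sum>\<sigma>\<in>\<Omega>. h \<sigma>)"
  shows "(\<Sum>\<sigma>\<in>\<Omega>. limit_potential \<sigma>) \<le> ennreal (2 * q * card F) * of_nat (card \<Omega>)"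
proof -
  have layer: "(\<Sum>\<sigma>\<in>\<Omega>. layer L h \<sigma>) = r ^ card L * (\<Sum>\<sigma>\<in>\<Omega>. h \<sigma>)" if "L \<subseteq> F" "indep L" for L h
  proof -
    have "finite L" using that(1) by (rule finite_sub)
    then show ?thesis using that
    proof (induction L)
      case (insert K L)
      have "indep L" using insert.prems by (auto simp: indep_def)
      then show ?case using insert by (simp add: layer_insert(1) \<Omega> mult.assoc)
    qed (simp add: layer_def)
  qed
  have stack: "(\<Sum>\<sigma>\<in>\<Omega>. stack U h \<sigma>) = r ^ weight U * (\<Sum>\<sigma>\<in>\<Omega>. h \<sigma>)" if "good_layers U" for U h
    using that by (induction U arbitrary: h) (auto simp: weight_def good_layers_Cons layer power_add mult_ac)
  have "(\<Sum>\<sigma>\<in>\<Omega>. potential m \<sigma>) \<le> ennreal (2 * q * card F) * of_nat (card \<Omega>)" for m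
  proof -
    have "(\<Sum>\<sigma>\<in>\<Omega>. potential m \<sigma>) = (\<Sum>p\<in>pyramids m. w ^ Suc (weight (snd p)) * (\<Sum>\<sigma>\<in>\<Omega>. pval p \<sigma>))"
      unfolding potential_def by (subst sum.swap) (simp add: sum_distrib_left)
    also have "\<dots> = (\<Sum>p\<in>pyramids m. ennreal (q ^ Suc (weight (snd p))) * of_nat (card \<Omega>))"
    proof (rule sum.cong[OF refl])
      fix p assume "p \<in> pyramids m"
      then obtain f U where p: "p = (f, U)" "f \<in> F" "good_layers U"
        using chains_good by (auto simp: pyramids_def)
      have "(\<Sum>\<sigma>\<in>\<Omega>. pval p \<sigma>) = r ^ Suc (weight U) * of_nat (card \<Omega>)"
        using p by (simp add: pval_def stack \<Omega> mult_ac)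
      then have "w ^ Suc (weight (snd p)) * (\<Sum>\<sigma>\<in>\<Omega>. pval p \<sigma>) = (w * r) ^ Suc (weight U) * of_nat (card \<Omega>)"
        by (simp add: p power_mult_distrib mult_ac)
      then show "w ^ Suc (weight (snd p)) * (\<Sum>\<sigma>\<in>\<Omega>. pval p \<sigma>) =
        ennreal (q ^ Suc (weight (snd p))) * of_nat (card \<Omega>)"
        using q(1) by (simp only: q(3) ennreal_power p snd_conv)
    qed
    also have "\<dots> = ennreal (\<Sum>p\<in>pyramids m. q ^ Suc (weight (snd p))) * of_nat (card \<Omega>)"
      using q(1) by (simp only: sum_distrib_right[symmetric] sum_ennreal zero_le_power)
    also have "(\<Sum>p\<in>pyramids m. q ^ Suc (weight (snd p))) = (\<Sum>f\<in>F. q * (\<Sum>U\<in>chains m {f}. q ^ weight U))"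
      using sum.Sigma[of F "\<lambda>f. chains m {f}" "\<lambda>f U. q ^ Suc (weight U)"]
      by (simp add: pyramids_def finite_F finite_chains sum_distrib_left split_def)
    also have "\<dots> \<le> (\<Sum>f\<in>F. q * 2 ^ card {f})"
      by (intro sum_mono mult_left_mono chains_sum) (use q in auto)
    also have "\<dots> = 2 * q * card F" by simp
    finally show ?thesis
      by (simp add: ennreal_leI mult_right_mono)
  qed
  moreover have "(\<Sum>\<sigma>\<in>\<Omega>. limit_potential \<sigma>) = (SUP m. \<Sum>\<sigma>\<in>\<Omega>. potential m \<sigma>)"
    unfolding limit_potential_def by (rule ennreal_SUP_sum[symmetric]) (rule potential_mono)
  ultimately show ?thesis by (auto intro: SUP_least)
qed

end

section \<open>Resampling cells of a permutation\<close>

definition exchange :: "nat \<Rightarrow> nat \<Rightarrow> (nat \<Rightarrow> nat) \<Rightarrow> nat \<Rightarrow> nat" where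
  "exchange i r \<sigma> = \<sigma>(i := \<sigma> r, r := \<sigma> i)"

definition cell_op :: "nat \<Rightarrow> nat \<times> nat \<Rightarrow> ((nat \<Rightarrow> nat) \<Rightarrow> ennreal) \<Rightarrow> (nat \<Rightarrow> nat) \<Rightarrow> ennreal" where
  "cell_op n e g \<sigma> = (if \<sigma> (fst e) = snd e then \<Sum>r<n. g (exchange (fst e) r \<sigma>) else 0)"

text \<open>In a product of these operators, an exchange with the row of a cell that is still to be
  resampled destroys that cell and contributes \<open>0\<close>; so such rows are excluded automatically.\<close>

definition apart :: "nat \<times> nat \<Rightarrow> nat \<times> nat \<Rightarrow> bool" where
  "apart e e' \<longleftrightarrow> fst e \<noteq> fst e' \<and> snd e \<noteq> snd e'"

text \<open>As for \<open>layer\<close>, the fold is an order-free product; for a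
  \<open>partial_matching\<close> the factors commute.\<close>

definition cells_op :: "nat \<Rightarrow> (nat \<times> nat) set \<Rightarrow> ((nat \<Rightarrow> nat) \<Rightarrow> ennreal) \<Rightarrow> (nat \<Rightarrow> nat) \<Rightarrow> ennreal" where
  "cells_op n K g = Finite_Set.fold (cell_op n) g K"

definition partial_matching :: "nat \<Rightarrow> (nat \<times> nat) set \<Rightarrow> bool" where
  "partial_matching n K \<longleftrightarrow> K \<subseteq> {..<n} \<times> {..<n} \<and> (\<forall>e\<in>K. \<forall>e'\<in>K. e \<noteq> e' \<longrightarrow> apart e e')"

text \<open>The two orders produce the same permutations equally often. This is shown by a bijection
  between the pairs of partner rows of the two orders that preserves the resulting
  permutation.\<close>

lemma cell_op_commute:
  assumes "apart e e'" "fst e < n" "fst e' < n"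
  shows "cell_op n e (cell_op n e' g) = cell_op n e' (cell_op n e g)"
proof
  fix \<sigma>
  obtain i j i' j' where e: "e = (i, j)" "e' = (i', j')" by (metis surj_pair)
  have ne: "i \<noteq> i'" "j \<noteq> j'" "i < n" "i' < n" using assms by (auto simp: e apart_def)
  have nested: "cell_op n (i, j) (cell_op n (i', j') g) \<sigma> =
      (if \<sigma> i = j \<and> \<sigma> i' = j' then
        \<Sum>(r, r')\<in>({..<n} - {i'}) \<times> {..<n}. g (exchange i' r' (exchange i r \<sigma>)) else 0)"
    if ne: "i \<noteq> i'" "j \<noteq> j'" "i < n" "i' < n" for i j i' j'
  proof (cases "\<sigma> i = j")
    case True
    have "cell_op n (i, j) (cell_op n (i', j') g) \<sigma> =
      (\<Sum>r<n. if r \<noteq> i' \<and> \<sigma> i' = j' then \<Sum>r'<n. g (exchange i' r' (exchange i r \<sigma>)) else 0)"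
      using True ne by (auto simp: cell_op_def exchange_def intro!: sum.cong)
    also have "\<dots> = (\<Sum>r\<in>{..<n} - {i'}. if \<sigma> i' = j' then \<Sum>r'<n. g (exchange i' r' (exchange i r \<sigma>)) else 0)"
      by (rule sum.mono_neutral_cong_right) auto
    also have "\<dots> = (if \<sigma> i = j \<and> \<sigma> i' = j' then
        \<Sum>(r, r')\<in>({..<n} - {i'}) \<times> {..<n}. g (exchange i' r' (exchange i r \<sigma>)) else 0)"
      using True by (simp add: sum.cartesian_product)
    finally show ?thesis .
  qed (simp add: cell_op_def)
  have "(\<Sum>(r, r')\<in>({..<n} - {i'}) \<times> {..<n}. g (exchange i' r' (exchange i r \<sigma>))) =
    (\<Sum>(r', r)\<in>({..<n} - {i}) \<times> {..<n}. g (exchange i r (exchange i' r' \<sigma>)))"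
  \<comment> \<open>The result is \<sigma> composed with the transpositions (i r) and (i' r'). If
    they are disjoint or trivial, they are just interchanged. For r' = r, or r' = i with r different
    from i, their product is a 3-cycle, which also factors in the other order; for r = r' = i it is
    the single transposition (i i').\<close>
  proof (rule sum.reindex_bij_witness[where
        i = "\<lambda>(b, a). if a = i' then (if b = i' then (i, i) else (b, b)) else if a = b then (a, i) else (a, b)" and
        j = "\<lambda>(r, r'). if r' = i then (if r = i then (i', i') else (r, r)) else if r' = r then (r, i') else (r', r)"])
    fix x assume "x \<in> ({..<n} - {i'}) \<times> {..<n}"
    then show "(case case x of (r, r') \<Rightarrow> if r' = i then (if r = i then (i', i') else (r, r)) else if r' = r then (r, i') else (r', r) of
      (r', r) \<Rightarrow> g (exchange i r (exchange i' r' \<sigma>))) = (case x of (r, r') \<Rightarrow> g (exchange i' r' (exchange i r \<sigma>)))"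
    proof -
      obtain r r' where x: "x = (r, r')" "r \<noteq> i'"
        using \<open>x \<in> ({..<n} - {i'}) \<times> {..<n}\<close> by auto
      consider "r' = i" "r = i" | "r' = i" "r \<noteq> i" | "r' \<noteq> i" "r' = r" | "r' \<noteq> i" "r' \<noteq> r" by blast
      then show ?thesis
        by cases (use x ne in \<open>auto simp: exchange_def fun_eq_iff intro!: arg_cong[where f = g]\<close>)
    qed
  qed (use ne in \<open>auto split: if_splits\<close>)
  then show "cell_op n e (cell_op n e' g) \<sigma> = cell_op n e' (cell_op n e g) \<sigma>"
    using nested[OF ne] nested[of i' i j' j] ne by (auto simp: e)
qed

lemma partial_matching_finite: "partial_matching n K \<Longrightarrow> finite K"
  unfolding partial_matching_def by (auto intro: finite_subset[of _ "{..<n} \<times> {..<n}"])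

lemma partial_matching_subset: "partial_matching n K \<Longrightarrow> L \<subseteq> K \<Longrightarrow> partial_matching n L"
  unfolding partial_matching_def by (meson subset_iff)

lemma cells_op_insert:
  assumes "partial_matching n (insert e K)" "e \<notin> K"
  shows "cells_op n (insert e K) g = cell_op n e (cells_op n K g)"
    "cells_op n (insert e K) g = cells_op n K (cell_op n e g)"
proof -
  interpret comp_fun_commute_on "insert e K" "cell_op n"
  proof
    fix x y assume "x \<in> insert e K" "y \<in> insert e K"
    then have "fst x < n" "fst y < n" "x \<noteq> y \<Longrightarrow> apart x y"
      using assms(1) unfolding partial_matching_def by force+
    then show "cell_op n y \<circ> cell_op n x = cell_op n x \<circ> cell_op n y"
      using cell_op_commute[of x y n] by (cases "x = y") (simp_all add: comp_def)
  qed
  have "finite K" using partial_matching_finite[OF assms(1)] by simp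
  then show "cells_op n (insert e K) g = cell_op n e (cells_op n K g)"
    "cells_op n (insert e K) g = cells_op n K (cell_op n e g)"
    unfolding cells_op_def using assms(2) by (rule fold_insert[OF subset_refl], rule fold_insert2[OF subset_refl])
qed

lemma cells_op_empty: "cells_op n {} g = g"
  by (simp add: cells_op_def)

lemma partial_matching_induct[consumes 1, case_names empty insert]:
  assumes "partial_matching n K" "P {}"
    "\<And>e K. partial_matching n (insert e K) \<Longrightarrow> partial_matching n K \<Longrightarrow> e \<notin> K \<Longrightarrow> P K \<Longrightarrow> P (insert e K)"
  shows "P K"
  using partial_matching_finite[OF assms(1)] assms(1)
proof (induction K)
  case (insert e K)
  then show ?case using assms(3)[of e K] partial_matching_subset[OF insert.prems, of K] by blast
qed (rule assms)

lemma cells_op_commute: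
  assumes "partial_matching n K" "partial_matching n L" "\<And>e e'. e \<in> K \<Longrightarrow> e' \<in> L \<Longrightarrow> apart e e'"
  shows "cells_op n K (cells_op n L g) = cells_op n L (cells_op n K g)"
proof -
  have single: "cell_op n e (cells_op n L g) = cells_op n L (cell_op n e g)"
    if "fst e < n" "\<And>e'. e' \<in> L \<Longrightarrow> apart e e'" for e g
    using assms(2) that
  proof (induction L arbitrary: g rule: partial_matching_induct)
    case (insert e' L)
    then have "cell_op n e (cell_op n e' h) = cell_op n e' (cell_op n e h)" for h
      by (intro cell_op_commute) (auto simp: partial_matching_def)
    with insert show ?case by (simp add: cells_op_insert(1))
  qed (simp add: cells_op_empty)
  from assms(1,3) show ?thesis
  proof (induction K rule: partial_matching_induct)
    case (insert e K)
    have "fst e < n" using insert.hyps by (auto simp: partial_matching_def)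
    with insert show ?case by (simp add: cells_op_insert(1) single)
  qed (simp add: cells_op_empty)
qed

lemma cell_op_mono: "(\<And>\<sigma>. g \<sigma> \<le> h \<sigma>) \<Longrightarrow> cell_op n e g \<sigma> \<le> cell_op n e h \<sigma>"
  by (auto simp: cell_op_def intro: sum_mono)

lemma cells_op_mono:
  assumes "partial_matching n K" "\<And>\<sigma>. g \<sigma> \<le> h \<sigma>"
  shows "cells_op n K g \<sigma> \<le> cells_op n K h \<sigma>"
  using assms
  by (induction K arbitrary: \<sigma> rule: partial_matching_induct)
    (auto simp: cells_op_empty cells_op_insert(1) intro!: cell_op_mono)

lemma cell_op_add: "cell_op n e (\<lambda>\<sigma>. g \<sigma> + h \<sigma>) = (\<lambda>\<sigma>. cell_op n e g \<sigma> + cell_op n e h \<sigma>)"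
  by (auto simp: cell_op_def sum.distrib)

lemma cells_op_add:
  assumes "partial_matching n K"
  shows "cells_op n K (\<lambda>\<sigma>. g \<sigma> + h \<sigma>) = (\<lambda>\<sigma>. cells_op n K g \<sigma> + cells_op n K h \<sigma>)"
  using assms
  by (induction K rule: partial_matching_induct)
    (auto simp: cells_op_empty cells_op_insert(1) cell_op_add)

lemma cell_op_scale: "cell_op n e (\<lambda>\<sigma>. c * g \<sigma>) = (\<lambda>\<sigma>. c * cell_op n e g \<sigma>)"
  by (auto simp: cell_op_def sum_distrib_left)

lemma cells_op_scale:
  assumes "partial_matching n K"
  shows "cells_op n K (\<lambda>\<sigma>. c * g \<sigma>) = (\<lambda>\<sigma>. c * cells_op n K g \<sigma>)"
  using assms
  by (induction K rule: partial_matching_induct)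
    (auto simp: cells_op_empty cells_op_insert(1) cell_op_scale)

lemma cell_op_SUP:
  assumes "\<And>\<sigma>. incseq (\<lambda>m::nat. H m \<sigma>)"
  shows "cell_op n e (\<lambda>\<sigma>. SUP m. H m \<sigma>) \<sigma> = (SUP m. cell_op n e (H m) \<sigma>)"
  using assms by (simp add: cell_op_def ennreal_SUP_sum)

lemma cells_op_SUP:
  assumes "partial_matching n K" "\<And>\<sigma>. incseq (\<lambda>m::nat. H m \<sigma>)"
  shows "cells_op n K (\<lambda>\<sigma>. SUP m. H m \<sigma>) \<sigma> = (SUP m. cells_op n K (H m) \<sigma>)"
  using assms(1)
proof (induction K arbitrary: \<sigma> rule: partial_matching_induct)
  case (insert e K)
  have "incseq (\<lambda>m. cells_op n K (H m) \<sigma>)" for \<sigma>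
    using assms(2) insert.hyps(2) by (auto simp: incseq_def intro!: cells_op_mono)
  moreover have "cells_op n K (\<lambda>\<sigma>. SUP m. H m \<sigma>) = (\<lambda>\<sigma>. SUP m. cells_op n K (H m) \<sigma>)"
    using insert.IH by blast
  ultimately show ?case
    using insert.hyps by (simp add: cells_op_insert(1) cell_op_SUP)
qed (simp add: cells_op_empty)

lemma cells_op_absent:
  assumes "partial_matching n K" "(i, j) \<in> K" "\<sigma> i \<noteq> j"
  shows "cells_op n K g \<sigma> = 0"
proof -
  have K: "K = insert (i, j) (K - {(i, j)})" using assms by auto
  have "cells_op n K g = cell_op n (i, j) (cells_op n (K - {(i, j)}) g)"
    by (subst K, rule cells_op_insert) (use assms(1) K in auto)
  then show ?thesis using assms by (simp add: cell_op_def)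
qed

definition contains_cells :: "(nat \<times> nat) set \<Rightarrow> (nat \<Rightarrow> nat) \<Rightarrow> bool" where
  "contains_cells K \<sigma> \<longleftrightarrow> (\<forall>(i, j)\<in>K. \<sigma> i = j)"

lemma partial_matching_card_le:
  assumes "partial_matching n K"
  shows "card K = card (fst ` K)" "card K \<le> n"
proof -
  have "inj_on fst K" using assms by (fastforce simp: inj_on_def partial_matching_def apart_def)
  then show "card K = card (fst ` K)" by (simp add: card_image)
  moreover have "card (fst ` K) \<le> card {..<n}"
    using assms by (intro card_mono) (auto simp: partial_matching_def)
  ultimately show "card K \<le> n" by simp
qed

text \<open>With \<open>K\<close> still to be treated, exactly n - |K| partner rows keep all its
  cells: those that do not host one of them. Multiplying these numbers gives the falling
  factorial.\<close>

lemma cells_op_one: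
  assumes "partial_matching n K"
  shows "cells_op n K (\<lambda>_. 1) \<sigma> =
    (if contains_cells K \<sigma> then ennreal (fact n / fact (n - card K)) else 0)"
  using assms
proof (induction K arbitrary: \<sigma> rule: partial_matching_induct)
  case empty
  then show ?case by (simp add: cells_op_empty contains_cells_def)
next
  case (insert e K)
  obtain i j where e: "e = (i, j)" by fastforce
  have fin: "finite K" using insert.hyps(2) partial_matching_finite by blast
  have sub: "K \<subseteq> {..<n} \<times> {..<n}" using insert.hyps(2) by (auto simp: partial_matching_def)
  have card: "card (insert e K) = Suc (card K)" using fin insert.hyps by simp
  have le: "Suc (card K) \<le> n" using partial_matching_card_le(2)[OF insert.hyps(1)] card by simp
  show ?case
  proof (cases "\<sigma> i = j")
    case True
    have ap: "i \<noteq> a \<and> j \<noteq> b" if "(a, b) \<in> K" for a b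
      using insert.hyps(1,3) that by (force simp: partial_matching_def e apart_def)
    have "contains_cells K (exchange i r \<sigma>) \<longleftrightarrow> contains_cells K \<sigma> \<and> r \<notin> fst ` K" for r
    proof
      assume *: "contains_cells K (exchange i r \<sigma>)"
      have "r \<notin> fst ` K"
      proof
        assume "r \<in> fst ` K"
        then obtain b where "(r, b) \<in> K" by auto
        then show False using * ap[of r b] True by (auto simp: contains_cells_def exchange_def split: if_splits)
      qed
      moreover have "\<sigma> a = b" if "(a, b) \<in> K" for a b
      proof -
        have "a \<noteq> r" using \<open>r \<notin> fst ` K\<close> that by force
        then show ?thesis using * ap[OF that] that by (auto simp: contains_cells_def exchange_def)
      qed
      ultimately show "contains_cells K \<sigma> \<and> r \<notin> fst ` K" by (auto simp: contains_cells_def)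
    next
      assume "contains_cells K \<sigma> \<and> r \<notin> fst ` K"
      then show "contains_cells K (exchange i r \<sigma>)"
        using ap by (force simp: contains_cells_def exchange_def)
    qed
    then have "cells_op n (insert e K) (\<lambda>_. 1) \<sigma> =
      (\<Sum>r<n. if contains_cells K \<sigma> \<and> r \<notin> fst ` K then ennreal (fact n / fact (n - card K)) else 0)"
      using True insert.hyps by (simp add: cells_op_insert(1) cell_op_def e insert.IH)
    also have "\<dots> = (if contains_cells K \<sigma> then (\<Sum>r\<in>{..<n} - fst ` K. ennreal (fact n / fact (n - card K))) else 0)"
    proof (cases "contains_cells K \<sigma>")
      case True
      have "(\<Sum>r<n. if r \<notin> fst ` K then ennreal (fact n / fact (n - card K)) else 0) =
          (\<Sum>r\<in>{..<n} - fst ` K. ennreal (fact n / fact (n - card K)))"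
        by (rule sum.mono_neutral_cong_right) auto
      then show ?thesis using True by simp
    qed simp
    also have "card ({..<n} - fst ` K) = n - card K"
      using sub fin partial_matching_card_le(1)[OF insert.hyps(2)]
      by (subst card_Diff_subset) auto
    then have "(\<Sum>r\<in>{..<n} - fst ` K. ennreal (fact n / fact (n - card K))) =
      ennreal (real (n - card K) * (fact n / fact (n - card K)))"
      by (subst ennreal_mult) (simp_all add: ennreal_of_nat_eq_real_of_nat)
    also have "real (n - card K) * (fact n / fact (n - card K)) = fact n / fact (n - card (insert e K))"
      using le by (simp add: card fact_reduce[of "n - card K"])
    finally show ?thesis using True by (auto simp: contains_cells_def e)
  next
    case False
    then show ?thesis
      using insert.hyps by (simp add: cells_op_insert(1) cell_op_def e contains_cells_def)
  qed
qed

lemma exchange_eq_comp: "exchange i r \<sigma> = \<sigma> \<circ> Transposition.transpose i r"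
  by (auto simp: exchange_def fun_eq_iff Transposition.transpose_def)

lemma exchange_permutes:
  assumes "\<sigma> permutes {..<n}" "i < n" "r < n"
  shows "exchange i r \<sigma> permutes {..<n}"
  unfolding exchange_eq_comp using assms
  by (intro permutes_compose permutes_swap_id) auto

lemma exchange_exchange: "exchange i r (exchange i r \<sigma>) = \<sigma>"
  by (auto simp: exchange_def fun_eq_iff)

text \<open>Double counting: for fixed r, \<open>exchange i r\<close> is an involution of the
  permutations that turns the condition \<sigma> i = j into \<tau> r = j, and each \<tau> satisfies
  the latter for exactly one r. So resampling a cell maps the uniform measure conditioned on that
  cell back to the uniform measure.\<close>

lemma sum_cell_op:
  assumes "i < n" "j < n"
  shows "(\<Sum>\<sigma> | \<sigma> permutes {..<n}. cell_op n (i, j) g \<sigma>) = (\<Sum>\<sigma> | \<sigma> permutes {..<n}. g \<sigma>)"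
proof -
  define P where "P = {\<sigma>. \<sigma> permutes {..<n}}"
  have finP: "finite P" unfolding P_def by (rule finite_permutations) simp
  have "(\<Sum>\<sigma>\<in>P. cell_op n (i, j) g \<sigma>) = (\<Sum>\<sigma>\<in>P. \<Sum>r<n. if \<sigma> i = j then g (exchange i r \<sigma>) else 0)"
    by (auto simp: cell_op_def intro!: sum.cong)
  also have "\<dots> = (\<Sum>r<n. \<Sum>\<sigma>\<in>P. if \<sigma> i = j then g (exchange i r \<sigma>) else 0)"
    by (rule sum.swap)
  also have "\<dots> = (\<Sum>r<n. \<Sum>\<tau>\<in>P. if \<tau> r = j then g \<tau> else 0)"
  proof (rule sum.cong[OF refl], rule sum.reindex_bij_witness[where i = "exchange i r" and j = "exchange i r" for r])
    fix r \<sigma>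
    assume "r \<in> {..<n}" "\<sigma> \<in> P"
    then show "exchange i r \<sigma> \<in> P" using exchange_permutes assms by (auto simp: P_def)
    then show "exchange i r \<sigma> \<in> P" .
    show "(if exchange i r \<sigma> r = j then g (exchange i r \<sigma>) else 0) = (if \<sigma> i = j then g (exchange i r \<sigma>) else 0)"
      by (simp add: exchange_def)
  qed (simp_all add: exchange_exchange)
  also have "\<dots> = (\<Sum>\<tau>\<in>P. \<Sum>r<n. if \<tau> r = j then g \<tau> else 0)"
    by (rule sum.swap)
  also have "\<dots> = (\<Sum>\<tau>\<in>P. g \<tau>)"
  proof (rule sum.cong[OF refl])
    fix \<tau> assume "\<tau> \<in> P"
    then have \<tau>: "\<tau> permutes {..<n}" by (simp add: P_def)
    have "(\<tau> r = j) = (r = inv_into UNIV \<tau> j)" for r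
      using permutes_inverses[OF \<tau>] by metis
    moreover have "inv_into UNIV \<tau> j < n" using permutes_in_image[OF permutes_inv[OF \<tau>], of j] assms by simp
    ultimately show "(\<Sum>r<n. if \<tau> r = j then g \<tau> else 0) = g \<tau>" by simp
  qed
  finally show ?thesis by (simp add: P_def)
qed

lemma sum_cells_op:
  assumes "partial_matching n K"
  shows "(\<Sum>\<sigma> | \<sigma> permutes {..<n}. cells_op n K g \<sigma>) = (\<Sum>\<sigma> | \<sigma> permutes {..<n}. g \<sigma>)"
  using assms
proof (induction K rule: partial_matching_induct)
  case (insert e K)
  obtain i j where "e = (i, j)" "i < n" "j < n" using insert.hyps(1) by (auto simp: partial_matching_def)
  with insert show ?case by (simp add: cells_op_insert(1) sum_cell_op)
qed (simp add: cells_op_empty)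

section \<open>Monochromatic sets of cells as flaws\<close>

lemma power_mult_fact_le: "m ^ k * fact m \<le> (fact (m + k) :: nat)"
proof (induction k)
  case (Suc k)
  have "m ^ Suc k * fact m \<le> m * fact (m + k)"
    using Suc by (simp add: mult.assoc)
  also have "\<dots> \<le> fact (m + Suc k)" by (simp add: algebra_simps)
  finally show ?case .
qed simp

lemma power_le_fact_quotient:
  assumes "k \<le> n"
  shows "(real n - real k) ^ k \<le> fact n / fact (n - k)"
proof -
  have "real ((n - k) ^ k * fact (n - k)) \<le> real (fact (n - k + k))"
    using power_mult_fact_le[of "n - k" k] by (rule of_nat_mono)
  with assms show ?thesis by (simp add: field_simps of_nat_diff)
qed

lemma power_le_binomial_fact:
  assumes "k \<le> n"
  shows "(real n - real k) ^ k \<le> real (n choose k) * fact k"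
proof -
  have "real (n choose k) * fact k = fact n / fact (n - k)"
    using assms by (simp add: binomial_fact)
  with power_le_fact_quotient[OF assms] show ?thesis by simp
qed

lemma binomial_fact_le_power: "real (n choose k) * fact k \<le> real n ^ k"
  using of_nat_mono[OF binomial_fact_pow[of n k], where 'a = real] by simp

text \<open>The probability (n - k)! / n! of \<open>k\<close> given cells in a uniform permutation,
  times the selection discount; this is the \<open>q\<close> of
  \<open>sum_limit_potential\<close>.\<close>

definition flaw_prob :: "nat \<Rightarrow> nat \<Rightarrow> nat \<Rightarrow> real" where
  "flaw_prob n s k = fact (n - k) / (fact n * real (Suc s choose k))"

text \<open>Comparing factorials with powers reduces both products to y^(k-1) times a bounded
  factor, where y = \<Delta> / ((n - k) (s + 1 - k)). As \<Delta> is positive, the last hypothesis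
  forces sqrt s > 20, and thereby \<open>1 \<le> k\<close>.\<close>

lemma flaw_prob_bounds:
  fixes s n k \<Delta> :: nat
  assumes k: "k\<^sup>2 \<le> s" "s < (Suc k)\<^sup>2" and "s < n" and \<Delta>: "1 \<le> \<Delta>" "real \<Delta> \<le> (real s - 20 * sqrt (real s)) * real n"
  shows "1 \<le> k" "flaw_prob n s k * real (\<Delta> choose k) \<le> 1 / 512"
    "flaw_prob n s k * (2 * real n * real k * real (\<Delta> - 1 choose (k - 1))) \<le> 8 / 512"
proof -
  define x where "x = sqrt (real s)"
  have xx: "x * x = real s" by (simp add: x_def)
  have "0 < (real s - 20 * x) * real n" using \<Delta> by (simp add: x_def)
  then have "0 < real s - 20 * x" by (auto simp: zero_less_mult_iff)
  then have "0 < x * (x - 20)" by (simp add: xx[symmetric] algebra_simps)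
  moreover have "0 \<le> x" by (simp add: x_def)
  ultimately have x: "20 < x" by (simp add: zero_less_mult_iff)
  have kx: "real k \<le> x"
    unfolding x_def using k(1) by (intro real_le_rsqrt) (metis of_nat_le_iff of_nat_power)
  have xk: "x < real k + 1"
  proof -
    have "real s < real ((Suc k)\<^sup>2)" using k(2) by (simp only: of_nat_less_iff)
    then show ?thesis
      unfolding x_def by (intro real_less_lsqrt) (simp_all add: add.commute)
  qed
  show k1: "1 \<le> k" using x xk by linarith
  have nx: "x * x < real n" using \<open>s < n\<close> by (simp add: xx)
  have x2: "2 * x \<le> x * x" using x by (intro mult_right_mono) auto
  have kn: "k \<le> n" "k \<le> Suc s"
  proof -
    have "real k \<le> real n" "real k \<le> real (Suc s)"
      using kx nx x2 x xx by auto
    then show "k \<le> n" "k \<le> Suc s" by (simp_all only: of_nat_le_iff)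
  qed
  define u where "u = real n - real k"
  define t where "t = real (Suc s) - real k"
  have u: "0 < u" "real n \<le> 2 * u" "real n * (x - 1) \<le> u * x"
  proof -
    have "x \<le> real n / x" using nx x by (simp add: field_simps)
    moreover have "real n / x \<le> real n / 2" using x by (intro divide_left_mono) auto
    moreover have "u \<ge> real n - x" using kx by (simp add: u_def)
    ultimately have "real n / x \<le> real n / 2" "u \<ge> real n - real n / x" "0 < real n"
      using \<open>s < n\<close> by auto
    then show "0 < u" "real n \<le> 2 * u" by linarith+
    have "real n * (x - 1) = (real n - real n / x) * x" using x by (simp add: field_simps)
    also have "\<dots> \<le> u * x" using \<open>u \<ge> real n - real n / x\<close> x by (intro mult_right_mono) auto
    finally show "real n * (x - 1) \<le> u * x" .
  qed
  have t: "0 < t" "x * x - x \<le> t" "real s \<le> 2 * t"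
  proof -
    have t_eq: "t = 1 + x * x - real k" by (simp add: t_def xx)
    show "0 < t" "x * x - x \<le> t" using kx x2 x t_eq by linarith+
    show "real s \<le> 2 * t" using kx x2 x t_eq xx by linarith
  qed
  define y where "y = real \<Delta> / (u * t)"
  have y0: "0 \<le> y" using u t by (simp add: y_def)
  \<comment> \<open>Passing from n to \<open>u\<close> and from s to \<open>t\<close> costs a factor
    1 - 1/x each, and (x - 20) x^2 <= (x - 18) (x - 1)^2: of the 20 in the hypothesis, 18
    survive.\<close>
  have y: "y \<le> exp (- 18 / x)"
  proof -
    have "real \<Delta> * x \<le> (x * (x - 20)) * real n * x"
      using \<Delta>(2) x by (intro mult_right_mono) (auto simp: x_def[symmetric] xx[symmetric] algebra_simps)
    also have "\<dots> = ((x - 20) * x * x) * real n" by (simp add: algebra_simps)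
    also have "\<dots> \<le> ((x - 18) * (x - 1) * (x - 1)) * real n"
      using x by (intro mult_right_mono) (auto simp: algebra_simps)
    also have "\<dots> = (x - 18) * (x - 1) * (real n * (x - 1))" by (simp add: algebra_simps)
    also have "\<dots> \<le> (x - 18) * (x - 1) * (u * x)"
      using u x by (intro mult_left_mono) auto
    also have "\<dots> = (x - 18) * u * (x * x - x)" by (simp add: algebra_simps)
    also have "\<dots> \<le> (x - 18) * u * t"
      using u t x by (intro mult_left_mono) auto
    finally have "y \<le> (x - 18) / x"
      using u t x by (simp add: y_def field_simps)
    also have "\<dots> = 1 + (- 18 / x)" using x by (simp add: field_simps)
    also have "\<dots> \<le> exp (- 18 / x)" by (rule exp_ge_add_one_self)
    finally show ?thesis .
  qed
  have y1: "y \<le> 1" using y x by (smt (verit) divide_nonneg_pos exp_le_one_iff minus_divide_left)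
  \<comment> \<open>From 20 < x < k + 1 follows k - 1 >= x / 2, so the exponent reaches 9; then 512
    = 2^9 <= exp 9.\<close>
  have yk: "y ^ (k - 1) \<le> 1 / 512"
  proof -
    have "y ^ (k - 1) \<le> exp (- 18 / x) ^ (k - 1)" using y y0 by (intro power_mono)
    also have "\<dots> = exp (real (k - 1) * (- 18 / x))" by (rule exp_of_nat_mult[symmetric])
    also have "\<dots> \<le> exp (- 9)"
    proof -
      have "x / 2 \<le> real (k - 1)" using xk k1 x by (simp add: of_nat_diff)
      then have "x / 2 * (18 / x) \<le> real (k - 1) * (18 / x)" using x by (intro mult_right_mono) auto
      moreover have "x / 2 * (18 / x) = 9" using x by simp
      moreover have "real (k - 1) * (- 18 / x) = - (real (k - 1) * (18 / x))" by simp
      ultimately show ?thesis unfolding exp_le_cancel_iff by linarith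
    qed
    also have "\<dots> = inverse (exp 1 ^ 9)" by (simp add: exp_minus flip: exp_of_nat_mult)
    also have "\<dots> \<le> inverse (2 ^ 9)"
    proof (intro le_imp_inverse_le power_mono)
      show "2 \<le> exp (1 :: real)" using exp_ge_add_one_self[of "1 :: real"] by simp
    qed auto
    finally show ?thesis by simp
  qed
  define D where "D = u ^ k * t ^ k"
  have D: "0 < D" using u t by (simp add: D_def)
  have fp: "flaw_prob n s k \<le> fact k / D"
  proof -
    have "D \<le> (fact n / fact (n - k)) * (real (Suc s choose k) * fact k)"
      unfolding D_def u_def t_def using u t power_le_fact_quotient[OF kn(1)] power_le_binomial_fact[OF kn(2)]
      by (intro mult_mono) (auto simp: u_def t_def)
    moreover have "0 < real (Suc s choose k)" using kn(2) by (simp add: zero_less_binomial)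
    ultimately show ?thesis using D by (simp add: flaw_prob_def field_simps del: binomial_Suc_Suc)
  qed
  have fp0: "0 \<le> flaw_prob n s k" by (simp add: flaw_prob_def)
  have "flaw_prob n s k * real (\<Delta> choose k) \<le> fact k / D * real (\<Delta> choose k)"
    using fp by (intro mult_right_mono) auto
  also have "\<dots> \<le> real \<Delta> ^ k / D"
    using D binomial_fact_le_power[of \<Delta> k] by (simp add: field_simps)
  also have "\<dots> = y ^ (k - 1) * y"
    using k1 by (cases k) (simp_all add: D_def y_def power_divide power_mult_distrib mult_ac)
  also have "\<dots> \<le> y ^ (k - 1) * 1" using y0 y1 by (intro mult_left_mono) auto
  finally show "flaw_prob n s k * real (\<Delta> choose k) \<le> 1 / 512" using yk by simp
  have "flaw_prob n s k * (2 * real n * real k * real (\<Delta> - 1 choose (k - 1)))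
    \<le> fact k / D * (2 * real n * real k * real (\<Delta> - 1 choose (k - 1)))"
    using fp by (intro mult_right_mono) auto
  also have "\<dots> = 2 * real n * real k * real k / D * (real (\<Delta> - 1 choose (k - 1)) * fact (k - 1))"
    using k1 by (simp add: fact_reduce[of k])
  also have "\<dots> \<le> 2 * real n * real k * real k / D * real \<Delta> ^ (k - 1)"
  proof (intro mult_left_mono)
    have "real (\<Delta> - 1 choose (k - 1)) * fact (k - 1) \<le> real (\<Delta> - 1) ^ (k - 1)"
      by (rule binomial_fact_le_power)
    also have "\<dots> \<le> real \<Delta> ^ (k - 1)" by (intro power_mono) auto
    finally show "real (\<Delta> - 1 choose (k - 1)) * fact (k - 1) \<le> real \<Delta> ^ (k - 1)" .
  qed (use D in auto)
  also have "\<dots> = 2 * real n * (real k * real k) / (u * t) * y ^ (k - 1)"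
  proof -
    have "D = (u * t) * (u * t) ^ (k - 1)"
      using k1 by (cases k) (simp_all add: D_def power_mult_distrib)
    then show ?thesis by (simp add: y_def power_divide mult_ac)
  qed
  \<comment> \<open>Here the upper bound on \<open>k\<close> counts: k^2 <= s <= 2 t, and n <= 2
    u.\<close>
  also have "\<dots> \<le> 8 * y ^ (k - 1)"
  proof (intro mult_right_mono)
    have "real k * real k \<le> real s" using k(1) by (simp add: power2_eq_square flip: of_nat_mult)
    then have "2 * real n * (real k * real k) \<le> 2 * (2 * u) * (2 * t)"
      using u(1,2) t(1,3) by (intro mult_mono[of "2 * real n"]) auto
    then show "2 * real n * (real k * real k) / (u * t) \<le> 8"
      using u t by (simp add: field_simps)
  qed (use y0 in auto)
  also have "\<dots> \<le> 8 * (1 / 512)" using yk by simp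
  finally show "flaw_prob n s k * (2 * real n * real k * real (\<Delta> - 1 choose (k - 1))) \<le> 8 / 512" by simp
qed


section \<open>Flaws of a colored matrix and their potential\<close>

definition cells_at :: "(nat \<Rightarrow> nat) \<Rightarrow> nat set \<Rightarrow> (nat \<times> nat) set" where
  "cells_at \<sigma> S = (\<lambda>i. (i, \<sigma> i)) ` S"

lemma card_cells_at: "card (cells_at \<sigma> S) = card S"
  unfolding cells_at_def by (rule card_image) (auto simp: inj_on_def)

lemma inj_cells_at: "inj_on (cells_at \<sigma>) A"
proof (rule inj_onI)
  fix S T assume "cells_at \<sigma> S = cells_at \<sigma> T"
  then have "fst ` cells_at \<sigma> S = fst ` cells_at \<sigma> T" by simp
  then show "S = T" by (simp add: cells_at_def image_image)
qed

lemma partial_matching_cells_at: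
  assumes "\<sigma> permutes {..<n}" "S \<subseteq> {..<n}"
  shows "partial_matching n (cells_at \<sigma> S)"
  unfolding partial_matching_def
proof
  show "cells_at \<sigma> S \<subseteq> {..<n} \<times> {..<n}"
    using assms permutes_in_image[OF assms(1)] by (auto simp: cells_at_def)
  show "\<forall>e\<in>cells_at \<sigma> S. \<forall>e'\<in>cells_at \<sigma> S. e \<noteq> e' \<longrightarrow> apart e e'"
    using permutes_inj[OF assms(1)] by (auto simp: cells_at_def apart_def inj_eq)
qed

definition color_rows :: "(nat \<Rightarrow> nat \<Rightarrow> nat) \<Rightarrow> nat \<Rightarrow> (nat \<Rightarrow> nat) \<Rightarrow> nat \<Rightarrow> nat set" where
  "color_rows C n \<sigma> a = {i. i < n \<and> C i (\<sigma> i) = a}"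

text \<open>The prefactor is the reciprocal of the mass found in \<open>cells_op_one\<close>, so
  this is a mean wherever all cells of \<open>K\<close> are present.\<close>

definition resample :: "nat \<Rightarrow> (nat \<times> nat) set \<Rightarrow> ((nat \<Rightarrow> nat) \<Rightarrow> ennreal) \<Rightarrow> (nat \<Rightarrow> nat) \<Rightarrow> ennreal" where
  "resample n K h \<sigma> = ennreal (fact (n - card K) / fact n) * cells_op n K h \<sigma>"

locale colored_cells =
  fixes C :: "nat \<Rightarrow> nat \<Rightarrow> nat" and n s k \<Delta> :: nat
  assumes class_le: "card {(i, j). i < n \<and> j < n \<and> C i j = a} \<le> \<Delta>"
    and k: "k\<^sup>2 \<le> s" "s < (Suc k)\<^sup>2" and s_less: "s < n"
    and \<Delta>: "1 \<le> \<Delta>" "real \<Delta> \<le> (real s - 20 * sqrt (real s)) * real n"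
begin

definition color_class :: "nat \<Rightarrow> (nat \<times> nat) set" where
  "color_class a = {(i, j). i < n \<and> j < n \<and> C i j = a}"

definition flaws :: "(nat \<times> nat) set set" where
  "flaws = {K. partial_matching n K \<and> card K = k \<and> (\<exists>a. K \<subseteq> color_class a)}"

text \<open>Flaws are nonempty and monochromatic, so the choice of the cell has no influence on the
  color.\<close>

definition flaw_color :: "(nat \<times> nat) set \<Rightarrow> nat" where
  "flaw_color K = (case SOME e. e \<in> K of (i, j) \<Rightarrow> C i j)"

text \<open>The row and column condition serves commutation. The color condition serves the
  injectivity of \<open>push\<close>, which needs flaws of equal color to be ordered in
  time.\<close>

definition clash :: "(nat \<times> nat) set \<Rightarrow> (nat \<times> nat) set \<Rightarrow> bool" where
  "clash K L \<longleftrightarrow> flaw_color K = flaw_color L \<or> (\<exists>e\<in>K. \<exists>e'\<in>L. \<not> apart e e')"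

definition flaw_weight :: ennreal where
  "flaw_weight = ennreal (1 / real (Suc s choose k))"

lemmas k_ge_1 = flaw_prob_bounds(1)[OF k s_less \<Delta>]

lemma k_le: "k \<le> s"
proof -
  have "k * 1 \<le> k * k" using k_ge_1 by (intro mult_le_mono2) auto
  then have "k \<le> k * k" by simp
  also have "\<dots> \<le> s" using k(1) by (simp add: power2_eq_square)
  finally show ?thesis .
qed

lemma finite_class: "finite (color_class a)"
  by (rule finite_subset[of _ "{..<n} \<times> {..<n}"]) (auto simp: color_class_def)

lemma flaw_color_eq:
  assumes "K \<in> flaws" "K \<subseteq> color_class a"
  shows "flaw_color K = a"
proof -
  have "K \<noteq> {}" using assms(1) k_ge_1 by (auto simp: flaws_def)
  then have "(SOME e. e \<in> K) \<in> K" by (simp add: some_in_eq)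
  with assms(2) show ?thesis by (auto simp: flaw_color_def color_class_def)
qed

lemma flaws_subset_class: "K \<in> flaws \<Longrightarrow> K \<subseteq> color_class (flaw_color K)"
  using flaw_color_eq by (fastforce simp: flaws_def)

sublocale commuting_flaws flaws clash flaw_color "resample n" flaw_weight
proof
  show "finite flaws"
    by (rule finite_subset[of _ "Pow ({..<n} \<times> {..<n})"]) (auto simp: flaws_def partial_matching_def)
  show "clash g f" if "clash f g" for f g
    using that by (force simp: clash_def apart_def)
  show "clash f g" if "flaw_color f = flaw_color g" for f g
    using that by (simp add: clash_def)
next
  fix f g h
  assume *: "f \<in> flaws" "g \<in> flaws" "\<not> clash f g"
  then have pm: "partial_matching n f" "partial_matching n g" by (auto simp: flaws_def)
  have "cells_op n f (cells_op n g h) = cells_op n g (cells_op n f h)"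
    by (rule cells_op_commute) (use * pm in \<open>auto simp: clash_def\<close>)
  then show "resample n f (resample n g h) = resample n g (resample n f h)"
    by (simp add: resample_def[abs_def] cells_op_scale[OF pm(1)] cells_op_scale[OF pm(2)] mult.left_commute)
next
  fix f \<sigma> assume "f \<in> flaws"
  then have pm: "partial_matching n f" by (simp add: flaws_def)
  have "ennreal (fact (n - card f) / fact n) * ennreal (fact n / fact (n - card f)) = 1"
    by (subst ennreal_mult[symmetric]) auto
  then show "resample n f (\<lambda>_. 1) \<sigma> \<le> 1"
    by (simp add: resample_def cells_op_one[OF pm])
next
  fix f \<sigma> and h h' :: "(nat \<Rightarrow> nat) \<Rightarrow> ennreal"
  assume "f \<in> flaws" "\<And>\<sigma>. h \<sigma> \<le> h' \<sigma>"
  then show "resample n f h \<sigma> \<le> resample n f h' \<sigma>"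
    unfolding resample_def by (intro mult_left_mono cells_op_mono) (auto simp: flaws_def)
next
  fix f h h' \<sigma> assume "f \<in> flaws"
  then show "resample n f (\<lambda>\<sigma>. h \<sigma> + h' \<sigma>) \<sigma> = resample n f h \<sigma> + resample n f h' \<sigma>"
    by (simp add: resample_def flaws_def cells_op_add distrib_left)
next
  fix f c h \<sigma> assume "f \<in> flaws"
  then show "resample n f (\<lambda>\<sigma>. c * h \<sigma>) \<sigma> = c * resample n f h \<sigma>"
    by (simp add: resample_def flaws_def cells_op_scale mult_ac)
next
  fix f \<sigma> and H :: "nat \<Rightarrow> (nat \<Rightarrow> nat) \<Rightarrow> ennreal"
  assume "f \<in> flaws" "\<And>\<sigma>. incseq (\<lambda>m. H m \<sigma>)"
  then show "resample n f (\<lambda>\<sigma>. SUP m. H m \<sigma>) \<sigma> = (SUP m. resample n f (H m) \<sigma>)"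
    by (simp add: resample_def flaws_def cells_op_SUP SUP_mult_left_ennreal)
qed

lemma card_flaws_of_color: "card {K \<in> flaws. flaw_color K = a} \<le> \<Delta> choose k"
proof -
  have "{K \<in> flaws. flaw_color K = a} \<subseteq> {K. K \<subseteq> color_class a \<and> card K = k}"
    using flaws_subset_class by (auto simp: flaws_def)
  then have "card {K \<in> flaws. flaw_color K = a} \<le> card {K. K \<subseteq> color_class a \<and> card K = k}"
    by (rule card_mono[rotated]) (simp add: finite_class)
  also have "\<dots> = card (color_class a) choose k" by (rule n_subsets[OF finite_class])
  also have "\<dots> \<le> \<Delta> choose k"
    using class_le by (intro binomial_right_mono) (simp add: color_class_def)
  finally show ?thesis .
qed

lemma card_flaws_containing: "card {K \<in> flaws. c \<in> K} \<le> (\<Delta> - 1) choose (k - 1)"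
proof -
  define a where "a = C (fst c) (snd c)"
  define X where "X = color_class a - {c}"
  have sub: "K \<subseteq> color_class a" if K: "K \<in> flaws" "c \<in> K" for K
  proof -
    obtain b where b: "K \<subseteq> color_class b" using K(1) unfolding flaws_def by blast
    with K(2) have "b = a" by (auto simp: color_class_def a_def)
    with b show ?thesis by simp
  qed
  have "(\<lambda>K. K - {c}) ` {K \<in> flaws. c \<in> K} \<subseteq> {L. L \<subseteq> X \<and> card L = k - 1}"
    using sub by (auto simp: X_def flaws_def)
  moreover have "inj_on (\<lambda>K. K - {c}) {K \<in> flaws. c \<in> K}"
    by (auto simp: inj_on_def)
  ultimately have "card {K \<in> flaws. c \<in> K} \<le> card {L. L \<subseteq> X \<and> card L = k - 1}"
    by (intro card_inj_on_le) (auto simp: X_def finite_class)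
  also have "\<dots> = card X choose (k - 1)" by (rule n_subsets) (simp add: X_def finite_class)
  finally have le: "card {K \<in> flaws. c \<in> K} \<le> card X choose (k - 1)" .
  show ?thesis
  proof (cases "c \<in> color_class a")
    case True
    then have "card X \<le> \<Delta> - 1"
      using class_le[of a] by (simp add: X_def finite_class color_class_def)
    then show ?thesis using le binomial_right_mono order_trans by blast
  next
    case False
    then have "{K \<in> flaws. c \<in> K} = {}" using sub by blast
    then show ?thesis by (simp only: card.empty le0)
  qed
qed

text \<open>A clashing flaw either has the color of \<open>K\<close> or contains one of the at most
  2 n cells in the row and column of one of the \<open>k\<close> cells of \<open>K\<close>.\<close>

lemma card_nbrs:
  assumes "K \<in> flaws"
  shows "card (nbrs {K}) \<le> (\<Delta> choose k) + 2 * n * k * ((\<Delta> - 1) choose (k - 1))"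
proof -
  define X where "X e = {fst e} \<times> {..<n} \<union> {..<n} \<times> {snd e}" for e :: "nat \<times> nat"
  have K: "finite K" "card K = k" "K \<subseteq> {..<n} \<times> {..<n}"
    using assms partial_matching_finite by (auto simp: flaws_def partial_matching_def)
  have cX: "card (X e) \<le> 2 * n" for e
  proof -
    have "card (X e) \<le> card ({fst e} \<times> {..<n}) + card ({..<n} \<times> {snd e})"
      unfolding X_def by (rule card_Un_le)
    then show ?thesis by (simp add: card_cartesian_product)
  qed
  have "nbrs {K} \<subseteq> {L \<in> flaws. flaw_color L = flaw_color K} \<union> (\<Union>e\<in>K. \<Union>c\<in>X e. {L \<in> flaws. c \<in> L})"
  proof
    fix L assume "L \<in> nbrs {K}"
    then have L: "L \<in> flaws" "clash K L" by (auto simp: nbrs_def)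
    show "L \<in> {L \<in> flaws. flaw_color L = flaw_color K} \<union> (\<Union>e\<in>K. \<Union>c\<in>X e. {L \<in> flaws. c \<in> L})"
    proof (cases "flaw_color L = flaw_color K")
      case False
      then obtain e c where "e \<in> K" "c \<in> L" "\<not> apart e c" using L by (auto simp: clash_def)
      moreover from this have "c \<in> X e"
        using L(1) by (auto simp: X_def apart_def flaws_def partial_matching_def)
      ultimately show ?thesis using L(1) by blast
    qed (use L in auto)
  qed
  then have "card (nbrs {K}) \<le> card ({L \<in> flaws. flaw_color L = flaw_color K} \<union> (\<Union>e\<in>K. \<Union>c\<in>X e. {L \<in> flaws. c \<in> L}))"
    by (rule card_mono[rotated]) (use finite_F K in \<open>auto simp: X_def\<close>)
  also have "\<dots> \<le> card {L \<in> flaws. flaw_color L = flaw_color K} + card (\<Union>e\<in>K. \<Union>c\<in>X e. {L \<in> flaws. c \<in> L})"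
    by (rule card_Un_le)
  also have "card (\<Union>e\<in>K. \<Union>c\<in>X e. {L \<in> flaws. c \<in> L}) \<le> (\<Sum>e\<in>K. \<Sum>c\<in>X e. card {L \<in> flaws. c \<in> L})"
    by (intro order_trans[OF card_UN_le] sum_mono card_UN_le) (auto simp: K X_def)
  also have "\<dots> \<le> (\<Sum>e\<in>K. \<Sum>c\<in>X e. (\<Delta> - 1) choose (k - 1))"
    by (intro sum_mono card_flaws_containing)
  also have "\<dots> \<le> (\<Sum>e\<in>K. 2 * n * ((\<Delta> - 1) choose (k - 1)))"
    by (intro sum_mono) (use cX in \<open>auto intro: mult_right_mono\<close>)
  also have "\<dots> = 2 * n * k * ((\<Delta> - 1) choose (k - 1))" by (simp add: K)
  finally show ?thesis using card_flaws_of_color[of "flaw_color K"] by simp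
qed

lemma card_flaws: "card flaws \<le> n\<^sup>2 * (\<Delta> choose k)"
proof -
  define X where "X = (\<lambda>(i, j). C i j) ` ({..<n} \<times> {..<n})"
  have "flaws \<subseteq> (\<Union>a\<in>X. {K \<in> flaws. flaw_color K = a})"
  proof
    fix K assume K: "K \<in> flaws"
    then have "K \<noteq> {}" using k_ge_1 by (auto simp: flaws_def)
    then have "flaw_color K \<in> X"
      using flaws_subset_class[OF K] by (force simp: color_class_def X_def)
    then show "K \<in> (\<Union>a\<in>X. {K \<in> flaws. flaw_color K = a})" using K by blast
  qed
  then have "card flaws \<le> card (\<Union>a\<in>X. {K \<in> flaws. flaw_color K = a})"
    by (rule card_mono[rotated]) (use finite_F in \<open>auto simp: X_def\<close>)
  also have "\<dots> \<le> (\<Sum>a\<in>X. card {K \<in> flaws. flaw_color K = a})"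
    by (rule card_UN_le) (simp add: X_def)
  also have "\<dots> \<le> (\<Sum>a\<in>X. \<Delta> choose k)" by (intro sum_mono card_flaws_of_color)
  also have "\<dots> = card X * (\<Delta> choose k)" by simp
  also have "card X \<le> n\<^sup>2"
    using card_image_le[of "{..<n} \<times> {..<n}" "\<lambda>(i, j). C i j"]
    by (simp add: X_def power2_eq_square)
  finally show ?thesis by simp
qed

text \<open>The two estimates in \<open>qc\<close> add up to 9/512 < 1/4. At most n^2 colors occur,
  each with at most (\<Delta> choose k) flaws of total weight at most 1/512; the resulting bound is
  rounded up generously.\<close>

lemma sum_limit_potential_le:
  "(\<Sum>\<sigma> | \<sigma> permutes {..<n}. limit_potential \<sigma>) \<le> of_nat (n\<^sup>2) * fact n"
proof -
  define q where "q = flaw_prob n s k"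
  have q0: "0 \<le> q" by (simp add: q_def flaw_prob_def)
  have qc: "q * real (\<Delta> choose k) \<le> 1 / 512"
    "q * (2 * real n * real k * real (\<Delta> - 1 choose (k - 1))) \<le> 8 / 512"
    using flaw_prob_bounds(2,3)[OF k s_less \<Delta>] by (simp_all add: q_def)
  have fin: "finite {\<sigma>. \<sigma> permutes {..<n}}" by (rule finite_permutations) simp
  have "(\<Sum>\<sigma> | \<sigma> permutes {..<n}. limit_potential \<sigma>)
    \<le> ennreal (2 * q * card flaws) * of_nat (card {\<sigma>. \<sigma> permutes {..<n}})"
  proof (rule sum_limit_potential[OF q0 _ _ fin])
    fix K assume "K \<in> flaws"
    then have "q * real (card (nbrs {K})) \<le> q * real ((\<Delta> choose k) + 2 * n * k * ((\<Delta> - 1) choose (k - 1)))"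
      using card_nbrs q0 by (intro mult_left_mono of_nat_mono) auto
    also have "\<dots> \<le> 1 / 4" using qc by (simp add: algebra_simps)
    finally show "q * real (card (nbrs {K})) \<le> 1 / 4" .
  next
    show "flaw_weight * ennreal (fact (n - k) / fact n) = ennreal q"
      by (simp add: flaw_weight_def q_def flaw_prob_def ennreal_mult[symmetric] mult.commute del: binomial_Suc_Suc)
  next
    fix K h assume "K \<in> flaws"
    then show "(\<Sum>\<sigma> | \<sigma> permutes {..<n}. resample n K h \<sigma>) =
      ennreal (fact (n - k) / fact n) * (\<Sum>\<sigma> | \<sigma> permutes {..<n}. h \<sigma>)"
      by (simp add: resample_def flaws_def sum_cells_op flip: sum_distrib_left)
  qed
  also have "\<dots> = ennreal (2 * q * card flaws) * fact n"
    by (simp add: card_permutations[OF refl])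
  also have "\<dots> \<le> ennreal (real (n\<^sup>2)) * fact n"
  proof (intro mult_right_mono ennreal_leI)
    have "2 * q * card flaws \<le> 2 * q * real (n\<^sup>2 * (\<Delta> choose k))"
      using card_flaws q0 by (intro mult_left_mono of_nat_mono) auto
    also have "\<dots> = 2 * real (n\<^sup>2) * (q * real (\<Delta> choose k))" by simp
    also have "\<dots> \<le> 2 * real (n\<^sup>2) * (1 / 512)"
      by (intro mult_left_mono qc) auto
    also have "\<dots> \<le> real (n\<^sup>2)" by simp
    finally show "2 * q * card flaws \<le> real (n\<^sup>2)" .
  qed auto
  finally show ?thesis by (simp add: ennreal_of_nat_eq_real_of_nat)
qed

text \<open>Each of the (|R| choose k) sets of cells of the overfull color is a present flaw, and a
  uniform choice among them has probability 1 / (|R| choose k). Since |R| >= s + 1, this is at most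
  \<open>flaw_weight\<close>, while the present flaws together carry weight at least 1, as
  \<open>limit_potential_step\<close> demands.\<close>

lemma limit_potential_descent:
  assumes \<sigma>: "\<sigma> permutes {..<n}" and "s < card (color_rows C n \<sigma> a)"
  shows "(\<Sum>S | S \<subseteq> color_rows C n \<sigma> a \<and> card S = k. resample n (cells_at \<sigma> S) limit_potential \<sigma>)
      / of_nat (card (color_rows C n \<sigma> a) choose k) + 1 \<le> limit_potential \<sigma>"
proof -
  define R where "R = color_rows C n \<sigma> a"
  define X where "X = {S. S \<subseteq> R \<and> card S = k}"
  define v where "v = ennreal (1 / real (card R choose k))"
  have R: "finite R" "R \<subseteq> {..<n}" by (auto simp: R_def color_rows_def)
  have sR: "Suc s \<le> card R" using assms(2) by (simp add: R_def)
  have finX: "finite X" using R by (simp add: X_def)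
  have cX: "card X = card R choose k" unfolding X_def by (rule n_subsets[OF R(1)])
  have pos: "0 < card R choose k" "0 < Suc s choose k"
    using sR k_le by (simp_all add: zero_less_binomial del: binomial_Suc_Suc)
  have flaw: "cells_at \<sigma> S \<in> flaws" "cells_at \<sigma> S \<subseteq> color_class a" if "S \<in> X" for S
  proof -
    show sub: "cells_at \<sigma> S \<subseteq> color_class a"
      using that permutes_in_image[OF \<sigma>] by (auto simp: X_def R_def cells_at_def color_rows_def color_class_def)
    show "cells_at \<sigma> S \<in> flaws"
      using that R sub partial_matching_cells_at[OF \<sigma>, of S] by (auto simp: flaws_def X_def card_cells_at)
  qed
  have step: "(\<Sum>K\<in>cells_at \<sigma> ` X. v * resample n K limit_potential \<sigma>) + 1 \<le> limit_potential \<sigma>"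
  proof (rule limit_potential_step)
    have "1 / real (card R choose k) \<le> 1 / real (Suc s choose k)"
      using pos binomial_right_mono[OF sR] by (intro divide_left_mono) (auto simp del: binomial_Suc_Suc)
    then show "v \<le> flaw_weight" unfolding v_def flaw_weight_def by (rule ennreal_leI)
    have "(\<Sum>K\<in>cells_at \<sigma> ` X. v) = of_nat (card R choose k) * v"
      by (simp add: card_image inj_cells_at cX)
    also have "\<dots> = 1"
      using pos by (simp add: v_def ennreal_of_nat_eq_real_of_nat flip: ennreal_mult)
    finally show "(\<Sum>K\<in>cells_at \<sigma> ` X. v) \<le> 1" by simp
    show "cells_at \<sigma> ` X \<subseteq> flaws" using flaw by blast
    show "flaw_color K = a" if "K \<in> cells_at \<sigma> ` X" for K
      using that flaw flaw_color_eq by blast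
    have "resample n (cells_at \<sigma> S) (\<lambda>_. 1) \<sigma> = 1" if "S \<in> X" for S
    proof -
      have pm: "partial_matching n (cells_at \<sigma> S)" using flaw that by (simp add: flaws_def)
      have "contains_cells (cells_at \<sigma> S) \<sigma>" by (auto simp: contains_cells_def cells_at_def)
      then show ?thesis
        by (simp add: resample_def cells_op_one[OF pm] flip: ennreal_mult)
    qed
    then have "(\<Sum>K\<in>cells_at \<sigma> ` X. resample n K (\<lambda>_. 1) \<sigma>) = of_nat (card R choose k)"
      by (simp add: sum.reindex[OF inj_cells_at] cX)
    moreover have "1 \<le> flaw_weight * of_nat (card R choose k)"
    proof -
      have "1 \<le> 1 / real (Suc s choose k) * real (card R choose k)"
        using pos binomial_right_mono[OF sR] by (simp del: binomial_Suc_Suc)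
      then have "ennreal 1 \<le> ennreal (1 / real (Suc s choose k) * real (card R choose k))"
        by (rule ennreal_leI)
      also have "\<dots> = flaw_weight * of_nat (card R choose k)"
        unfolding flaw_weight_def ennreal_of_nat_eq_real_of_nat by (rule ennreal_mult) auto
      finally show ?thesis by simp
    qed
    ultimately show "1 \<le> flaw_weight * (\<Sum>K\<in>cells_at \<sigma> ` X. resample n K (\<lambda>_. 1) \<sigma>)" by simp
  qed
  have "(\<Sum>K\<in>cells_at \<sigma> ` X. v * resample n K limit_potential \<sigma>) =
    (\<Sum>S\<in>X. resample n (cells_at \<sigma> S) limit_potential \<sigma>) * v"
    by (simp add: sum.reindex[OF inj_cells_at] sum_distrib_left mult.commute)
  moreover have "v = inverse (of_nat (card R choose k))"
    using pos by (simp add: v_def inverse_ennreal ennreal_of_nat_eq_real_of_nat divide_inverse)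
  ultimately show ?thesis using step by (simp add: divide_ennreal_def X_def R_def)
qed

end

section \<open>Expected running time\<close>

text \<open>\<open>wp c f \<sigma>\<close> is the expectation of the running time of \<open>c\<close> from \<open>\<sigma>\<close> plus the value of \<open>f\<close> at
  the final state. The value \<open>\<infinity>\<close> of \<open>f\<close> marks states that must not be reached.\<close>

primrec wp :: "com \<Rightarrow> (state \<Rightarrow> ennreal) \<Rightarrow> state \<Rightarrow> ennreal" where
  "wp Skip f = f"
| "wp (Assign x i e) f = (\<lambda>\<sigma>. 1 + f (update x (aval i \<sigma>) (aval e \<sigma>) \<sigma>))"
| "wp (Flip x i) f =
     (\<lambda>\<sigma>. 1 + (f (update x (aval i \<sigma>) 1 \<sigma>) + f (update x (aval i \<sigma>) 0 \<sigma>)) / 2)"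
| "wp (Seq c1 c2) f = wp c1 (\<lambda>\<sigma>. 1 + wp c2 f \<sigma>)"
| "wp (Cond b c1 c2) f = (\<lambda>\<sigma>. 1 + (if bval b \<sigma> then wp c1 f \<sigma> else wp c2 f \<sigma>))"
| "wp (Loop b c) f = lfp (\<lambda>X \<sigma>. 2 + (if bval b \<sigma> then wp c (\<lambda>\<sigma>'. 1 + X \<sigma>') \<sigma> else f \<sigma>))"

lemma wp_mono: "f \<le> g \<Longrightarrow> wp c f \<le> wp c g"
proof (induction c arbitrary: f g)
  case (Flip x i)
  then show ?case
    by (auto simp: le_fun_def intro!: add_left_mono divide_right_mono_ennreal add_mono)
next
  case (Seq c1 c2)
  show ?case
    unfolding wp.simps by (rule Seq.IH(1)) (use Seq in \<open>simp add: le_fun_def\<close>)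
next
  case (Cond b c1 c2)
  then show ?case by (simp add: le_fun_def)
next
  case (Loop b c)
  show ?case
    unfolding wp.simps
    by (rule lfp_mono) (use Loop.prems in \<open>auto simp: le_fun_def\<close>)
qed (auto simp: le_fun_def)

lemma wp_mono': "(\<And>\<sigma>. f \<sigma> \<le> g \<sigma>) \<Longrightarrow> wp c f \<sigma> \<le> wp c g \<sigma>"
  using wp_mono[of f g c] by (simp add: le_fun_def)

lemma mono_loop:
  "mono (\<lambda>(X :: state \<Rightarrow> ennreal) \<sigma>. 2 + (if bval b \<sigma> then wp c (\<lambda>\<sigma>'. 1 + X \<sigma>') \<sigma> else f \<sigma>))"
proof (rule monoI, rule le_funI)
  fix X Y :: "state \<Rightarrow> ennreal" and \<sigma>
  assume "X \<le> Y"
  then have "wp c (\<lambda>\<sigma>'. 1 + X \<sigma>') \<sigma> \<le> wp c (\<lambda>\<sigma>'. 1 + Y \<sigma>') \<sigma>"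
    by (intro wp_mono') (auto simp: le_fun_def)
  then show "2 + (if bval b \<sigma> then wp c (\<lambda>\<sigma>'. 1 + X \<sigma>') \<sigma> else f \<sigma>)
    \<le> 2 + (if bval b \<sigma> then wp c (\<lambda>\<sigma>'. 1 + Y \<sigma>') \<sigma> else f \<sigma>)" by simp
qed

lemma wp_Loop_unfold:
  "wp (Loop b c) f \<sigma> =
    2 + (if bval b \<sigma> then wp c (\<lambda>\<sigma>'. 1 + wp (Loop b c) f \<sigma>') \<sigma> else f \<sigma>)"
  unfolding wp.simps by (subst lfp_unfold[OF mono_loop]) simp

text \<open>Park induction: any pre-fixed point bounds the least one. It covers loops that halt only
  almost surely, with no separate termination argument.\<close>

lemma wp_Loop_le:
  assumes "\<And>\<sigma>. bval b \<sigma> \<Longrightarrow> 2 + wp c (\<lambda>\<sigma>'. 1 + I \<sigma>') \<sigma> \<le> I \<sigma>"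
    and "\<And>\<sigma>. \<not> bval b \<sigma> \<Longrightarrow> 2 + f \<sigma> \<le> I \<sigma>"
  shows "wp (Loop b c) f \<sigma> \<le> I \<sigma>"
proof -
  have "wp (Loop b c) f \<le> I"
    unfolding wp.simps by (rule lfp_lowerbound) (use assms in \<open>auto simp: le_fun_def\<close>)
  then show ?thesis by (simp add: le_fun_def)
qed

text \<open>The constants in \<open>wp\<close> are those of the small-step semantics: a loop round
  takes one step to unfold and one to test, and a finished first component of \<open>Seq\<close>
  takes one step to be discarded.\<close>

lemma step_wp:
  "c \<noteq> Skip \<Longrightarrow> 1 + (\<integral>\<^sup>+cf. wp (fst cf) f (snd cf) \<partial>step (c, \<sigma>)) = wp c f \<sigma>"
proof (induction c arbitrary: f)
  case (Flip x i)
  then show ?case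
    by (simp add: divide_ennreal_def algebra_simps add_divide_distrib_ennreal)
next
  case (Seq c1 c2)
  show ?case
  proof (cases "c1 = Skip")
    case False
    then show ?thesis
      using Seq.IH(1)[of "\<lambda>\<sigma>. 1 + wp c2 f \<sigma>"] by (simp add: split_def)
  qed simp
next
  case (Loop b c)
  have "1 + (1 + (if bval b \<sigma> then wp c (\<lambda>\<sigma>'. 1 + wp (Loop b c) f \<sigma>') \<sigma> else f \<sigma>)) = wp (Loop b c) f \<sigma>"
    by (subst (2) wp_Loop_unfold) (simp flip: add.assoc)
  then show ?case by (cases "bval b \<sigma>") (simp_all del: wp.simps(6))
qed auto

text \<open>Amortization: the steps spent so far plus the expected \<open>wp\<close> of the current
  configuration never exceed the initial \<open>wp\<close>.\<close>

lemma wp_run: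
  "(\<Sum>j<k. ennreal (measure_pmf.prob (run j (c, \<sigma>)) {cf. fst cf \<noteq> Skip})) +
    (\<integral>\<^sup>+cf. wp (fst cf) f (snd cf) \<partial>run k (c, \<sigma>)) \<le> wp c f \<sigma>"
proof (induction k)
  case (Suc k)
  let ?V = "\<lambda>cf. wp (fst cf) f (snd cf)"
  let ?N = "{cf :: com \<times> state. fst cf \<noteq> Skip}"
  have step: "indicator ?N cf + (\<integral>\<^sup>+cf'. ?V cf' \<partial>step cf) \<le> ?V cf" for cf
    using step_wp[where c = "fst cf" and \<sigma> = "snd cf" and f = f] by (cases "fst cf = Skip"; cases cf) auto
  have "ennreal (measure_pmf.prob (run k (c, \<sigma>)) ?N) + (\<integral>\<^sup>+cf. ?V cf \<partial>run (Suc k) (c, \<sigma>)) =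
    (\<integral>\<^sup>+cf. indicator ?N cf + (\<integral>\<^sup>+cf'. ?V cf' \<partial>step cf) \<partial>run k (c, \<sigma>))"
    by (simp add: nn_integral_add measure_pmf.emeasure_eq_measure)
  also have "\<dots> \<le> (\<integral>\<^sup>+cf. ?V cf \<partial>run k (c, \<sigma>))"
    by (intro nn_integral_mono step)
  finally show ?case
    using Suc by (simp add: add.assoc) (meson add_left_mono order_trans)
qed simp

text \<open>Letting the number of steps grow in \<open>wp_run\<close> bounds the expected time. A
  reachable wrong output has positive probability and value \<infinity>, so it would make
  \<open>wp\<close> infinite.\<close>

lemma wp_sound:
  assumes "wp P (\<lambda>\<tau>. if Q \<tau> then 0 else \<infinity>) \<sigma> \<le> of_nat t"
  shows "computes_in_expected_time P \<sigma> Q t"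
  unfolding computes_in_expected_time_def
proof (intro conjI allI impI)
  let ?f = "\<lambda>\<tau>. if Q \<tau> then 0 else \<infinity> :: ennreal"
  have "expected_time P \<sigma> = (SUP k. \<Sum>j<k. ennreal (measure_pmf.prob (run j (P, \<sigma>)) {cf. fst cf \<noteq> Skip}))"
    unfolding expected_time_def by (rule suminf_eq_SUP)
  also have "\<dots> \<le> of_nat t"
  proof (rule SUP_least)
    fix k
    show "(\<Sum>j<k. ennreal (measure_pmf.prob (run j (P, \<sigma>)) {cf. fst cf \<noteq> Skip})) \<le> of_nat t"
      by (rule order_trans[OF _ order_trans[OF wp_run[where k = k] assms]]) (auto intro: add_increasing2)
  qed
  finally show "expected_time P \<sigma> \<le> of_nat t" .
next
  let ?f = "\<lambda>\<tau>. if Q \<tau> then 0 else \<infinity> :: ennreal"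
  let ?V = "\<lambda>cf. wp (fst cf) ?f (snd cf)"
  fix k \<tau> assume \<tau>: "(Skip, \<tau>) \<in> set_pmf (run k (P, \<sigma>))"
  show "Q \<tau>"
  proof (rule ccontr)
    assume "\<not> Q \<tau>"
    have "(\<integral>\<^sup>+cf. ?V cf * indicator {(Skip, \<tau>)} cf \<partial>run k (P, \<sigma>)) \<le> (\<integral>\<^sup>+cf. ?V cf \<partial>run k (P, \<sigma>))"
      by (intro nn_integral_mono) (auto simp: indicator_def)
    also have "\<dots> \<le> wp P ?f \<sigma>"
      by (rule order_trans[OF _ wp_run[where k = k]]) (auto intro: add_increasing)
    also have "\<dots> < \<infinity>" using assms by (rule le_less_trans) (simp add: of_nat_less_top)
    finally have "(\<integral>\<^sup>+cf. ?V cf * indicator {(Skip, \<tau>)} cf \<partial>run k (P, \<sigma>)) < \<infinity>" .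
    moreover have "(\<integral>\<^sup>+cf. ?V cf * indicator {(Skip, \<tau>)} cf \<partial>run k (P, \<sigma>)) =
      (\<integral>\<^sup>+cf. \<infinity> * indicator {(Skip, \<tau>)} cf \<partial>run k (P, \<sigma>))"
      by (intro nn_integral_cong) (use \<open>\<not> Q \<tau>\<close> in \<open>auto simp: indicator_def\<close>)
    moreover have "\<dots> = \<infinity> * emeasure (run k (P, \<sigma>)) {(Skip, \<tau>)}"
      by (rule nn_integral_cmult_indicator) simp
    moreover have "emeasure (run k (P, \<sigma>)) {(Skip, \<tau>)} \<noteq> 0"
      using \<tau> by (simp add: emeasure_pmf_single set_pmf_iff)
    ultimately show False by (simp add: ennreal_top_mult)
  qed
qed

text \<open>A worst-case triple for phases without coin flips, where expectations would be a burden.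
  Quantifying over \<open>f\<close> allows any continuation of the program to be inserted, and
  \<open>b\<close> bounds its cost on all final states alike.\<close>

definition takes :: "com \<Rightarrow> state \<Rightarrow> nat \<Rightarrow> (state \<Rightarrow> bool) \<Rightarrow> bool" where
  "takes c \<sigma> t Q \<longleftrightarrow> (\<forall>f b. (\<forall>\<sigma>'. Q \<sigma>' \<longrightarrow> f \<sigma>' \<le> b) \<longrightarrow> wp c f \<sigma> \<le> of_nat t + b)"

lemma takesI: "(\<And>f b. (\<And>\<sigma>'. Q \<sigma>' \<Longrightarrow> f \<sigma>' \<le> b) \<Longrightarrow> wp c f \<sigma> \<le> of_nat t + b) \<Longrightarrow> takes c \<sigma> t Q"
  by (simp add: takes_def)

lemma takesD: "takes c \<sigma> t Q \<Longrightarrow> (\<And>\<sigma>'. Q \<sigma>' \<Longrightarrow> f \<sigma>' \<le> b) \<Longrightarrow> wp c f \<sigma> \<le> of_nat t + b"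
  by (simp add: takes_def)

lemma takes_weaken:
  assumes "takes c \<sigma> t Q" "t \<le> t'" "\<And>\<sigma>'. Q \<sigma>' \<Longrightarrow> Q' \<sigma>'"
  shows "takes c \<sigma> t' Q'"
proof (rule takesI)
  fix f :: "state \<Rightarrow> ennreal" and b assume "\<And>\<sigma>'. Q' \<sigma>' \<Longrightarrow> f \<sigma>' \<le> b"
  then have "wp c f \<sigma> \<le> of_nat t + b" using assms by (intro takesD[OF assms(1)]) auto
  also have "\<dots> \<le> of_nat t' + b" using assms(2) by (intro add_right_mono) simp
  finally show "wp c f \<sigma> \<le> of_nat t' + b" .
qed

lemma takes_Skip: "Q \<sigma> \<Longrightarrow> takes Skip \<sigma> 0 Q"
  by (simp add: takes_def)

lemma takes_Assign: "Q (update x (aval i \<sigma>) (aval e \<sigma>) \<sigma>) \<Longrightarrow> takes (Assign x i e) \<sigma> 1 Q"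
  by (simp add: takes_def)

lemma takes_Seq:
  assumes "takes c1 \<sigma> t1 Q1" "\<And>\<sigma>'. Q1 \<sigma>' \<Longrightarrow> takes c2 \<sigma>' t2 Q"
  shows "takes (Seq c1 c2) \<sigma> (t1 + t2 + 1) Q"
proof (rule takesI)
  fix f :: "state \<Rightarrow> ennreal" and b assume f: "\<And>\<sigma>'. Q \<sigma>' \<Longrightarrow> f \<sigma>' \<le> b"
  have "wp c1 (\<lambda>\<sigma>. 1 + wp c2 f \<sigma>) \<sigma> \<le> of_nat t1 + (1 + (of_nat t2 + b))"
    using assms(2) f by (intro takesD[OF assms(1)] add_left_mono) (auto intro: takesD)
  then show "wp (Seq c1 c2) f \<sigma> \<le> of_nat (t1 + t2 + 1) + b" by (simp add: ac_simps)
qed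

lemma takes_Cond:
  assumes "bval b \<sigma> \<Longrightarrow> takes c1 \<sigma> t Q" "\<not> bval b \<sigma> \<Longrightarrow> takes c2 \<sigma> t Q"
  shows "takes (Cond b c1 c2) \<sigma> (t + 1) Q"
proof (rule takesI)
  fix f :: "state \<Rightarrow> ennreal" and a assume "\<And>\<sigma>'. Q \<sigma>' \<Longrightarrow> f \<sigma>' \<le> a"
  then have "(if bval b \<sigma> then wp c1 f \<sigma> else wp c2 f \<sigma>) \<le> of_nat t + a"
    using assms by (auto intro: takesD)
  then show "wp (Cond b c1 c2) f \<sigma> \<le> of_nat (t + 1) + a"
    by (simp add: ac_simps add_left_mono)
qed

text \<open>\<open>d\<close> is the exact number of remaining rounds. Each round adds two steps for
  unfolding and test and one for leaving the body; the failing test costs the final 2.\<close>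

lemma takes_Loop:
  assumes guard: "\<And>d \<sigma>. I d \<sigma> \<Longrightarrow> bval b \<sigma> \<longleftrightarrow> 0 < d"
    and body: "\<And>d \<sigma>. I (Suc d) \<sigma> \<Longrightarrow> takes c \<sigma> t (I d)"
    and "I d \<sigma>"
  shows "takes (Loop b c) \<sigma> (d * (t + 3) + 2) (I 0)"
proof (rule takesI)
  fix f :: "state \<Rightarrow> ennreal" and a assume f: "\<And>\<sigma>'. I 0 \<sigma>' \<Longrightarrow> f \<sigma>' \<le> a"
  from assms(3) show "wp (Loop b c) f \<sigma> \<le> of_nat (d * (t + 3) + 2) + a"
  proof (induction d arbitrary: \<sigma>)
    case 0
    then show ?case
      using guard[of 0 \<sigma>] f[of \<sigma>] by (subst wp_Loop_unfold) (simp add: add_left_mono)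
  next
    case (Suc d)
    have "wp c (\<lambda>\<sigma>'. 1 + wp (Loop b c) f \<sigma>') \<sigma> \<le> of_nat t + (1 + (of_nat (d * (t + 3) + 2) + a))"
      by (rule takesD[OF body[OF Suc.prems]]) (intro add_left_mono Suc.IH)
    then have "2 + wp c (\<lambda>\<sigma>'. 1 + wp (Loop b c) f \<sigma>') \<sigma> \<le> 2 + (of_nat t + (1 + (of_nat (d * (t + 3) + 2) + a)))"
      by (rule add_left_mono)
    also have "\<dots> = of_nat (2 + t + 1 + (d * (t + 3) + 2)) + a"
      by (simp only: of_nat_add of_nat_numeral of_nat_1 add.assoc)
    also have "2 + t + 1 + (d * (t + 3) + 2) = Suc d * (t + 3) + 2" by simp
    finally show ?case
      using guard[OF Suc.prems] by (subst wp_Loop_unfold) (simp del: wp.simps)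
  qed
qed

section \<open>Uniform sampling by coin flips\<close>

abbreviation var :: "vname \<Rightarrow> aexp" where
  "var x \<equiv> Elem x (Lit 0)"

abbreviation set_var :: "vname \<Rightarrow> aexp \<Rightarrow> com" where
  "set_var x e \<equiv> Assign x (Lit 0) e"

text \<open>From r = 0 and p = 1, \<open>p\<close> runs through the powers of two until it reaches
  \<open>n\<close>, and \<open>r\<close> stays uniform below \<open>p\<close>.\<close>

definition random_bits :: com where
  "random_bits = Loop (Less (var ''p'') (var ''n''))
    (Seq (Flip ''b'' (Lit 0))
      (Seq (set_var ''r'' (Add (Add (var ''r'') (var ''r'')) (var ''b'')))
        (set_var ''p'' (Add (var ''p'') (var ''p'')))))"

text \<open>Starting with \<open>r = n\<close> makes the guard of the rejection loop fail initially.\<close>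

definition draw :: "bexp \<Rightarrow> com" where
  "draw g = Seq (set_var ''r'' (var ''n''))
    (Loop (Neg (Conj (Less (var ''r'') (var ''n'')) g))
      (Seq (set_var ''r'' (Lit 0)) (Seq (set_var ''p'' (Lit 1)) random_bits)))"

definition same_rest :: "state \<Rightarrow> state \<Rightarrow> bool" where
  "same_rest \<sigma> \<sigma>' \<longleftrightarrow> (\<forall>x. x \<notin> {''r'', ''p'', ''b''} \<longrightarrow> \<sigma>' x = \<sigma> x)"

lemma sum_lessThan_add: "(\<Sum>y<m + k. g y) = (\<Sum>x<m. g x) + (\<Sum>x<(k::nat). g (m + x) :: ennreal)"
  by (induction k) (simp_all add: add.assoc)

lemma half_sum_ennreal: "(x + u + (x + v)) / 2 = x + ennreal (1 / 2) * (u + v)"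
proof -
  have half: "y / 2 = ennreal (1 / 2) * y" for y
    by (simp add: divide_ennreal_def mult.commute)
  have "x + u + (x + v) = 2 * x + (u + v)" unfolding mult_2 by (simp only: ac_simps)
  moreover have "ennreal (1 / 2) * 2 = 1"
    by (subst ennreal_numeral[symmetric], subst ennreal_mult[symmetric]) auto
  then have "ennreal (1 / 2) * (2 * x) = x" by (metis mult.assoc mult_1)
  ultimately show ?thesis unfolding half by (simp only: distrib_left)
qed

text \<open>Generalized for induction to an arbitrary prefix in \<open>r\<close> with
  \<open>d\<close> bits missing; the assumptions on \<open>p\<close> make \<open>d\<close> the exact
  number of doublings to come. The final values with this prefix form an interval of length 2^d,
  split in half by the next bit. A bit costs 8 steps.\<close>

lemma wp_random_bits:
  assumes "\<sigma> ''n'' 0 = n" "n \<le> \<sigma> ''p'' 0 * 2 ^ d" "d = 0 \<or> \<sigma> ''p'' 0 * 2 ^ (d - 1) < n"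
    and "\<And>\<sigma>'. same_rest \<sigma> \<sigma>' \<Longrightarrow> f \<sigma>' \<le> F (\<sigma>' ''r'' 0)"
  shows "wp random_bits f \<sigma> \<le> of_nat (8 * d + 2) +
    ennreal (1 / 2 ^ d) * (\<Sum>x<2 ^ d. F (\<sigma> ''r'' 0 * 2 ^ d + x))"
  using assms
proof (induction d arbitrary: \<sigma>)
  case 0
  then have "f \<sigma> \<le> F (\<sigma> ''r'' 0)" by (simp add: same_rest_def)
  then show ?case
    using 0 unfolding random_bits_def by (subst wp_Loop_unfold) (simp add: add_left_mono)
next
  case (Suc d)
  define a where "a = \<sigma> ''r'' 0"
  define p where "p = \<sigma> ''p'' 0"
  define \<tau> where "\<tau> e = update ''p'' 0 (p + p) (update ''r'' 0 (a + a + e) (update ''b'' 0 e \<sigma>))" for e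
  define S where "S e = (\<Sum>x<2 ^ d. F ((a + a + e) * 2 ^ d + x))" for e
  have less: "p < n"
    using Suc.prems(3) by (simp add: p_def) (metis le_less_trans mult.right_neutral mult_le_mono2 one_le_numeral one_le_power)
  have IH: "wp random_bits f (\<tau> e) \<le> of_nat (8 * d + 2) + ennreal (1 / 2 ^ d) * S e" for e
  proof -
    have "wp random_bits f (\<tau> e) \<le> of_nat (8 * d + 2) +
      ennreal (1 / 2 ^ d) * (\<Sum>x<2 ^ d. F (\<tau> e ''r'' 0 * 2 ^ d + x))"
    proof (rule Suc.IH)
      show "\<tau> e ''n'' 0 = n" using Suc.prems(1) by (simp add: \<tau>_def update_def)
      show "n \<le> \<tau> e ''p'' 0 * 2 ^ d" using Suc.prems(2) by (simp add: \<tau>_def update_def p_def algebra_simps)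
      show "d = 0 \<or> \<tau> e ''p'' 0 * 2 ^ (d - 1) < n"
        using Suc.prems(3) by (cases d) (simp_all add: \<tau>_def update_def p_def algebra_simps)
      show "f \<sigma>' \<le> F (\<sigma>' ''r'' 0)" if "same_rest (\<tau> e) \<sigma>'" for \<sigma>'
        by (rule Suc.prems(4)) (use that in \<open>auto simp: same_rest_def \<tau>_def update_def\<close>)
    qed
    then show ?thesis by (simp add: \<tau>_def update_def S_def)
  qed
  have "wp random_bits f \<sigma> = 2 + (1 + ((5 + wp random_bits f (\<tau> 1)) + (5 + wp random_bits f (\<tau> 0))) / 2)"
    unfolding random_bits_def
    by (subst wp_Loop_unfold)
      (use less Suc.prems(1) in \<open>simp add: p_def \<tau>_def a_def update_def del: wp.simps(6) flip: add.assoc\<close>)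
  also have "\<dots> \<le> 2 + (1 + ((5 + (of_nat (8 * d + 2) + ennreal (1 / 2 ^ d) * S 1)) + (5 + (of_nat (8 * d + 2) + ennreal (1 / 2 ^ d) * S 0))) / 2)"
    by (intro add_left_mono divide_right_mono_ennreal add_mono order_refl IH)
  also have "\<dots> = 2 + (1 + ((5 + of_nat (8 * d + 2)) + ennreal (1 / 2) * (ennreal (1 / 2 ^ d) * S 1 + ennreal (1 / 2 ^ d) * S 0)))"
    using half_sum_ennreal[of "5 + of_nat (8 * d + 2)" "ennreal (1 / 2 ^ d) * S 1" "ennreal (1 / 2 ^ d) * S 0"]
    by (simp only: add.assoc)
  also have "ennreal (1 / 2) * (ennreal (1 / 2 ^ d) * S 1 + ennreal (1 / 2 ^ d) * S 0) =
      ennreal (1 / 2) * ennreal (1 / 2 ^ d) * (S 0 + S 1)"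
    by (simp only: distrib_left mult.assoc add.commute)
  also have "2 + (1 + ((5 + of_nat (8 * d + 2)) + ennreal (1 / 2) * ennreal (1 / 2 ^ d) * (S 0 + S 1))) =
      of_nat (2 + 1 + 5 + (8 * d + 2)) + ennreal (1 / 2) * ennreal (1 / 2 ^ d) * (S 0 + S 1)"
    by (simp only: of_nat_add of_nat_numeral of_nat_1 add.assoc)
  also have "2 + 1 + 5 + (8 * d + 2) = 8 * Suc d + 2" by simp
  also have "ennreal (1 / 2) * ennreal (1 / 2 ^ d) = ennreal (1 / 2 ^ Suc d)"
    by (subst ennreal_mult[symmetric]) auto
  also have "S 0 + S 1 = (\<Sum>x<2 ^ d + 2 ^ d. F (a * 2 ^ Suc d + x))"
    unfolding sum_lessThan_add S_def
    by (rule arg_cong2[where f = "(+)"]; rule sum.cong[OF refl], rule arg_cong[where f = F],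
        simp add: distrib_right mult.left_commute[of a 2])
  also have "2 ^ d + 2 ^ d = (2 ^ Suc d :: nat)" by simp
  finally show ?case by (simp add: a_def)
qed

lemma exists_bit_length:
  assumes "1 \<le> (n::nat)"
  shows "\<exists>J\<le>n. n \<le> 2 ^ J \<and> (J = 0 \<or> 2 ^ (J - 1) < n) \<and> 2 ^ J \<le> 2 * n"
proof -
  define J where "J = (LEAST J. n \<le> 2 ^ J)"
  have n: "n \<le> 2 ^ n" using less_exp[of n] by simp
  have J: "n \<le> 2 ^ J" unfolding J_def by (rule LeastI) (rule n)
  have "J \<le> n" unfolding J_def by (rule Least_le) (rule n)
  moreover have *: "J = 0 \<or> 2 ^ (J - 1) < n"
    using not_less_Least[of "J - 1" "\<lambda>J. n \<le> 2 ^ J"] by (cases J) (auto simp: J_def[symmetric])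
  moreover have "2 ^ J \<le> 2 * n" using * assms by (cases J) auto
  ultimately show ?thesis using J by blast
qed

text \<open>M T + S / N is a pre-fixed point of the rejection recursion: a trial costs T, succeeds
  with probability N / P, and on success is uniform on N values with total cost S. The expected
  number of trials P / N is at most M.\<close>

lemma rejection_inequality:
  fixes N P :: nat and T M :: real
  assumes "1 \<le> N" "N \<le> P" "real P \<le> M" "0 \<le> T"
  shows "ennreal T + ennreal (1 / P) * (S + of_nat (P - N) * (ennreal (M * T) + ennreal (1 / N) * S))
    \<le> ennreal (M * T) + ennreal (1 / N) * S"
proof (cases S)
  case (real u)
  have MT: "0 \<le> M * T" using assms by auto
  have eq: "T + 1 / P * (u + real (P - N) * (M * T + 1 / N * u)) = T + M * T - N / P * (M * T) + 1 / N * u"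
    using assms by (simp add: of_nat_diff field_simps)
  have "T \<le> N / P * (M * T)"
  proof -
    have "T * P \<le> T * M" using assms by (intro mult_left_mono) auto
    also have "\<dots> \<le> N * (T * M)" using assms mult_right_mono[of 1 "real N" "T * M"] by auto
    finally show ?thesis using assms by (simp add: field_simps)
  qed
  then have le: "T + 1 / P * (u + real (P - N) * (M * T + 1 / N * u)) \<le> M * T + 1 / N * u"
    unfolding eq by simp
  define A where "A = M * T + 1 / N * u"
  have A: "0 \<le> A" using MT real by (simp add: A_def)
  have eq1: "ennreal (M * T) + ennreal (1 / N) * S = ennreal A"
    unfolding A_def using MT real by (subst ennreal_plus) (simp_all flip: ennreal_mult)
  define B where "B = u + real (P - N) * A"
  have B: "0 \<le> B" using A real by (simp add: B_def)
  have eq2: "S + of_nat (P - N) * ennreal A = ennreal B"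
    unfolding B_def using A real by (subst ennreal_plus) (simp_all add: ennreal_of_nat_eq_real_of_nat flip: ennreal_mult)
  have "ennreal T + ennreal (1 / P) * (S + of_nat (P - N) * (ennreal (M * T) + ennreal (1 / N) * S)) =
    ennreal T + ennreal (1 / P) * ennreal B"
    unfolding eq1 eq2 ..
  also have "\<dots> = ennreal (T + 1 / P * B)"
    using B assms(4) by (subst ennreal_plus) (auto simp flip: ennreal_mult)
  also have "\<dots> \<le> ennreal A" unfolding A_def B_def by (rule ennreal_leI[OF le])
  also have "\<dots> = ennreal (M * T) + ennreal (1 / N) * S" by (rule eq1[symmetric])
  finally show ?thesis .
next
  case top
  then show ?thesis using assms by (simp add: ennreal_mult_top)
qed

text \<open>At most 2 n expected trials, as the range 2^J is at most 2 n and one accepted value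
  suffices; a trial takes at most 8 n + 11 steps, as J is at most n.\<close>

definition draw_time :: "nat \<Rightarrow> nat" where
  "draw_time n = 2 * n * (8 * n + 11) + 2"

lemma wp_draw:
  fixes F :: "nat \<Rightarrow> ennreal"
  assumes n: "\<sigma> ''n'' 0 = n" and G: "G \<subseteq> {..<n}" "G \<noteq> {}"
    and g: "\<And>\<sigma>'. same_rest \<sigma> \<sigma>' \<Longrightarrow> \<sigma>' ''r'' 0 < n \<Longrightarrow> bval g \<sigma>' \<longleftrightarrow> \<sigma>' ''r'' 0 \<in> G"
    and F: "\<And>\<sigma>'. same_rest \<sigma> \<sigma>' \<Longrightarrow> \<sigma>' ''r'' 0 \<in> G \<Longrightarrow> f \<sigma>' \<le> F (\<sigma>' ''r'' 0)"
  shows "wp (draw g) f \<sigma> \<le> of_nat (draw_time n) + ennreal (1 / card G) * (\<Sum>x\<in>G. F x)"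
proof -
  have n1: "1 \<le> n" using G by (cases n) auto
  obtain J where J: "J \<le> n" "n \<le> 2 ^ J" "J = 0 \<or> 2 ^ (J - 1) < n" "2 ^ J \<le> 2 * n"
    using exists_bit_length[OF n1] by blast
  define P :: nat where "P = 2 ^ J"
  define N where "N = card G"
  define S where "S = (\<Sum>x\<in>G. F x)"
  define T where "T = 8 * n + 11"
  define X where "X = of_nat (2 * n * T) + ennreal (1 / N) * S"
  define Z where "Z y = (if y \<in> G then F y else X)" for y
  \<comment> \<open>The pre-fixed point for \<open>wp_Loop_le\<close>: the 2 pays for the failing
    guard, and \<infinity> disposes of states that differ from \<sigma> outside the scratch
    variables.\<close>
  define I where "I \<sigma>' = (if same_rest \<sigma> \<sigma>' then (if \<sigma>' ''r'' 0 \<in> G then 2 + F (\<sigma>' ''r'' 0) else X) else \<infinity>)" for \<sigma>'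
  have finG: "finite G" using G(1) finite_subset by blast
  have N: "1 \<le> N" "N \<le> P"
  proof -
    show "1 \<le> N" using G finG by (simp add: N_def Suc_le_eq card_gt_0_iff)
    have "N \<le> card {..<n}" unfolding N_def by (intro card_mono G) auto
    then show "N \<le> P" using J by (simp add: P_def)
  qed
  have key: "of_nat T + ennreal (1 / P) * (\<Sum>y<P. Z y) \<le> X"
  proof -
    have GP: "G \<subseteq> {..<P}" using G(1) J(2) by (auto simp: P_def)
    then have "(\<Sum>y<P. Z y) = (\<Sum>y\<in>G. Z y) + (\<Sum>y\<in>{..<P} - G. Z y)"
      by (subst sum.subset_diff[of G]) (simp_all add: add.commute)
    also have "(\<Sum>y\<in>G. Z y) = S" by (simp add: Z_def S_def)
    also have "(\<Sum>y\<in>{..<P} - G. Z y) = (\<Sum>y\<in>{..<P} - G. X)" by (intro sum.cong) (auto simp: Z_def)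
    also have "\<dots> = of_nat (P - N) * X"
      using GP finG by (simp add: N_def card_Diff_subset)
    finally have "(\<Sum>y<P. Z y) = S + of_nat (P - N) * X" .
    then show ?thesis
      using rejection_inequality[OF N, of "real (2 * n)" "real T" S] J(4)
      by (simp add: X_def ennreal_of_nat_eq_real_of_nat P_def flip: of_nat_mult)
  qed
  have loop: "wp (Loop (Neg (Conj (Less (var ''r'') (var ''n'')) g))
      (Seq (set_var ''r'' (Lit 0)) (Seq (set_var ''p'' (Lit 1)) random_bits))) f \<sigma>' \<le> I \<sigma>'" for \<sigma>'
  proof (rule wp_Loop_le)
    fix \<sigma>' assume "bval (Neg (Conj (Less (var ''r'') (var ''n'')) g)) \<sigma>'"
    then have guard: "\<not> (\<sigma>' ''r'' 0 < \<sigma>' ''n'' 0 \<and> bval g \<sigma>')" by simp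
    show "2 + wp (Seq (set_var ''r'' (Lit 0)) (Seq (set_var ''p'' (Lit 1)) random_bits)) (\<lambda>\<sigma>'. 1 + I \<sigma>') \<sigma>' \<le> I \<sigma>'"
    proof (cases "same_rest \<sigma> \<sigma>'")
      case True
      define \<tau> where "\<tau> = update ''p'' 0 1 (update ''r'' 0 0 \<sigma>')"
      have n': "\<sigma>' ''n'' 0 = n" using True n by (simp add: same_rest_def)
      have notin: "\<sigma>' ''r'' 0 \<notin> G"
        using guard g[OF True] G(1) n' by auto
      have "wp random_bits (\<lambda>\<sigma>'. 1 + I \<sigma>') \<tau> \<le> of_nat (8 * J + 2) +
        ennreal (1 / 2 ^ J) * (\<Sum>x<2 ^ J. (\<lambda>y. 3 + Z y) (\<tau> ''r'' 0 * 2 ^ J + x))"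
      proof (rule wp_random_bits)
        show "\<tau> ''n'' 0 = n" using n' by (simp add: \<tau>_def update_def)
        show "n \<le> \<tau> ''p'' 0 * 2 ^ J" using J by (simp add: \<tau>_def update_def)
        show "J = 0 \<or> \<tau> ''p'' 0 * 2 ^ (J - 1) < n" using J by (simp add: \<tau>_def update_def)
        show "1 + I \<rho> \<le> 3 + Z (\<rho> ''r'' 0)" if "same_rest \<tau> \<rho>" for \<rho>
        proof -
          have "same_rest \<sigma> \<rho>"
            using that True by (auto simp: same_rest_def \<tau>_def update_def)
          then show ?thesis
            by (auto simp: I_def Z_def add_right_mono simp flip: add.assoc)
        qed
      qed
      also have "\<dots> = of_nat (8 * J + 2) + ennreal (1 / P) * (of_nat P * 3 + (\<Sum>y<P. Z y))"
        by (simp add: \<tau>_def update_def sum.distrib P_def)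
      also have "\<dots> = of_nat (8 * J + 5) + ennreal (1 / P) * (\<Sum>y<P. Z y)"
      proof -
        have "ennreal (1 / P) * (of_nat P * 3) = 3"
          using N by (simp add: ennreal_of_nat_eq_real_of_nat flip: mult.assoc ennreal_mult)
        then show ?thesis by (simp add: distrib_left flip: add.assoc)
      qed
      finally have bits: "wp random_bits (\<lambda>\<sigma>'. 1 + I \<sigma>') \<tau> \<le> of_nat (8 * J + 5) + ennreal (1 / P) * (\<Sum>y<P. Z y)" .
      have "2 + wp (Seq (set_var ''r'' (Lit 0)) (Seq (set_var ''p'' (Lit 1)) random_bits)) (\<lambda>\<sigma>'. 1 + I \<sigma>') \<sigma>' =
        of_nat 6 + wp random_bits (\<lambda>\<sigma>'. 1 + I \<sigma>') \<tau>"
        by (simp add: \<tau>_def flip: add.assoc)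
      also have "\<dots> \<le> of_nat 6 + (of_nat (8 * J + 5) + ennreal (1 / P) * (\<Sum>y<P. Z y))"
        by (intro add_left_mono bits)
      also have "\<dots> = of_nat (6 + (8 * J + 5)) + ennreal (1 / P) * (\<Sum>y<P. Z y)"
        by (simp only: of_nat_add add.assoc)
      also have "\<dots> \<le> of_nat T + ennreal (1 / P) * (\<Sum>y<P. Z y)"
        using J(1) by (intro add_right_mono of_nat_mono) (simp add: T_def)
      also have "\<dots> \<le> X" by (rule key)
      finally show ?thesis using True notin by (simp add: I_def)
    qed (simp add: I_def)
  next
    fix \<sigma>' assume "\<not> bval (Neg (Conj (Less (var ''r'') (var ''n'')) g)) \<sigma>'"
    then have guard: "\<sigma>' ''r'' 0 < \<sigma>' ''n'' 0" "bval g \<sigma>'" by simp_all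
    show "2 + f \<sigma>' \<le> I \<sigma>'"
    proof (cases "same_rest \<sigma> \<sigma>'")
      case True
      then have "\<sigma>' ''n'' 0 = n" using n by (simp add: same_rest_def)
      then have "\<sigma>' ''r'' 0 \<in> G" using guard g[OF True] by simp
      then show ?thesis using F[OF True] True by (simp add: I_def add_left_mono)
    qed (simp add: I_def)
  qed
  have "wp (draw g) f \<sigma> \<le> 1 + (1 + I (update ''r'' 0 n \<sigma>))"
    unfolding draw_def using n by (simp del: wp.simps(6) One_nat_def add: add_left_mono loop)
  also have "I (update ''r'' 0 n \<sigma>) = X"
    using G(1) by (auto simp: I_def same_rest_def update_def)
  finally show ?thesis
    by (simp add: X_def draw_time_def T_def N_def S_def ac_simps)
qed

section \<open>The phases of the program\<close>

abbreviation equal_exp :: "aexp \<Rightarrow> aexp \<Rightarrow> bexp" where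
  "equal_exp e e' \<equiv> Conj (Neg (Less e e')) (Neg (Less e' e))"

abbreviation cell_color :: "vname \<Rightarrow> aexp" where
  "cell_color x \<equiv> Elem ''A'' (Add (Elem ''off'' (var x)) (Elem ''pi'' (var x)))"

abbreviation increment :: "vname \<Rightarrow> com" where
  "increment x \<equiv> set_var x (Add (var x) (Lit 1))"

text \<open>The mark of row \<open>i\<close> is cleared before the draw: the row may then be its own
  partner, and exactly the rows whose cells still await resampling are excluded.\<close>

definition shuffle_loop :: com where
  "shuffle_loop = Loop (Less (var ''i'') (var ''n''))
    (Seq
      (Cond (Less (Lit 0) (Elem ''mk'' (var ''i'')))
        (Seq (Assign ''mk'' (var ''i'') (Lit 0))
          (Seq (draw (Less (Elem ''mk'' (var ''r'')) (Lit 1)))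
            (Seq (set_var ''t'' (Elem ''pi'' (var ''i'')))
              (Seq (Assign ''pi'' (var ''i'') (Elem ''pi'' (var ''r'')))
                (Assign ''pi'' (var ''r'') (var ''t''))))))
        Skip)
      (increment ''i''))"

definition shuffle :: com where
  "shuffle = Seq (set_var ''i'' (Lit 0)) shuffle_loop"

definition count_loop :: com where
  "count_loop = Loop (Less (var ''j'') (var ''n''))
    (Seq (Cond (equal_exp (cell_color ''j'') (cell_color ''i'')) (increment ''cnt'') Skip)
      (increment ''j''))"

definition check_loop :: com where
  "check_loop = Loop (Less (var ''i'') (var ''n''))
    (Seq (set_var ''cnt'' (Lit 0)) (Seq (set_var ''j'' (Lit 0)) (Seq count_loop
      (Seq (Cond (Less (var ''s'') (var ''cnt''))
          (Seq (set_var ''flag'' (Lit 1)) (set_var ''q'' (var ''i''))) Skip)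
        (increment ''i'')))))"

definition check :: com where
  "check = Seq (set_var ''flag'' (Lit 0)) (Seq (set_var ''i'' (Lit 0)) check_loop)"

definition mark_loop :: com where
  "mark_loop = Loop (Less (Lit 0) (var ''m''))
    (Seq (draw (Conj (Less (Elem ''mk'' (var ''r'')) (Lit 1)) (equal_exp (cell_color ''r'') (cell_color ''q''))))
      (Seq (Assign ''mk'' (var ''r'') (Lit 1)) (set_var ''m'' (Sub (var ''m'') (Lit 1)))))"

definition mark :: com where
  "mark = Seq (set_var ''m'' (var ''k'')) mark_loop"

definition main_loop :: com where
  "main_loop = Loop (Less (Lit 0) (var ''flag''))
    (Seq shuffle (Seq check (Cond (Less (Lit 0) (var ''flag'')) mark Skip)))"

text \<open>The identity is put outside the rows, as \<open>permutes\<close> requires.\<close>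

definition perm_of :: "nat \<Rightarrow> state \<Rightarrow> nat \<Rightarrow> nat" where
  "perm_of n \<sigma> i = (if i < n then \<sigma> ''pi'' i else i)"

definition marks :: "nat \<Rightarrow> state \<Rightarrow> nat set" where
  "marks n \<sigma> = {i. i < n \<and> 0 < \<sigma> ''mk'' i}"

definition ready :: "nat \<Rightarrow> nat \<Rightarrow> nat \<Rightarrow> (nat \<Rightarrow> nat \<Rightarrow> nat) \<Rightarrow> state \<Rightarrow> bool" where
  "ready n s k C \<sigma> \<longleftrightarrow> \<sigma> ''n'' 0 = n \<and> \<sigma> ''s'' 0 = s \<and> \<sigma> ''k'' 0 = k \<and>
    (\<forall>i<n. \<forall>j<n. \<sigma> ''A'' (\<sigma> ''off'' i + j) = C i j) \<and> perm_of n \<sigma> permutes {..<n}"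

lemma ready_color:
  assumes "ready n s k C \<sigma>" "i < n"
  shows "\<sigma> ''A'' (\<sigma> ''off'' i + \<sigma> ''pi'' i) = C i (perm_of n \<sigma> i)"
  using assms permutes_in_image[of "perm_of n \<sigma>" "{..<n}" i] by (auto simp: ready_def perm_of_def)

lemma update_apply: "update x k v \<sigma> y j = (if y = x \<and> j = k then v else \<sigma> y j)"
  by (simp add: update_def)

lemma update_other: "y \<noteq> x \<Longrightarrow> update x k v \<sigma> y = \<sigma> y"
  by (simp add: update_def)

lemma resample_empty: "resample n {} F \<sigma> = F \<sigma>"
  by (simp add: resample_def cells_op_empty)

text \<open>One exchange peels one cell off the operator product. Rows in S - {i} contribute 0 to
  the product because the exchange destroys their cell, so the sum runs over \<open>G\<close>; its
  size n - |S| + 1 is the quotient of the two normalizations.\<close>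

lemma resample_exchange:
  assumes \<pi>: "\<pi> permutes {..<n}" and S: "S \<subseteq> {..<n}" "i \<in> S"
  defines "G \<equiv> {..<n} - (S - {i})"
  shows "ennreal (1 / card G) * (\<Sum>x\<in>G. resample n (cells_at (exchange i x \<pi>) (S - {i})) F (exchange i x \<pi>)) =
    resample n (cells_at \<pi> S) F \<pi>"
proof -
  define K where "K = cells_at \<pi> (S - {i})"
  have finS: "finite S" using S finite_subset by blast
  have pm: "partial_matching n (cells_at \<pi> S)" "partial_matching n K"
    using S unfolding K_def by (auto intro!: partial_matching_cells_at[OF \<pi>])
  have ins: "cells_at \<pi> S = insert (i, \<pi> i) K" "(i, \<pi> i) \<notin> K"
    using S(2) by (auto simp: K_def cells_at_def)
  have cS: "1 \<le> card S" "card S \<le> n"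
    using S finS card_mono[OF _ S(1)] by (auto simp: Suc_le_eq card_gt_0_iff)
  have cK: "card K = card S - 1" using S finS by (simp add: K_def card_cells_at)
  have cG: "card G = n - (card S - 1)"
    using S finS by (simp add: G_def card_Diff_subset subset_iff)
  have "cells_op n (cells_at \<pi> S) F \<pi> = (\<Sum>x<n. cells_op n K F (exchange i x \<pi>))"
    using pm ins by (simp add: cells_op_insert(1) cell_op_def)
  also have "\<dots> = (\<Sum>x\<in>G. cells_op n K F (exchange i x \<pi>))"
  proof (rule sum.mono_neutral_right)
    show "\<forall>x\<in>{..<n} - G. cells_op n K F (exchange i x \<pi>) = 0"
    proof
      fix x assume "x \<in> {..<n} - G"
      then have x: "x \<in> S" "x \<noteq> i" by (auto simp: G_def)
      have "exchange i x \<pi> x \<noteq> \<pi> x"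
        using x permutes_inj[OF \<pi>] by (auto simp: exchange_def inj_eq)
      then show "cells_op n K F (exchange i x \<pi>) = 0"
        using x by (intro cells_op_absent[OF pm(2), of x "\<pi> x"]) (auto simp: K_def cells_at_def)
    qed
  qed (auto simp: G_def)
  finally have op: "cells_op n (cells_at \<pi> S) F \<pi> = (\<Sum>x\<in>G. cells_op n K F (exchange i x \<pi>))" .
  have "cells_at (exchange i x \<pi>) (S - {i}) = K" if "x \<in> G" for x
    using that by (auto simp: K_def cells_at_def exchange_def G_def)
  then have "(\<Sum>x\<in>G. resample n (cells_at (exchange i x \<pi>) (S - {i})) F (exchange i x \<pi>)) =
      ennreal (fact (n - card K) / fact n) * cells_op n (cells_at \<pi> S) F \<pi>"
    by (simp add: resample_def op sum_distrib_left)
  moreover have "ennreal (1 / card G) * ennreal (fact (n - card K) / fact n) = ennreal (fact (n - card S) / fact n)"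
  proof -
    have "n - card K = Suc (n - card S)" "card G = Suc (n - card S)" using cS cK cG by auto
    then have "1 / real (card G) * (fact (n - card K) / fact n) = fact (n - card S) / fact n"
      by (simp add: field_simps del: of_nat_Suc)
    then show ?thesis by (subst ennreal_mult[symmetric]) auto
  qed
  ultimately show ?thesis by (simp add: resample_def card_cells_at flip: mult.assoc)
qed

definition swap_time :: "nat \<Rightarrow> nat" where
  "swap_time n = draw_time n + 14"

lemma average_const:
  fixes G :: "'a set"
  assumes "finite G" "G \<noteq> {}"
  shows "ennreal (1 / card G) * (\<Sum>x\<in>G. c + h x) = c + ennreal (1 / card G) * (\<Sum>x\<in>G. h x)"
proof -
  have "0 < card G" using assms by (simp add: card_gt_0_iff)
  then have "ennreal (1 / card G) * of_nat (card G) = 1"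
    unfolding ennreal_of_nat_eq_real_of_nat by (subst ennreal_mult[symmetric]) auto
  then have "ennreal (1 / card G) * (of_nat (card G) * c) = c" by (metis mult.assoc mult_1)
  then show ?thesis by (simp add: sum.distrib distrib_left)
qed

text \<open>The program treats rows in increasing order, while \<open>resample\<close> has no order;
  so \<open>resample_exchange\<close> at the current marked row is the induction step.\<close>

lemma wp_shuffle_loop:
  assumes "ready n s k C \<sigma>" "marks n \<sigma> \<subseteq> {\<sigma> ''i'' 0..}" "\<sigma> ''i'' 0 + d = n"
    and "\<And>\<sigma>'. ready n s k C \<sigma>' \<Longrightarrow> marks n \<sigma>' = {} \<Longrightarrow> f \<sigma>' \<le> F (perm_of n \<sigma>')"
  shows "wp shuffle_loop f \<sigma> \<le> of_nat (d * swap_time n + 2) +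
    resample n (cells_at (perm_of n \<sigma>) (marks n \<sigma>)) F (perm_of n \<sigma>)"
  using assms(1-3)
proof (induction d arbitrary: \<sigma>)
  case 0
  then have "marks n \<sigma> = {}" by (auto simp: marks_def)
  then show ?case
    using 0 assms(4)[of \<sigma>] unfolding shuffle_loop_def
    by (subst wp_Loop_unfold) (simp add: ready_def cells_at_def resample_empty add_left_mono)
next
  case (Suc d)
  define i where "i = \<sigma> ''i'' 0"
  define \<pi> where "\<pi> = perm_of n \<sigma>"
  define S where "S = marks n \<sigma>"
  define \<rho> where "\<rho> = resample n (cells_at \<pi> S) F \<pi>"
  have i: "i < n" "\<sigma> ''i'' 0 = i" "\<sigma> ''n'' 0 = n" using Suc.prems by (auto simp: i_def ready_def)
  have \<pi>: "\<pi> permutes {..<n}" using Suc.prems by (simp add: \<pi>_def ready_def)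
  show ?case
  proof (cases "i \<in> S")
    case False
    define \<sigma>1 where "\<sigma>1 = update ''i'' 0 (i + 1) \<sigma>"
    have same: "perm_of n \<sigma>1 = \<pi>" "marks n \<sigma>1 = S"
      by (auto simp: \<sigma>1_def update_def \<pi>_def S_def perm_of_def marks_def fun_eq_iff)
    have "wp shuffle_loop f \<sigma>1 \<le> of_nat (d * swap_time n + 2) +
        resample n (cells_at (perm_of n \<sigma>1) (marks n \<sigma>1)) F (perm_of n \<sigma>1)"
    proof (rule Suc.IH)
      show "ready n s k C \<sigma>1"
        using Suc.prems(1) same(1) unfolding ready_def \<pi>_def by (simp add: \<sigma>1_def update_def)
      have "S \<subseteq> {i..}" using Suc.prems by (simp add: S_def i_def)
      then have "S \<subseteq> {i + 1..}" using False by (force simp: Suc_le_eq le_less)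
      then show "marks n \<sigma>1 \<subseteq> {\<sigma>1 ''i'' 0..}" unfolding same(2) by (simp add: \<sigma>1_def update_def)
      show "\<sigma>1 ''i'' 0 + d = n" using Suc.prems by (simp add: \<sigma>1_def update_def i_def)
    qed
    then have IH: "wp shuffle_loop f \<sigma>1 \<le> of_nat (d * swap_time n + 2) + \<rho>"
      by (simp only: same \<rho>_def)
    have "wp shuffle_loop f \<sigma> = of_nat 6 + wp shuffle_loop f \<sigma>1"
      using False i unfolding shuffle_loop_def
      by (subst wp_Loop_unfold)
        (simp add: \<sigma>1_def S_def marks_def del: wp.simps(6) flip: add.assoc)
    also have "\<dots> \<le> of_nat 6 + (of_nat (d * swap_time n + 2) + \<rho>)" by (intro add_left_mono IH)
    also have "\<dots> = of_nat (6 + (d * swap_time n + 2)) + \<rho>" by (simp only: of_nat_add add.assoc)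
    also have "\<dots> \<le> of_nat (Suc d * swap_time n + 2) + \<rho>"
      by (intro add_right_mono of_nat_mono) (simp add: swap_time_def)
    finally show ?thesis by (simp add: \<rho>_def \<pi>_def S_def)
  next
    case True
    define \<sigma>0 where "\<sigma>0 = update ''mk'' i 0 \<sigma>"
    define G where "G = {..<n} - (S - {i})"
    define \<sigma>2 where "\<sigma>2 \<tau> = update ''i'' 0 (\<tau> ''i'' 0 + 1)
      (update ''pi'' (\<tau> ''r'' 0) (\<tau> ''pi'' (\<tau> ''i'' 0))
        (update ''pi'' (\<tau> ''i'' 0) (\<tau> ''pi'' (\<tau> ''r'' 0))
          (update ''t'' 0 (\<tau> ''pi'' (\<tau> ''i'' 0)) \<tau>)))" for \<tau> :: state
    have Sn: "S \<subseteq> {..<n}" by (auto simp: S_def marks_def)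
    have G: "finite G" "G \<noteq> {}" "G \<subseteq> {..<n}" using i by (auto simp: G_def)
    have after: "9 + wp shuffle_loop f (\<sigma>2 \<tau>) \<le> (\<lambda>x. of_nat (9 + (d * swap_time n + 2)) +
        resample n (cells_at (exchange i x \<pi>) (S - {i})) F (exchange i x \<pi>)) (\<tau> ''r'' 0)"
      if \<tau>: "same_rest \<sigma>0 \<tau>" "\<tau> ''r'' 0 \<in> G" for \<tau>
    proof -
      define x where "x = \<tau> ''r'' 0"
      have x: "x < n" using \<tau>(2) G by (auto simp: x_def)
      have vals: "\<tau> ''pi'' = \<sigma> ''pi''" "\<tau> ''mk'' = (\<sigma> ''mk'')(i := 0)" "\<tau> ''n'' = \<sigma> ''n''"
        "\<tau> ''s'' = \<sigma> ''s''" "\<tau> ''k'' = \<sigma> ''k''" "\<tau> ''A'' = \<sigma> ''A''" "\<tau> ''off'' = \<sigma> ''off''"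
        "\<tau> ''i'' 0 = i"
        using \<tau>(1) i by (auto simp: same_rest_def \<sigma>0_def update_def)
      have perm2: "perm_of n (\<sigma>2 \<tau>) = exchange i x \<pi>"
        using x i by (auto simp: fun_eq_iff perm_of_def \<sigma>2_def update_def vals exchange_def \<pi>_def x_def[symmetric])
      have marks2: "marks n (\<sigma>2 \<tau>) = S - {i}"
        by (auto simp: marks_def \<sigma>2_def update_def vals S_def)
      have "wp shuffle_loop f (\<sigma>2 \<tau>) \<le> of_nat (d * swap_time n + 2) +
          resample n (cells_at (perm_of n (\<sigma>2 \<tau>)) (marks n (\<sigma>2 \<tau>))) F (perm_of n (\<sigma>2 \<tau>))"
      proof (rule Suc.IH)
        show "ready n s k C (\<sigma>2 \<tau>)"
          using Suc.prems(1) exchange_permutes[OF \<pi> i(1) x] unfolding ready_def perm2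
          by (simp add: \<sigma>2_def update_def vals)
        have "S \<subseteq> {i..}" using Suc.prems by (simp add: S_def i_def)
        then have "S - {i} \<subseteq> {i + 1..}" by (force simp: Suc_le_eq le_less)
        then show "marks n (\<sigma>2 \<tau>) \<subseteq> {\<sigma>2 \<tau> ''i'' 0..}"
          unfolding marks2 by (simp add: \<sigma>2_def update_def vals)
        show "\<sigma>2 \<tau> ''i'' 0 + d = n" using Suc.prems by (simp add: \<sigma>2_def update_def vals i_def)
      qed
      then have "9 + wp shuffle_loop f (\<sigma>2 \<tau>) \<le> of_nat 9 + (of_nat (d * swap_time n + 2) +
          resample n (cells_at (exchange i x \<pi>) (S - {i})) F (exchange i x \<pi>))"
        unfolding perm2 marks2 by (simp add: add_left_mono)
      then show ?thesis by (simp only: of_nat_add add.assoc x_def)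
    qed
    have drawn: "wp (draw (Less (Elem ''mk'' (var ''r'')) (Lit 1))) (\<lambda>\<tau>. 9 + wp shuffle_loop f (\<sigma>2 \<tau>)) \<sigma>0
      \<le> of_nat (draw_time n) + ennreal (1 / card G) * (\<Sum>x\<in>G. of_nat (9 + (d * swap_time n + 2)) +
          resample n (cells_at (exchange i x \<pi>) (S - {i})) F (exchange i x \<pi>))"
    proof (rule wp_draw)
      show "\<sigma>0 ''n'' 0 = n" using i by (simp add: \<sigma>0_def update_def)
      fix \<tau> assume \<tau>: "same_rest \<sigma>0 \<tau>" "\<tau> ''r'' 0 < n"
      have "\<tau> ''mk'' = (\<sigma> ''mk'')(i := 0)" using \<tau>(1) by (auto simp: same_rest_def \<sigma>0_def update_def)
      then show "bval (Less (Elem ''mk'' (var ''r'')) (Lit 1)) \<tau> \<longleftrightarrow> \<tau> ''r'' 0 \<in> G"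
        using \<tau>(2) by (auto simp: G_def S_def marks_def)
    qed (use G after in auto)
    have eq: "wp shuffle_loop f \<sigma> = of_nat 5 +
      wp (draw (Less (Elem ''mk'' (var ''r'')) (Lit 1))) (\<lambda>\<tau>. 9 + wp shuffle_loop f (\<sigma>2 \<tau>)) \<sigma>0"
      using True i unfolding shuffle_loop_def
      by (subst wp_Loop_unfold)
        (simp add: \<sigma>0_def \<sigma>2_def S_def marks_def update_apply del: wp.simps(6) flip: add.assoc)
    also have "\<dots> \<le> of_nat 5 + (of_nat (draw_time n) + (of_nat (9 + (d * swap_time n + 2)) + \<rho>))"
      using drawn
      unfolding average_const[OF G(1,2)] resample_exchange[OF \<pi> Sn True, folded G_def] \<rho>_def[symmetric]
      by (rule add_left_mono)
    also have "\<dots> = of_nat (5 + (draw_time n + (9 + (d * swap_time n + 2)))) + \<rho>"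
      by (simp only: of_nat_add add.assoc)
    also have "5 + (draw_time n + (9 + (d * swap_time n + 2))) = Suc d * swap_time n + 2"
      by (simp add: swap_time_def)
    finally show ?thesis by (simp add: \<rho>_def \<pi>_def S_def)
  qed
qed


lemma wp_shuffle:
  assumes "ready n s k C \<sigma>"
    and "\<And>\<sigma>'. ready n s k C \<sigma>' \<Longrightarrow> marks n \<sigma>' = {} \<Longrightarrow> f \<sigma>' \<le> F (perm_of n \<sigma>')"
  shows "wp shuffle f \<sigma> \<le> of_nat (n * swap_time n + 4) +
    resample n (cells_at (perm_of n \<sigma>) (marks n \<sigma>)) F (perm_of n \<sigma>)"
proof -
  define \<sigma>1 where "\<sigma>1 = update ''i'' 0 0 \<sigma>"
  have same: "perm_of n \<sigma>1 = perm_of n \<sigma>" "marks n \<sigma>1 = marks n \<sigma>"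
    by (auto simp: \<sigma>1_def update_def perm_of_def marks_def fun_eq_iff)
  have "wp shuffle_loop f \<sigma>1 \<le> of_nat (n * swap_time n + 2) +
    resample n (cells_at (perm_of n \<sigma>1) (marks n \<sigma>1)) F (perm_of n \<sigma>1)"
  proof (rule wp_shuffle_loop)
    show "ready n s k C \<sigma>1" using assms(1) unfolding ready_def same by (simp add: \<sigma>1_def update_def)
  qed (use assms in \<open>auto simp: \<sigma>1_def update_def\<close>)
  then have le: "of_nat 2 + wp shuffle_loop f \<sigma>1 \<le> of_nat 2 + (of_nat (n * swap_time n + 2) +
    resample n (cells_at (perm_of n \<sigma>) (marks n \<sigma>)) F (perm_of n \<sigma>))"
    unfolding same by (rule add_left_mono)
  have "wp shuffle f \<sigma> = of_nat 2 + wp shuffle_loop f \<sigma>1"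
    by (simp add: shuffle_def \<sigma>1_def flip: add.assoc)
  also have "\<dots> \<le> of_nat 2 + (of_nat (n * swap_time n + 2) +
    resample n (cells_at (perm_of n \<sigma>) (marks n \<sigma>)) F (perm_of n \<sigma>))" by (rule le)
  also have "\<dots> = of_nat (2 + (n * swap_time n + 2)) +
    resample n (cells_at (perm_of n \<sigma>) (marks n \<sigma>)) F (perm_of n \<sigma>)"
    by (simp only: of_nat_add add.assoc)
  also have "2 + (n * swap_time n + 2) = n * swap_time n + 4" by simp
  finally show ?thesis .
qed

definition keeps :: "state \<Rightarrow> state \<Rightarrow> bool" where
  "keeps \<sigma> \<sigma>' \<longleftrightarrow> (\<forall>x\<in>{''n'', ''s'', ''k'', ''A'', ''off'', ''pi'', ''mk''}. \<sigma>' x = \<sigma> x)"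

lemma keeps_update:
  "x \<notin> {''n'', ''s'', ''k'', ''A'', ''off'', ''pi'', ''mk''} \<Longrightarrow> keeps \<sigma> (update x j v \<sigma>') \<longleftrightarrow> keeps \<sigma> \<sigma>'"
  by (auto simp: keeps_def update_def)

lemma keepsD:
  assumes "keeps \<sigma> \<sigma>'"
  shows "ready n s k C \<sigma>' \<longleftrightarrow> ready n s k C \<sigma>" "perm_of n \<sigma>' = perm_of n \<sigma>" "marks n \<sigma>' = marks n \<sigma>"
proof -
  show p: "perm_of n \<sigma>' = perm_of n \<sigma>" and "marks n \<sigma>' = marks n \<sigma>"
    using assms by (auto simp: keeps_def perm_of_def marks_def fun_eq_iff)
  show "ready n s k C \<sigma>' \<longleftrightarrow> ready n s k C \<sigma>"
    unfolding ready_def p using assms by (simp add: keeps_def)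
qed

lemma takes_count_loop:
  assumes "ready n s k C \<sigma>" "\<sigma> ''i'' 0 < n" "\<sigma> ''j'' 0 = 0" "\<sigma> ''cnt'' 0 = 0"
  defines "\<pi> \<equiv> perm_of n \<sigma>"
  shows "takes count_loop \<sigma> (n * 7 + 2) (\<lambda>\<sigma>'. keeps \<sigma> \<sigma>' \<and>
    (\<forall>x\<in>{''i'', ''flag'', ''q''}. \<sigma>' x = \<sigma> x) \<and>
    \<sigma>' ''cnt'' 0 = card (color_rows C n \<pi> (C (\<sigma> ''i'' 0) (\<pi> (\<sigma> ''i'' 0)))))"
proof -
  define a where "a = C (\<sigma> ''i'' 0) (\<pi> (\<sigma> ''i'' 0))"
  define I where "I d \<sigma>' \<longleftrightarrow> keeps \<sigma> \<sigma>' \<and> (\<forall>x\<in>{''i'', ''flag'', ''q''}. \<sigma>' x = \<sigma> x) \<and>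
    \<sigma>' ''j'' 0 + d = n \<and> \<sigma>' ''cnt'' 0 = card {j. j < \<sigma>' ''j'' 0 \<and> C j (\<pi> j) = a}" for d \<sigma>'
  have n: "\<sigma>' ''n'' 0 = n" if "I d \<sigma>'" for d \<sigma>'
    using that assms(1) by (simp add: I_def keeps_def ready_def)
  have "takes count_loop \<sigma> (n * (4 + 3) + 2) (I 0)"
    unfolding count_loop_def
  proof (rule takes_Loop[where I = I])
    show "bval (Less (var ''j'') (var ''n'')) \<sigma>' \<longleftrightarrow> 0 < d" if "I d \<sigma>'" for d \<sigma>'
      using n[OF that] that by (auto simp: I_def)
    show "I n \<sigma>" using assms(3,4) by (simp add: I_def keeps_def)
    fix d \<sigma>' assume I: "I (Suc d) \<sigma>'"
    define j where "j = \<sigma>' ''j'' 0"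
    have j: "j < n" using I by (auto simp: I_def j_def)
    have ready: "ready n s k C \<sigma>'" and perm: "perm_of n \<sigma>' = \<pi>"
      using I assms(1) keepsD[of \<sigma> \<sigma>'] by (auto simp: I_def \<pi>_def)
    have col: "aval (cell_color ''j'') \<sigma>' = C j (\<pi> j)" "aval (cell_color ''i'') \<sigma>' = a"
      using ready_color[OF ready] j I assms(2) by (auto simp: perm j_def a_def I_def)
    have set_Suc: "{j'. j' < Suc j \<and> C j' (\<pi> j') = a} =
      (if C j (\<pi> j) = a then insert j {j'. j' < j \<and> C j' (\<pi> j') = a} else {j'. j' < j \<and> C j' (\<pi> j') = a})"
      by (auto simp: less_Suc_eq)
    define c where "c = (if C j (\<pi> j) = a then Suc (\<sigma>' ''cnt'' 0) else \<sigma>' ''cnt'' 0)"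
    have test: "takes (Cond (equal_exp (cell_color ''j'') (cell_color ''i'')) (increment ''cnt'') Skip) \<sigma>' (1 + 1)
      (\<lambda>\<tau>. keeps \<sigma> \<tau> \<and> (\<forall>x\<in>{''i'', ''flag'', ''q'', ''j''}. \<tau> x = \<sigma>' x) \<and> \<tau> ''cnt'' 0 = c)"
    proof (rule takes_Cond)
      assume "bval (equal_exp (cell_color ''j'') (cell_color ''i'')) \<sigma>'"
      then have "C j (\<pi> j) = a" using col by simp
      then show "takes (increment ''cnt'') \<sigma>' 1 (\<lambda>\<tau>. keeps \<sigma> \<tau> \<and> (\<forall>x\<in>{''i'', ''flag'', ''q'', ''j''}. \<tau> x = \<sigma>' x) \<and> \<tau> ''cnt'' 0 = c)"
        using I by (intro takes_Assign) (simp add: keeps_update I_def c_def update_apply update_other)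
    next
      assume "\<not> bval (equal_exp (cell_color ''j'') (cell_color ''i'')) \<sigma>'"
      then have "C j (\<pi> j) \<noteq> a" using col by auto
      then show "takes Skip \<sigma>' 1 (\<lambda>\<tau>. keeps \<sigma> \<tau> \<and> (\<forall>x\<in>{''i'', ''flag'', ''q'', ''j''}. \<tau> x = \<sigma>' x) \<and> \<tau> ''cnt'' 0 = c)"
        using I by (intro takes_weaken[OF takes_Skip[where Q = "\<lambda>\<tau>. \<tau> = \<sigma>'"]]) (auto simp: I_def c_def)
    qed
    have next_row: "takes (increment ''j'') \<tau> 1 (I d)"
      if \<tau>: "keeps \<sigma> \<tau> \<and> (\<forall>x\<in>{''i'', ''flag'', ''q'', ''j''}. \<tau> x = \<sigma>' x) \<and> \<tau> ''cnt'' 0 = c" for \<tau>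
    proof (rule takes_Assign)
      have "card {j'. j' < Suc j \<and> C j' (\<pi> j') = a} = c"
        using I unfolding set_Suc by (auto simp: c_def I_def j_def)
      then show "I d (update ''j'' (aval (Lit 0) \<tau>) (aval (Add (var ''j'') (Lit 1)) \<tau>) \<tau>)"
        using \<tau> I by (simp add: I_def keeps_update update_apply update_other j_def)
    qed
    show "takes (Seq (Cond (equal_exp (cell_color ''j'') (cell_color ''i'')) (increment ''cnt'') Skip)
      (increment ''j'')) \<sigma>' 4 (I d)"
      by (rule takes_weaken[OF takes_Seq[OF test next_row]]) auto
  qed
  then show ?thesis
    by (rule takes_weaken) (auto simp: I_def color_rows_def a_def)
qed

definition check_time :: "nat \<Rightarrow> nat" where
  "check_time n = n * (n * 7 + 16) + 6"

lemma takes_check: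
  assumes "ready n s k C \<sigma>"
  defines "\<pi> \<equiv> perm_of n \<sigma>"
  shows "takes check \<sigma> (check_time n) (\<lambda>\<sigma>'. keeps \<sigma> \<sigma>' \<and>
    (if 0 < \<sigma>' ''flag'' 0
     then \<sigma>' ''q'' 0 < n \<and> s < card (color_rows C n \<pi> (C (\<sigma>' ''q'' 0) (\<pi> (\<sigma>' ''q'' 0))))
     else \<forall>a. card (color_rows C n \<pi> a) \<le> s))"
proof -
  define R where "R i = card (color_rows C n \<pi> (C i (\<pi> i)))" for i
  \<comment> \<open>Once the flag is raised it stays so, and \<open>q\<close> names some overfull
    row; while it is down, all rows before \<open>m\<close> have passed.\<close>
  define V where "V m \<sigma>' \<longleftrightarrow> keeps \<sigma> \<sigma>' \<and>
    (if 0 < \<sigma>' ''flag'' 0 then \<sigma>' ''q'' 0 < n \<and> s < R (\<sigma>' ''q'' 0) else \<forall>i<m. R i \<le> s)" for m \<sigma>'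
  define I where "I d \<sigma>' \<longleftrightarrow> \<sigma>' ''i'' 0 + d = n \<and> V (\<sigma>' ''i'' 0) \<sigma>'" for d \<sigma>'
  have ready: "ready n s k C \<sigma>'" and perm: "perm_of n \<sigma>' = \<pi>" if "keeps \<sigma> \<sigma>'" for \<sigma>'
    using that assms(1) keepsD[of \<sigma> \<sigma>'] by (auto simp: \<pi>_def)
  have loop: "takes check_loop \<sigma>' (n * (n * 7 + 13 + 3) + 2) (I 0)" if "I n \<sigma>'" for \<sigma>'
    unfolding check_loop_def
  proof (rule takes_Loop[where I = I])
    show "bval (Less (var ''i'') (var ''n'')) \<tau> \<longleftrightarrow> 0 < d" if "I d \<tau>" for d \<tau>
    proof -
      have "\<tau> ''n'' 0 = n" using that ready[of \<tau>] by (simp add: I_def V_def ready_def)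
      then show ?thesis using that by (auto simp: I_def)
    qed
    show "I n \<sigma>'" by fact
    fix d \<tau> assume I: "I (Suc d) \<tau>"
    define i where "i = \<tau> ''i'' 0"
    have i: "i < n" using I by (simp add: I_def i_def)
    have keep: "keeps \<sigma> \<tau>" using I by (simp add: I_def V_def)
    let ?same = "\<lambda>\<tau>'. keeps \<sigma> \<tau>' \<and> (\<forall>x\<in>{''i'', ''flag'', ''q''}. \<tau>' x = \<tau> x)"
    have count: "takes count_loop \<tau>' (n * 7 + 2) (\<lambda>\<tau>''. ?same \<tau>'' \<and> \<tau>'' ''cnt'' 0 = R i)"
      if \<tau>': "?same \<tau>' \<and> \<tau>' ''cnt'' 0 = 0 \<and> \<tau>' ''j'' 0 = 0" for \<tau>'
    proof (rule takes_weaken[OF takes_count_loop[OF ready, of \<tau>']])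
      show "keeps \<sigma> \<tau>'" "\<tau>' ''i'' 0 < n" "\<tau>' ''j'' 0 = 0" "\<tau>' ''cnt'' 0 = 0"
        using \<tau>' i by (auto simp: i_def)
      fix \<rho> assume "keeps \<tau>' \<rho> \<and> (\<forall>x\<in>{''i'', ''flag'', ''q''}. \<rho> x = \<tau>' x) \<and>
        \<rho> ''cnt'' 0 = card (color_rows C n (perm_of n \<tau>') (C (\<tau>' ''i'' 0) (perm_of n \<tau>' (\<tau>' ''i'' 0))))"
      then show "?same \<rho> \<and> \<rho> ''cnt'' 0 = R i"
        using \<tau>' perm[of \<tau>'] by (auto simp: R_def i_def keeps_def)
    qed simp
    have test: "takes (Cond (Less (var ''s'') (var ''cnt'')) (Seq (set_var ''flag'' (Lit 1)) (set_var ''q'' (var ''i''))) Skip)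
      \<tau>' (3 + 1) (\<lambda>\<tau>''. \<tau>'' ''i'' 0 = i \<and> V (Suc i) \<tau>'')"
      if \<tau>': "?same \<tau>' \<and> \<tau>' ''cnt'' 0 = R i" for \<tau>'
    proof -
      have s: "\<tau>' ''s'' 0 = s" using \<tau>' ready[of \<tau>'] by (simp add: ready_def)
      show ?thesis
      proof (rule takes_Cond)
        assume "bval (Less (var ''s'') (var ''cnt'')) \<tau>'"
        then have "s < R i" using s \<tau>' by simp
        then have "takes (Seq (set_var ''flag'' (Lit 1)) (set_var ''q'' (var ''i''))) \<tau>' (1 + 1 + 1)
          (\<lambda>\<tau>''. \<tau>'' ''i'' 0 = i \<and> V (Suc i) \<tau>'')"
          using \<tau>' i
          by (intro takes_Seq[OF takes_Assign[where Q = "\<lambda>\<rho>. \<rho> = update ''flag'' 0 1 \<tau>'"]] takes_Assign)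
            (simp_all add: V_def keeps_update update_apply i_def)
        then show "takes (Seq (set_var ''flag'' (Lit 1)) (set_var ''q'' (var ''i''))) \<tau>' 3
          (\<lambda>\<tau>''. \<tau>'' ''i'' 0 = i \<and> V (Suc i) \<tau>'')" by (rule takes_weaken) auto
      next
        assume "\<not> bval (Less (var ''s'') (var ''cnt'')) \<tau>'"
        then have "R i \<le> s" using s \<tau>' by simp
        then have "\<tau>' ''i'' 0 = i \<and> V (Suc i) \<tau>'"
          using \<tau>' I by (auto simp: I_def V_def i_def less_Suc_eq split: if_splits)
        then show "takes Skip \<tau>' 3 (\<lambda>\<tau>''. \<tau>'' ''i'' 0 = i \<and> V (Suc i) \<tau>'')"
          by (intro takes_weaken[OF takes_Skip]) auto
      qed
    qed
    have inc: "takes (increment ''i'') \<tau>' 1 (I d)" if "\<tau>' ''i'' 0 = i \<and> V (Suc i) \<tau>'" for \<tau>'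
      using that I by (intro takes_Assign) (simp add: I_def V_def keeps_update update_apply i_def)
    have "takes (Seq (set_var ''cnt'' (Lit 0)) (Seq (set_var ''j'' (Lit 0)) (Seq count_loop
        (Seq (Cond (Less (var ''s'') (var ''cnt''))
            (Seq (set_var ''flag'' (Lit 1)) (set_var ''q'' (var ''i''))) Skip)
          (increment ''i''))))) \<tau> (1 + (1 + ((n * 7 + 2) + (3 + 1 + 1 + 1) + 1) + 1) + 1) (I d)"
    proof (rule takes_Seq[OF takes_Assign[where Q = "\<lambda>\<tau>'. ?same \<tau>' \<and> \<tau>' ''cnt'' 0 = 0"]])
      show "?same (update ''cnt'' (aval (Lit 0) \<tau>) (aval (Lit 0) \<tau>) \<tau>) \<and>
        update ''cnt'' (aval (Lit 0) \<tau>) (aval (Lit 0) \<tau>) \<tau> ''cnt'' 0 = 0"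
        using keep by (simp add: keeps_update update_apply update_other)
    qed (rule takes_Seq[OF takes_Assign[where Q = "\<lambda>\<tau>'. ?same \<tau>' \<and> \<tau>' ''cnt'' 0 = 0 \<and> \<tau>' ''j'' 0 = 0"]],
        simp add: keeps_update update_apply update_other,
        rule takes_Seq[OF count], assumption, rule takes_Seq[OF test], assumption, rule inc, assumption)
    then show "takes (Seq (set_var ''cnt'' (Lit 0)) (Seq (set_var ''j'' (Lit 0)) (Seq count_loop
        (Seq (Cond (Less (var ''s'') (var ''cnt''))
            (Seq (set_var ''flag'' (Lit 1)) (set_var ''q'' (var ''i''))) Skip)
          (increment ''i''))))) \<tau> (n * 7 + 13) (I d)"
      by (rule takes_weaken) auto
  qed
  \<comment> \<open>Testing the color of every row suffices, since other colors occur zero times in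
    the transversal.\<close>
  have I0: "(if 0 < \<sigma>' ''flag'' 0
     then \<sigma>' ''q'' 0 < n \<and> s < card (color_rows C n \<pi> (C (\<sigma>' ''q'' 0) (\<pi> (\<sigma>' ''q'' 0))))
     else \<forall>a. card (color_rows C n \<pi> a) \<le> s)" if "I 0 \<sigma>'" for \<sigma>'
  proof (cases "0 < \<sigma>' ''flag'' 0")
    case False
    then have R: "R i \<le> s" if "i < n" for i using that \<open>I 0 \<sigma>'\<close> by (simp add: I_def V_def)
    have "card (color_rows C n \<pi> a) \<le> s" for a
    proof (cases "color_rows C n \<pi> a = {}")
      case False
      then obtain i where "i < n" "C i (\<pi> i) = a" by (auto simp: color_rows_def)
      then show ?thesis using R[of i] by (simp add: R_def)
    qed simp
    then show ?thesis using False by simp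
  qed (use that in \<open>auto simp: I_def V_def R_def\<close>)
  have "takes check \<sigma> (1 + (1 + (n * (n * 7 + 13 + 3) + 2) + 1) + 1) (I 0)"
    unfolding check_def
    by (rule takes_Seq[OF takes_Assign[where Q = "\<lambda>\<rho>. \<rho> = update ''flag'' 0 0 \<sigma>"]], simp,
        rule takes_Seq[OF takes_Assign[where Q = "\<lambda>\<rho>. \<rho> = update ''i'' 0 0 (update ''flag'' 0 0 \<sigma>)"]], simp,
        rule loop) (simp add: I_def V_def keeps_update update_apply, simp add: keeps_def)
  then show ?thesis
    by (rule takes_weaken) (use I0 in \<open>auto simp: check_time_def I_def V_def\<close>)
qed

section \<open>Selecting the cells and the main loop\<close>

definition extensions :: "'a set \<Rightarrow> 'a set \<Rightarrow> nat \<Rightarrow> 'a set set" where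
  "extensions R S m = {S'. S \<subseteq> S' \<and> S' \<subseteq> R \<and> card S' = card S + m}"

definition extension_average :: "'a set \<Rightarrow> ('a set \<Rightarrow> ennreal) \<Rightarrow> nat \<Rightarrow> 'a set \<Rightarrow> ennreal" where
  "extension_average R F m S = ennreal (1 / (card R - card S choose m)) * (\<Sum>S'\<in>extensions R S m. F S')"

lemma extension_average_0:
  assumes "finite R" "S \<subseteq> R"
  shows "extension_average R F 0 S = F S"
proof -
  have "extensions R S 0 = {S}"
  proof -
    have "S' = S" if "S \<subseteq> S'" "S' \<subseteq> R" "card S' = card S" for S'
      using that card_subset_eq[of S' S] finite_subset[OF that(2) assms(1)] by simp
    then show ?thesis using assms(2) by (auto simp: extensions_def)
  qed
  then show ?thesis by (simp add: extension_average_def)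
qed

text \<open>Double counting: an extension by m + 1 elements is reached through each of its m + 1 new
  elements, and (m + 1) (N choose m + 1) = N (N - 1 choose m).\<close>

lemma extension_average_Suc:
  assumes R: "finite R" "S \<subseteq> R" and less: "card S < card R"
  shows "ennreal (1 / card (R - S)) * (\<Sum>x\<in>R - S. extension_average R F m (insert x S)) =
    extension_average R F (Suc m) S"
proof -
  define X where "X = extensions R S (Suc m)"
  define N where "N = card R - card S"
  obtain N' where N': "N = Suc N'" using less by (cases N) (auto simp: N_def)
  have finS: "finite S" using R finite_subset by blast
  have cRS: "card (R - S) = N" using R finS by (simp add: N_def card_Diff_subset)
  have finX: "finite X"
    by (rule finite_subset[of _ "Pow R"]) (use R in \<open>auto simp: X_def extensions_def\<close>)
  have ext: "extensions R (insert x S) m = {S' \<in> X. x \<in> S'}" if "x \<in> R - S" for x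
    using that finS by (auto simp: X_def extensions_def)
  have avg: "extension_average R F m (insert x S) =
    ennreal (1 / (N' choose m)) * (\<Sum>S'\<in>X. if x \<in> S' then F S' else 0)" if "x \<in> R - S" for x
  proof -
    have "card (insert x S) = Suc (card S)" "card R - Suc (card S) = N'"
      using that finS N' by (simp_all add: N_def)
    then show ?thesis
      unfolding extension_average_def ext[OF that] using finX by (simp add: sum.inter_filter)
  qed
  have "(\<Sum>x\<in>R - S. extension_average R F m (insert x S)) =
    ennreal (1 / (N' choose m)) * (\<Sum>x\<in>R - S. \<Sum>S'\<in>X. if x \<in> S' then F S' else 0)"
    by (simp add: avg sum_distrib_left)
  also have "(\<Sum>x\<in>R - S. \<Sum>S'\<in>X. if x \<in> S' then F S' else 0) = (\<Sum>S'\<in>X. \<Sum>x\<in>R - S. if x \<in> S' then F S' else 0)"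
    by (rule sum.swap)
  also have "\<dots> = (\<Sum>S'\<in>X. of_nat (Suc m) * F S')"
  proof (rule sum.cong[OF refl])
    fix S' assume S': "S' \<in> X"
    have "{x \<in> R - S. x \<in> S'} = S' - S" using S' by (auto simp: X_def extensions_def)
    moreover have "card (S' - S) = Suc m"
      using S' finS by (simp add: X_def extensions_def card_Diff_subset)
    ultimately have "card {x \<in> R - S. x \<in> S'} = Suc m" by simp
    then show "(\<Sum>x\<in>R - S. if x \<in> S' then F S' else 0) = of_nat (Suc m) * F S'"
      using R(1) by (simp flip: sum.inter_filter)
  qed
  also have "\<dots> = of_nat (Suc m) * sum F X" by (simp only: sum_distrib_left)
  finally have sum: "(\<Sum>x\<in>R - S. extension_average R F m (insert x S)) =
    ennreal (1 / (N' choose m)) * (of_nat (Suc m) * sum F X)" .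
  have "1 / real N * (1 / real (N' choose m) * real (Suc m)) = 1 / real (N choose Suc m)"
  \<comment> \<open>If m is too large, both binomials vanish and the identity holds because division
    by zero gives 0.\<close>
  proof (cases "N' choose m = 0")
    case False
    have "Suc m * (N choose Suc m) = N * (N' choose m)"
      unfolding N' by (rule Suc_times_binomial)
    then have *: "real (Suc m) * real (N choose Suc m) = real N * real (N' choose m)"
      by (metis of_nat_mult)
    have "0 < real N" "0 < real (N' choose m)" using False N' by auto
    moreover from this * have "0 < real (N choose Suc m)"
      by (metis mult_pos_pos of_nat_0_less_iff zero_less_mult_pos zero_less_Suc)
    ultimately show ?thesis using * by (simp add: field_simps del: of_nat_Suc binomial_Suc_Suc)
  qed (simp add: N' binomial_eq_0)
  then have "ennreal (1 / N) * (ennreal (1 / (N' choose m)) * of_nat (Suc m)) = ennreal (1 / (N choose Suc m))"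
    unfolding ennreal_of_nat_eq_real_of_nat
    by (simp only: ennreal_mult[symmetric] divide_nonneg_nonneg mult_nonneg_nonneg of_nat_0_le_iff zero_le_one)
  moreover have rhs: "extension_average R F (Suc m) S = ennreal (1 / (N choose Suc m)) * sum F X"
    by (simp add: extension_average_def X_def N_def)
  ultimately show ?thesis
    unfolding sum cRS rhs
    by (simp only: mult.assoc[symmetric])
qed

definition mark_time :: "nat \<Rightarrow> nat" where
  "mark_time n = n * (draw_time n + 7) + 4"

text \<open>Drawing without replacement yields a uniform set by
  \<open>extension_average_Suc\<close>. The inequality between
  \<open>card (marks n \<sigma>) + m\<close> and \<open>card R\<close> guarantees that an eligible
  row remains, so that rejection sampling can succeed.\<close>

lemma wp_mark_loop:
  fixes n q :: nat and \<pi> :: "nat \<Rightarrow> nat" and C :: "nat \<Rightarrow> nat \<Rightarrow> nat"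
  defines "R \<equiv> color_rows C n \<pi> (C q (\<pi> q))"
  assumes "ready n s k C \<sigma>" "perm_of n \<sigma> = \<pi>" "\<sigma> ''q'' 0 = q" "q < n" "\<sigma> ''flag'' 0 = fl"
    and "marks n \<sigma> \<subseteq> R" "\<sigma> ''m'' 0 = m" "card (marks n \<sigma>) + m \<le> card R"
    and f: "\<And>\<sigma>'. ready n s k C \<sigma>' \<Longrightarrow> perm_of n \<sigma>' = \<pi> \<Longrightarrow> \<sigma>' ''flag'' 0 = fl \<Longrightarrow> f \<sigma>' \<le> F (marks n \<sigma>')"
  shows "wp mark_loop f \<sigma> \<le> of_nat (m * (draw_time n + 7) + 2) + extension_average R F m (marks n \<sigma>)"
  using assms(2-9)
proof (induction m arbitrary: \<sigma>)
  case 0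
  have "finite R" by (simp add: R_def color_rows_def)
  then show ?case
    using 0 f[of \<sigma>] unfolding mark_loop_def
    by (subst wp_Loop_unfold) (simp add: extension_average_0 add_left_mono)
next
  case (Suc m)
  define S where "S = marks n \<sigma>"
  define g where "g = Conj (Less (Elem ''mk'' (var ''r'')) (Lit 1)) (equal_exp (cell_color ''r'') (cell_color ''q''))"
  define \<sigma>2 where "\<sigma>2 \<tau> = update ''m'' 0 (\<tau> ''m'' 0 - 1) (update ''mk'' (\<tau> ''r'' 0) 1 \<tau>)" for \<tau> :: state
  have permutes_\<pi>: "\<pi> permutes {..<n}" using Suc.prems(1,2) by (auto simp: ready_def)
  have R: "finite R" "R \<subseteq> {..<n}" by (auto simp: R_def color_rows_def)
  have SR: "S \<subseteq> R" "card S < card R" using Suc.prems by (auto simp: S_def)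
  have finS: "finite S" using SR R finite_subset by blast
  have ne: "finite (R - S)" "R - S \<noteq> {}"
    using R SR by (auto simp: card_seteq leD dest: card_mono[OF finS])
  have ready_after: "ready n s k C \<tau> \<and> perm_of n \<tau> = \<pi> \<and> marks n \<tau> = S \<and> \<tau> ''q'' 0 = q \<and>
    \<tau> ''flag'' 0 = fl \<and> \<tau> ''m'' 0 = Suc m" if "same_rest \<sigma> \<tau>" for \<tau>
  proof -
    have "keeps \<sigma> \<tau>" using that by (auto simp: keeps_def same_rest_def)
    then show ?thesis
      using keepsD[of \<sigma> \<tau>] Suc.prems that by (simp add: S_def same_rest_def)
  qed
  have after: "5 + wp mark_loop f (\<sigma>2 \<tau>) \<le> (\<lambda>x. of_nat (5 + (m * (draw_time n + 7) + 2)) +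
      extension_average R F m (insert x S)) (\<tau> ''r'' 0)"
    if \<tau>: "same_rest \<sigma> \<tau>" "\<tau> ''r'' 0 \<in> R - S" for \<tau>
  proof -
    define x where "x = \<tau> ''r'' 0"
    have x: "x \<in> R" "x \<notin> S" "x < n" using \<tau>(2) R by (auto simp: x_def)
    note ra = ready_after[OF \<tau>(1)]
    have perm2: "perm_of n (\<sigma>2 \<tau>) = \<pi>"
    proof -
      have "perm_of n (\<sigma>2 \<tau>) = perm_of n \<tau>" by (simp add: \<sigma>2_def perm_of_def update_other fun_eq_iff)
      then show ?thesis using ra by simp
    qed
    have marks2: "marks n (\<sigma>2 \<tau>) = insert x S"
      using ra x by (auto simp: \<sigma>2_def marks_def update_apply x_def)
    have "wp mark_loop f (\<sigma>2 \<tau>) \<le> of_nat (m * (draw_time n + 7) + 2) +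
      extension_average R F m (marks n (\<sigma>2 \<tau>))"
    proof (rule Suc.IH)
      show "ready n s k C (\<sigma>2 \<tau>)" unfolding ready_def perm2
        using ra permutes_\<pi> by (simp add: ready_def \<sigma>2_def update_other)
      show "marks n (\<sigma>2 \<tau>) \<subseteq> R" unfolding marks2 using SR x by simp
      show "card (marks n (\<sigma>2 \<tau>)) + m \<le> card R"
        unfolding marks2 using finS x Suc.prems by (simp add: S_def)
      show "perm_of n (\<sigma>2 \<tau>) = \<pi>" by (rule perm2)
    qed (use ra Suc.prems in \<open>simp_all add: \<sigma>2_def update_apply update_other\<close>)
    then have "5 + wp mark_loop f (\<sigma>2 \<tau>) \<le> of_nat 5 + (of_nat (m * (draw_time n + 7) + 2) +
      extension_average R F m (insert x S))"
      unfolding marks2 by (simp add: add_left_mono)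
    then show ?thesis by (simp only: of_nat_add add.assoc x_def)
  qed
  have drawn: "wp (draw g) (\<lambda>\<tau>. 5 + wp mark_loop f (\<sigma>2 \<tau>)) \<sigma> \<le> of_nat (draw_time n) +
    ennreal (1 / card (R - S)) * (\<Sum>x\<in>R - S. of_nat (5 + (m * (draw_time n + 7) + 2)) +
      extension_average R F m (insert x S))"
  proof (rule wp_draw)
    show "\<sigma> ''n'' 0 = n" using Suc.prems by (simp add: ready_def)
    fix \<tau> assume \<tau>: "same_rest \<sigma> \<tau>" "\<tau> ''r'' 0 < n"
    note ra = ready_after[OF \<tau>(1)]
    have "aval (cell_color ''r'') \<tau> = C (\<tau> ''r'' 0) (\<pi> (\<tau> ''r'' 0))" "aval (cell_color ''q'') \<tau> = C q (\<pi> q)"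
      using ready_color[of n s k C \<tau>] ra \<tau>(2) assms(5) by auto
    moreover have "\<tau> ''mk'' (\<tau> ''r'' 0) < 1 \<longleftrightarrow> \<tau> ''r'' 0 \<notin> S"
      using ra \<tau>(2) by (auto simp: marks_def)
    ultimately show "bval g \<tau> \<longleftrightarrow> \<tau> ''r'' 0 \<in> R - S"
      using \<tau>(2) by (auto simp: g_def R_def color_rows_def)
  qed (use ne R after in auto)
  have "0 < \<sigma> ''m'' 0" using Suc.prems by simp
  then have "wp mark_loop f \<sigma> = of_nat 2 + wp (draw g) (\<lambda>\<tau>. 5 + wp mark_loop f (\<sigma>2 \<tau>)) \<sigma>"
    unfolding mark_loop_def
    by (subst wp_Loop_unfold) (simp add: \<sigma>2_def g_def update_apply update_other del: wp.simps(6) flip: add.assoc)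
  also have "\<dots> \<le> of_nat 2 + (of_nat (draw_time n) + (of_nat (5 + (m * (draw_time n + 7) + 2)) +
      extension_average R F (Suc m) S))"
    using drawn unfolding average_const[OF ne] extension_average_Suc[OF R(1) SR] by (rule add_left_mono)
  also have "\<dots> = of_nat (2 + (draw_time n + (5 + (m * (draw_time n + 7) + 2)))) + extension_average R F (Suc m) S"
    by (simp only: of_nat_add add.assoc)
  also have "2 + (draw_time n + (5 + (m * (draw_time n + 7) + 2))) = Suc m * (draw_time n + 7) + 2" by simp
  finally show ?case by (simp add: S_def)
qed

lemma wp_mark:
  fixes n q :: nat and \<pi> :: "nat \<Rightarrow> nat" and C :: "nat \<Rightarrow> nat \<Rightarrow> nat"
  defines "R \<equiv> color_rows C n \<pi> (C q (\<pi> q))"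
  assumes "ready n s k C \<sigma>" "perm_of n \<sigma> = \<pi>" "\<sigma> ''q'' 0 = q" "q < n" "marks n \<sigma> = {}" "k \<le> card R"
    and f: "\<And>\<sigma>'. ready n s k C \<sigma>' \<Longrightarrow> perm_of n \<sigma>' = \<pi> \<Longrightarrow> \<sigma>' ''flag'' 0 = \<sigma> ''flag'' 0 \<Longrightarrow> f \<sigma>' \<le> F (marks n \<sigma>')"
  shows "wp mark f \<sigma> \<le> of_nat (mark_time n) +
    ennreal (1 / (card R choose k)) * (\<Sum>S | S \<subseteq> R \<and> card S = k. F S)"
proof -
  define \<sigma>1 where "\<sigma>1 = update ''m'' 0 k \<sigma>"
  have keep: "keeps \<sigma> \<sigma>1" unfolding \<sigma>1_def by (simp add: keeps_update) (simp add: keeps_def)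
  have "card R \<le> n"
    using card_mono[of "{..<n}" R] by (auto simp: R_def color_rows_def)
  then have kn: "k \<le> n" using assms(7) by simp
  have le: "wp mark_loop f \<sigma>1 \<le> of_nat (k * (draw_time n + 7) + 2) + extension_average R F k (marks n \<sigma>1)"
    unfolding R_def
    by (rule wp_mark_loop[where s = s and k = k and fl = "\<sigma> ''flag'' 0"])
      (use keepsD[OF keep] assms in \<open>auto simp: \<sigma>1_def update_apply update_other\<close>)
  have "wp mark f \<sigma> = of_nat 2 + wp mark_loop f \<sigma>1"
    using assms(2) by (simp add: mark_def \<sigma>1_def ready_def flip: add.assoc)
  also have "\<dots> \<le> of_nat 2 + (of_nat (k * (draw_time n + 7) + 2) + extension_average R F k (marks n \<sigma>1))"
    by (rule add_left_mono[OF le])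
  also have "\<dots> = of_nat (2 + (k * (draw_time n + 7) + 2)) + extension_average R F k {}"
    using keepsD(3)[OF keep] assms(6) by (simp only: of_nat_add add.assoc)
  also have "\<dots> \<le> of_nat (mark_time n) + extension_average R F k {}"
    using mult_right_mono[OF kn, of "draw_time n + 7"]
    by (intro add_right_mono of_nat_mono) (simp add: mark_time_def)
  finally show ?thesis by (simp add: extension_average_def extensions_def)
qed

definition shuffle_time :: "nat \<Rightarrow> nat" where
  "shuffle_time n = n * swap_time n + 4"

definition round_time :: "nat \<Rightarrow> nat" where
  "round_time n = check_time n + mark_time n + shuffle_time n + 8"

lemma resample_affine:
  assumes pm: "partial_matching n K" and "contains_cells K \<pi>"
  shows "resample n K (\<lambda>\<pi>. b * (1 + \<Phi> \<pi>)) \<pi> = b * (1 + resample n K \<Phi> \<pi>)"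
proof -
  have "resample n K (\<lambda>_. 1) \<pi> = 1"
    using assms(2) by (simp add: resample_def cells_op_one[OF pm] flip: ennreal_mult)
  moreover have "resample n K (\<lambda>\<pi>. b * (1 + \<Phi> \<pi>)) \<pi> =
    b * (resample n K (\<lambda>_. 1) \<pi> + resample n K \<Phi> \<pi>)"
    unfolding resample_def cells_op_scale[OF pm] cells_op_add[OF pm]
    by (simp only: distrib_left mult.left_commute)
  ultimately show ?thesis by simp
qed

lemma divide_of_nat_ennreal: "0 < N \<Longrightarrow> (x::ennreal) / of_nat N = ennreal (1 / real N) * x"
  by (simp add: divide_ennreal_def inverse_ennreal ennreal_of_nat_eq_real_of_nat divide_inverse mult.commute)

text \<open>Amortized bound: a round costs at most \<open>round_time\<close> and lowers \<Phi> by at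
  least 1 in the mean, so \<open>round_time n * (1 + \<Phi>)\<close> pays for all rounds, the extra
  1 for the last one. At the loop head the marked cells are still to be resampled, hence
  \<open>resample\<close> in the bound.\<close>

lemma wp_main_loop:
  fixes \<Phi> :: "(nat \<Rightarrow> nat) \<Rightarrow> ennreal"
  assumes descent: "\<And>\<pi> a. \<pi> permutes {..<n} \<Longrightarrow> s < card (color_rows C n \<pi> a) \<Longrightarrow> k \<le> s \<and>
      (\<Sum>S | S \<subseteq> color_rows C n \<pi> a \<and> card S = k. resample n (cells_at \<pi> S) \<Phi> \<pi>)
        / of_nat (card (color_rows C n \<pi> a) choose k) + 1 \<le> \<Phi> \<pi>"
    and f: "\<And>\<tau>. ready n s k C \<tau> \<Longrightarrow> (\<And>a. card (color_rows C n (perm_of n \<tau>) a) \<le> s) \<Longrightarrow> f \<tau> \<le> 0"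
    and \<sigma>: "ready n s k C \<sigma>" "0 < \<sigma> ''flag'' 0"
  shows "wp main_loop f \<sigma> \<le> of_nat (shuffle_time n + 2) + resample n (cells_at (perm_of n \<sigma>) (marks n \<sigma>))
    (\<lambda>\<pi>. of_nat (round_time n) * (1 + \<Phi> \<pi>)) (perm_of n \<sigma>)"
proof -
  define \<psi> where "\<psi> = (\<lambda>\<pi>. of_nat (round_time n) * (1 + \<Phi> \<pi>))"
  define T where "T = shuffle_time n + 2"
  define J where "J \<sigma> = of_nat T + resample n (cells_at (perm_of n \<sigma>) (marks n \<sigma>)) \<psi> (perm_of n \<sigma>)" for \<sigma>
  \<comment> \<open>\<infinity> marks states that never reach the loop head: corrupted data, or a
    lowered flag despite an overfull color. The 2 is the cost of leaving the loop.\<close>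
  define I where "I \<sigma> = (if ready n s k C \<sigma> then
      if 0 < \<sigma> ''flag'' 0 then J \<sigma>
      else if \<forall>a. card (color_rows C n (perm_of n \<sigma>) a) \<le> s then 2 else \<infinity>
    else \<infinity>)" for \<sigma>
  have test: "1 + wp (Seq check (Cond (Less (Lit 0) (var ''flag'')) mark Skip)) (\<lambda>\<sigma>'. 1 + I \<sigma>') \<sigma>1
    \<le> \<psi> (perm_of n \<sigma>1)" if \<sigma>1: "ready n s k C \<sigma>1" "marks n \<sigma>1 = {}" for \<sigma>1
  proof -
    define \<pi> where "\<pi> = perm_of n \<sigma>1"
    have \<pi>: "\<pi> permutes {..<n}" using \<sigma>1 by (simp add: \<pi>_def ready_def)
    define b where "b = of_nat (mark_time n + T + 3) + of_nat (round_time n) * \<Phi> \<pi>"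
    have "wp check (\<lambda>\<sigma>2. 1 + wp (Cond (Less (Lit 0) (var ''flag'')) mark Skip) (\<lambda>\<sigma>'. 1 + I \<sigma>') \<sigma>2) \<sigma>1
      \<le> of_nat (check_time n) + b"
    proof (rule takesD[OF takes_check[OF \<sigma>1(1)]])
      fix \<sigma>2
      assume *: "keeps \<sigma>1 \<sigma>2 \<and>
        (if 0 < \<sigma>2 ''flag'' 0
         then \<sigma>2 ''q'' 0 < n \<and> s < card (color_rows C n (perm_of n \<sigma>1) (C (\<sigma>2 ''q'' 0) (perm_of n \<sigma>1 (\<sigma>2 ''q'' 0))))
         else \<forall>a. card (color_rows C n (perm_of n \<sigma>1) a) \<le> s)"
      have \<sigma>2: "ready n s k C \<sigma>2" "perm_of n \<sigma>2 = \<pi>" "marks n \<sigma>2 = {}"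
        using * keepsD[of \<sigma>1 \<sigma>2] \<sigma>1 by (auto simp: \<pi>_def)
      show "1 + wp (Cond (Less (Lit 0) (var ''flag'')) mark Skip) (\<lambda>\<sigma>'. 1 + I \<sigma>') \<sigma>2 \<le> b"
      proof (cases "0 < \<sigma>2 ''flag'' 0")
        case False
        then have "I \<sigma>2 = 2" using * \<sigma>2 by (simp add: I_def \<pi>_def)
        then have "1 + wp (Cond (Less (Lit 0) (var ''flag'')) mark Skip) (\<lambda>\<sigma>'. 1 + I \<sigma>') \<sigma>2 = of_nat 5"
          using False by (simp flip: add.assoc)
        also have "\<dots> \<le> of_nat (mark_time n + T + 3)"
          by (intro of_nat_mono) (simp add: mark_time_def)
        also have "\<dots> \<le> b" unfolding b_def by simp
        finally show ?thesis .
      next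
        case True
        define R where "R = color_rows C n \<pi> (C (\<sigma>2 ''q'' 0) (\<pi> (\<sigma>2 ''q'' 0)))"
        define X where "X = {S. S \<subseteq> R \<and> card S = k}"
        have q: "\<sigma>2 ''q'' 0 < n" "s < card R" using * True by (simp_all add: R_def \<pi>_def)
        have desc: "k \<le> s" "(\<Sum>S\<in>X. resample n (cells_at \<pi> S) \<Phi> \<pi>) / of_nat (card R choose k) + 1 \<le> \<Phi> \<pi>"
          using descent[OF \<pi>, of "C (\<sigma>2 ''q'' 0) (\<pi> (\<sigma>2 ''q'' 0))"] q(2) unfolding R_def X_def by auto
        have R: "finite R" "R \<subseteq> {..<n}" by (auto simp: R_def color_rows_def)
        have cX: "card X = card R choose k" unfolding X_def by (rule n_subsets[OF R(1)])
        have pos: "0 < card R choose k" using desc q by (simp add: zero_less_binomial)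
        then have X: "finite X" "X \<noteq> {}" using cX card_gt_0_iff[of X] by auto
        have "wp mark (\<lambda>\<sigma>'. 1 + I \<sigma>') \<sigma>2 \<le> of_nat (mark_time n) +
          ennreal (1 / (card R choose k)) * (\<Sum>S\<in>X. of_nat (1 + T) + resample n (cells_at \<pi> S) \<psi> \<pi>)"
          unfolding R_def X_def
        proof (rule wp_mark[OF \<sigma>2(1,2) refl q(1) \<sigma>2(3)])
          fix \<sigma>' assume "ready n s k C \<sigma>'" "perm_of n \<sigma>' = \<pi>" "\<sigma>' ''flag'' 0 = \<sigma>2 ''flag'' 0"
          then show "1 + I \<sigma>' \<le> of_nat (1 + T) + resample n (cells_at \<pi> (marks n \<sigma>')) \<psi> \<pi>"
            using True by (simp add: I_def J_def add.assoc)
        qed (use desc q in \<open>simp add: R_def\<close>)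
        also have "(\<Sum>S\<in>X. of_nat (1 + T) + resample n (cells_at \<pi> S) \<psi> \<pi>) =
          (\<Sum>S\<in>X. (of_nat (1 + T) + of_nat (round_time n)) + of_nat (round_time n) * resample n (cells_at \<pi> S) \<Phi> \<pi>)"
        proof (rule sum.cong[OF refl])
          fix S assume "S \<in> X"
          then have "partial_matching n (cells_at \<pi> S)"
            using R by (intro partial_matching_cells_at[OF \<pi>]) (auto simp: X_def)
          then have "resample n (cells_at \<pi> S) \<psi> \<pi> = of_nat (round_time n) * (1 + resample n (cells_at \<pi> S) \<Phi> \<pi>)"
            unfolding \<psi>_def by (rule resample_affine) (auto simp: contains_cells_def cells_at_def)
          then show "of_nat (1 + T) + resample n (cells_at \<pi> S) \<psi> \<pi> =
            (of_nat (1 + T) + of_nat (round_time n)) + of_nat (round_time n) * resample n (cells_at \<pi> S) \<Phi> \<pi>"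
            by (simp add: distrib_left add.assoc)
        qed
        also have "ennreal (1 / (card R choose k)) * \<dots> = (of_nat (1 + T) + of_nat (round_time n)) +
          of_nat (round_time n) * ((\<Sum>S\<in>X. resample n (cells_at \<pi> S) \<Phi> \<pi>) / of_nat (card R choose k))"
          unfolding cX[symmetric] average_const[OF X] divide_of_nat_ennreal[OF pos[folded cX]]
          by (simp add: sum_distrib_left[symmetric] mult.left_commute)
        \<comment> \<open>The separate \<open>of_nat (round_time n)\<close> is absorbed as the
          \<open>+ 1\<close> of \<open>descent\<close>.\<close>
        also have "of_nat (mark_time n) + \<dots> = of_nat (mark_time n + (1 + T)) +
          of_nat (round_time n) * ((\<Sum>S\<in>X. resample n (cells_at \<pi> S) \<Phi> \<pi>) / of_nat (card R choose k) + 1)"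
          by (simp add: distrib_left ac_simps)
        also have "\<dots> \<le> of_nat (mark_time n + (1 + T)) + of_nat (round_time n) * \<Phi> \<pi>"
          by (intro add_left_mono mult_left_mono desc) simp
        finally have le: "wp mark (\<lambda>\<sigma>'. 1 + I \<sigma>') \<sigma>2 \<le> of_nat (mark_time n + (1 + T)) + of_nat (round_time n) * \<Phi> \<pi>" .
        have "1 + wp (Cond (Less (Lit 0) (var ''flag'')) mark Skip) (\<lambda>\<sigma>'. 1 + I \<sigma>') \<sigma>2 =
          of_nat 2 + wp mark (\<lambda>\<sigma>'. 1 + I \<sigma>') \<sigma>2" using True by (simp flip: add.assoc)
        also have "\<dots> \<le> of_nat 2 + (of_nat (mark_time n + (1 + T)) + of_nat (round_time n) * \<Phi> \<pi>)"
          by (rule add_left_mono[OF le])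
        also have "\<dots> = of_nat (2 + (mark_time n + (1 + T))) + of_nat (round_time n) * \<Phi> \<pi>"
          by (simp only: of_nat_add add.assoc)
        also have "2 + (mark_time n + (1 + T)) = mark_time n + T + 3" by simp
        finally show ?thesis by (simp add: b_def)
      qed
    qed
    then have "1 + wp (Seq check (Cond (Less (Lit 0) (var ''flag'')) mark Skip)) (\<lambda>\<sigma>'. 1 + I \<sigma>') \<sigma>1
      \<le> of_nat 1 + (of_nat (check_time n) + b)"
      by (simp add: add_left_mono)
    also have "\<dots> = of_nat (1 + (check_time n + (mark_time n + T + 3))) + of_nat (round_time n) * \<Phi> \<pi>"
      unfolding b_def by (simp only: of_nat_add add.assoc)
    also have "\<dots> \<le> of_nat (round_time n) + of_nat (round_time n) * \<Phi> \<pi>"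
      by (intro add_right_mono of_nat_mono) (simp add: round_time_def T_def)
    finally show ?thesis by (simp add: \<psi>_def \<pi>_def distrib_left)
  qed
  have "wp main_loop f \<sigma> \<le> I \<sigma>"
    unfolding main_loop_def
  proof (rule wp_Loop_le)
    fix \<sigma> assume flag: "bval (Less (Lit 0) (var ''flag'')) \<sigma>"
    show "2 + wp (Seq shuffle (Seq check (Cond (Less (Lit 0) (var ''flag'')) mark Skip))) (\<lambda>\<sigma>'. 1 + I \<sigma>') \<sigma> \<le> I \<sigma>"
    proof (cases "ready n s k C \<sigma>")
      case True
      have "wp (Seq shuffle (Seq check (Cond (Less (Lit 0) (var ''flag'')) mark Skip))) (\<lambda>\<sigma>'. 1 + I \<sigma>') \<sigma>
        \<le> of_nat (shuffle_time n) + resample n (cells_at (perm_of n \<sigma>) (marks n \<sigma>)) \<psi> (perm_of n \<sigma>)"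
        unfolding wp.simps(4)[of shuffle] shuffle_time_def by (rule wp_shuffle[OF True]) (rule test)
      then have "2 + wp (Seq shuffle (Seq check (Cond (Less (Lit 0) (var ''flag'')) mark Skip))) (\<lambda>\<sigma>'. 1 + I \<sigma>') \<sigma>
        \<le> of_nat 2 + (of_nat (shuffle_time n) + resample n (cells_at (perm_of n \<sigma>) (marks n \<sigma>)) \<psi> (perm_of n \<sigma>))"
        by (simp add: add_left_mono del: wp.simps)
      also have "\<dots> = I \<sigma>"
        using True flag by (simp add: I_def J_def T_def ac_simps)
      finally show ?thesis .
    qed (simp add: I_def)
  next
    fix \<sigma> assume "\<not> bval (Less (Lit 0) (var ''flag'')) \<sigma>"
    then show "2 + f \<sigma> \<le> I \<sigma>" using f[of \<sigma>] by (simp add: I_def)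
  qed
  then show ?thesis using \<sigma> by (simp add: I_def J_def T_def \<psi>_def)
qed

section \<open>Initialization and the complete program\<close>

text \<open>The array \<open>off\<close> tabulates \<open>i * n\<close>, as the machine cannot multiply. Initially all rows are marked,
  so that the first shuffle produces a uniformly random permutation.\<close>

definition init_loop :: com where
  "init_loop = Loop (Less (var ''i'') (var ''n''))
    (Seq (Assign ''off'' (var ''i'') (var ''o''))
      (Seq (Assign ''pi'' (var ''i'') (var ''i''))
        (Seq (Assign ''mk'' (var ''i'') (Lit 1))
          (Seq (set_var ''o'' (Add (var ''o'') (var ''n''))) (increment ''i'')))))"

text \<open>\<open>u\<close> holds (k + 1)^2 and is updated by odd increments, which avoids
  multiplication. The guard \<open>k < n\<close> keeps the time polynomial in \<open>n\<close>,
  however large \<open>s\<close> is.\<close>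

definition root_loop :: com where
  "root_loop = Loop (Conj (Less (var ''k'') (var ''n'')) (Neg (Less (var ''s'') (var ''u''))))
    (Seq (increment ''k'')
      (set_var ''u'' (Add (Add (var ''u'') (Add (var ''k'') (var ''k''))) (Lit 1))))"

definition setup_phase :: com where
  "setup_phase = Seq (set_var ''i'' (Lit 0)) (Seq (set_var ''o'' (Lit 0)) (Seq init_loop
    (Seq (set_var ''k'' (Lit 0)) (Seq (set_var ''u'' (Lit 1)) (Seq root_loop
      (set_var ''flag'' (Lit 1)))))))"

definition program :: com where
  "program = Seq setup_phase main_loop"

text \<open>For s < n this is the integer square root of s; the alternative \<open>n \<le> k\<close>
  mirrors the cap in \<open>root_loop\<close>.\<close>

definition sample_size :: "nat \<Rightarrow> nat \<Rightarrow> nat" where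
  "sample_size n s = (LEAST k. n \<le> k \<or> s < (Suc k)\<^sup>2)"

lemma sample_size_le: "sample_size n s \<le> n"
  unfolding sample_size_def by (rule Least_le) simp

lemma sample_size_reached: "n \<le> sample_size n s \<or> s < (Suc (sample_size n s))\<^sup>2"
  unfolding sample_size_def by (rule LeastI[of _ n]) simp

lemma sample_size_guard:
  assumes "k \<le> sample_size n s"
  shows "k < n \<and> \<not> s < (Suc k)\<^sup>2 \<longleftrightarrow> k < sample_size n s"
proof
  show "k < sample_size n s" if "k < n \<and> \<not> s < (Suc k)\<^sup>2"
    using assms that sample_size_reached[of n s] by (cases "k = sample_size n s") auto
  show "k < n \<and> \<not> s < (Suc k)\<^sup>2" if "k < sample_size n s"
    using not_less_Least[OF that[unfolded sample_size_def]] by auto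
qed

lemma sample_size_bounds:
  assumes "s < n"
  shows "(sample_size n s)\<^sup>2 \<le> s" "s < (Suc (sample_size n s))\<^sup>2"
proof -
  show "(sample_size n s)\<^sup>2 \<le> s"
  proof (cases "sample_size n s")
    case (Suc k)
    then show ?thesis using sample_size_guard[of k n s] by auto
  qed simp
  have "n \<le> n\<^sup>2" by (simp add: power2_eq_square)
  also have "n\<^sup>2 \<le> (Suc n)\<^sup>2" by (intro power_mono) auto
  finally show "s < (Suc (sample_size n s))\<^sup>2"
    using sample_size_reached[of n s] sample_size_le[of n s] assms by (cases "n \<le> sample_size n s") auto
qed

definition raw_input :: "nat \<Rightarrow> nat \<Rightarrow> (nat \<Rightarrow> nat \<Rightarrow> nat) \<Rightarrow> state \<Rightarrow> bool" where
  "raw_input n s C \<sigma> \<longleftrightarrow> \<sigma> ''n'' 0 = n \<and> \<sigma> ''s'' 0 = s \<and> (\<forall>i<n. \<forall>j<n. \<sigma> ''A'' (i * n + j) = C i j)"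

lemma raw_input_update:
  "x \<notin> {''n'', ''s'', ''A''} \<Longrightarrow> raw_input n s C (update x j v \<sigma>) \<longleftrightarrow> raw_input n s C \<sigma>"
  by (auto simp: raw_input_def update_other)

definition initialized :: "nat \<Rightarrow> nat \<Rightarrow> (nat \<Rightarrow> nat \<Rightarrow> nat) \<Rightarrow> nat \<Rightarrow> state \<Rightarrow> bool" where
  "initialized n s C m \<sigma> \<longleftrightarrow> raw_input n s C \<sigma> \<and>
    (\<forall>i<m. \<sigma> ''off'' i = i * n \<and> \<sigma> ''pi'' i = i \<and> \<sigma> ''mk'' i = 1)"

lemma initialized_update:
  "x \<notin> {''n'', ''s'', ''A'', ''off'', ''pi'', ''mk''} \<Longrightarrow>
    initialized n s C m (update x j v \<sigma>) \<longleftrightarrow> initialized n s C m \<sigma>"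
  by (auto simp: initialized_def raw_input_def update_other)

lemma initialized_ready:
  assumes "initialized n s C n \<sigma>"
  shows "ready n s (\<sigma> ''k'' 0) C \<sigma>" "perm_of n \<sigma> = id" "marks n \<sigma> = {..<n}"
proof -
  show "perm_of n \<sigma> = id"
    using assms by (auto simp: initialized_def perm_of_def fun_eq_iff)
  then show "ready n s (\<sigma> ''k'' 0) C \<sigma>"
    using assms by (auto simp: ready_def initialized_def raw_input_def permutes_id)
  show "marks n \<sigma> = {..<n}"
    using assms by (auto simp: initialized_def marks_def)
qed

lemma takes_init_loop:
  assumes "raw_input n s C \<sigma>" "\<sigma> ''i'' 0 = 0" "\<sigma> ''o'' 0 = 0"
  shows "takes init_loop \<sigma> (n * 12 + 2) (initialized n s C n)"
proof -
  define I where "I d \<sigma> \<longleftrightarrow> initialized n s C (\<sigma> ''i'' 0) \<sigma> \<and> \<sigma> ''i'' 0 + d = n \<and> \<sigma> ''o'' 0 = \<sigma> ''i'' 0 * n" for d \<sigma>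
  have "takes init_loop \<sigma> (n * (9 + 3) + 2) (I 0)"
    unfolding init_loop_def
  proof (rule takes_Loop[where I = I])
    show "I n \<sigma>" using assms by (simp add: I_def initialized_def)
    show "bval (Less (var ''i'') (var ''n'')) \<sigma> \<longleftrightarrow> 0 < d" if "I d \<sigma>" for d \<sigma>
      using that by (auto simp: I_def initialized_def raw_input_def)
    fix d \<sigma> assume I: "I (Suc d) \<sigma>"
    define i where "i = \<sigma> ''i'' 0"
    define \<tau> where "\<tau> = update ''i'' 0 (i + 1) (update ''o'' 0 (\<sigma> ''o'' 0 + n)
      (update ''mk'' i 1 (update ''pi'' i i (update ''off'' i (\<sigma> ''o'' 0) \<sigma>))))"
    have n: "\<sigma> ''n'' 0 = n" using I by (simp add: I_def initialized_def raw_input_def)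
    have "I d \<tau>"
      using I by (auto simp: I_def initialized_def \<tau>_def raw_input_update update_apply i_def[symmetric] less_Suc_eq)
    show "takes (Seq (Assign ''off'' (var ''i'') (var ''o''))
      (Seq (Assign ''pi'' (var ''i'') (var ''i''))
        (Seq (Assign ''mk'' (var ''i'') (Lit 1))
          (Seq (set_var ''o'' (Add (var ''o'') (var ''n''))) (increment ''i''))))) \<sigma> 9 (I d)"
    proof (rule takesI)
      fix f :: "state \<Rightarrow> ennreal" and b assume f: "\<And>\<sigma>'. I d \<sigma>' \<Longrightarrow> f \<sigma>' \<le> b"
      have "wp (Seq (Assign ''off'' (var ''i'') (var ''o''))
        (Seq (Assign ''pi'' (var ''i'') (var ''i''))
          (Seq (Assign ''mk'' (var ''i'') (Lit 1))
            (Seq (set_var ''o'' (Add (var ''o'') (var ''n''))) (increment ''i''))))) f \<sigma> = of_nat 9 + f \<tau>"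
        using n by (simp add: \<tau>_def update_apply i_def flip: add.assoc)
      also have "\<dots> \<le> of_nat 9 + b" by (intro add_left_mono f) fact
      finally show "wp (Seq (Assign ''off'' (var ''i'') (var ''o''))
        (Seq (Assign ''pi'' (var ''i'') (var ''i''))
          (Seq (Assign ''mk'' (var ''i'') (Lit 1))
            (Seq (set_var ''o'' (Add (var ''o'') (var ''n''))) (increment ''i''))))) f \<sigma> \<le> of_nat 9 + b" .
    qed
  qed
  then show ?thesis by (rule takes_weaken) (auto simp: I_def)
qed

lemma takes_root_loop:
  assumes "initialized n s C n \<sigma>" "\<sigma> ''k'' 0 = 0" "\<sigma> ''u'' 0 = 1"
  shows "takes root_loop \<sigma> (n * 6 + 2) (\<lambda>\<sigma>'. initialized n s C n \<sigma>' \<and> \<sigma>' ''k'' 0 = sample_size n s)"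
proof -
  define K where "K = sample_size n s"
  define I where "I d \<sigma> \<longleftrightarrow> initialized n s C n \<sigma> \<and> \<sigma> ''k'' 0 + d = K \<and> \<sigma> ''u'' 0 = (Suc (\<sigma> ''k'' 0))\<^sup>2" for d \<sigma>
  have "takes root_loop \<sigma> (K * (3 + 3) + 2) (I 0)"
    unfolding root_loop_def
  proof (rule takes_Loop[where I = I])
    show "I K \<sigma>" using assms by (simp add: I_def)
    show "bval (Conj (Less (var ''k'') (var ''n'')) (Neg (Less (var ''s'') (var ''u'')))) \<sigma> \<longleftrightarrow> 0 < d"
      if "I d \<sigma>" for d \<sigma>
      using that sample_size_guard[of "\<sigma> ''k'' 0" n s]
      by (auto simp: I_def initialized_def raw_input_def K_def)
    fix d \<sigma> assume I: "I (Suc d) \<sigma>"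
    have "takes (Seq (increment ''k'')
      (set_var ''u'' (Add (Add (var ''u'') (Add (var ''k'') (var ''k''))) (Lit 1)))) \<sigma> (1 + 1 + 1) (I d)"
      by (rule takes_Seq[OF takes_Assign[where Q = "\<lambda>\<rho>. \<rho> = update ''k'' 0 (\<sigma> ''k'' 0 + 1) \<sigma>"]], simp, rule takes_Assign)
        (use I in \<open>simp add: I_def initialized_update update_apply power2_eq_square\<close>)
    then show "takes (Seq (increment ''k'')
      (set_var ''u'' (Add (Add (var ''u'') (Add (var ''k'') (var ''k''))) (Lit 1)))) \<sigma> 3 (I d)"
      by (rule takes_weaken) auto
  qed
  then show ?thesis
    by (rule takes_weaken) (use sample_size_le[of n s] in \<open>auto simp: I_def K_def\<close>)
qed

definition setup_time :: "nat \<Rightarrow> nat" where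
  "setup_time n = 18 * n + 15"

lemma takes_setup_phase:
  assumes "raw_input n s C \<sigma>"
  shows "takes setup_phase \<sigma> (setup_time n) (\<lambda>\<sigma>'. ready n s (sample_size n s) C \<sigma>' \<and>
    perm_of n \<sigma>' = id \<and> marks n \<sigma>' = {..<n} \<and> 0 < \<sigma>' ''flag'' 0)"
proof -
  have "takes setup_phase \<sigma> (1 + (1 + ((n * 12 + 2) + (1 + (1 + ((n * 6 + 2) + 1 + 1) + 1) + 1) + 1) + 1) + 1)
    (\<lambda>\<sigma>'. initialized n s C n \<sigma>' \<and> \<sigma>' ''k'' 0 = sample_size n s \<and> 0 < \<sigma>' ''flag'' 0)"
    unfolding setup_phase_def
    by (rule takes_Seq[OF takes_Assign[where Q = "\<lambda>\<rho>. raw_input n s C \<rho> \<and> \<rho> ''i'' 0 = 0"]],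
        use assms in \<open>simp add: raw_input_update update_apply\<close>,
        rule takes_Seq[OF takes_Assign[where Q = "\<lambda>\<rho>. raw_input n s C \<rho> \<and> \<rho> ''i'' 0 = 0 \<and> \<rho> ''o'' 0 = 0"]],
        simp add: raw_input_update update_apply,
        rule takes_Seq[OF takes_init_loop[of n s C]], simp, simp, simp,
        rule takes_Seq[OF takes_Assign[where Q = "\<lambda>\<rho>. initialized n s C n \<rho> \<and> \<rho> ''k'' 0 = 0"]],
        simp add: initialized_update update_apply,
        rule takes_Seq[OF takes_Assign[where Q = "\<lambda>\<rho>. initialized n s C n \<rho> \<and> \<rho> ''k'' 0 = 0 \<and> \<rho> ''u'' 0 = 1"]],
        simp add: initialized_update update_apply,
        rule takes_Seq[OF takes_root_loop[of n s C]], simp, simp, simp,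
        rule takes_Assign, simp add: initialized_update update_apply)
  then show ?thesis
  proof (rule takes_weaken)
    fix \<sigma>' assume "initialized n s C n \<sigma>' \<and> \<sigma>' ''k'' 0 = sample_size n s \<and> 0 < \<sigma>' ''flag'' 0"
    then show "ready n s (sample_size n s) C \<sigma>' \<and> perm_of n \<sigma>' = id \<and> marks n \<sigma>' = {..<n} \<and> 0 < \<sigma>' ''flag'' 0"
      using initialized_ready[of n s C \<sigma>'] by simp
  qed (simp add: setup_time_def)
qed

text \<open>The operator product preserves the sum over permutations and vanishes at all of them but
  the identity, the only one containing all cells of the identity.\<close>

lemma resample_all:
  "resample n (cells_at id {..<n}) \<psi> id = ennreal (1 / fact n) * (\<Sum>\<sigma> | \<sigma> permutes {..<n}. \<psi> \<sigma>)"
proof -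
  define K where "K = cells_at id {..<n}"
  have pm: "partial_matching n K" unfolding K_def by (rule partial_matching_cells_at) (auto simp: permutes_id)
  have "(\<Sum>\<sigma> | \<sigma> permutes {..<n}. \<psi> \<sigma>) = (\<Sum>\<sigma> | \<sigma> permutes {..<n}. cells_op n K \<psi> \<sigma>)"
    by (rule sum_cells_op[OF pm, symmetric])
  also have "\<dots> = (\<Sum>\<sigma>\<in>{id}. cells_op n K \<psi> \<sigma>)"
  proof (rule sum.mono_neutral_right)
    show "finite {\<sigma>. \<sigma> permutes {..<n}}" by (rule finite_permutations) simp
    show "\<forall>\<sigma>\<in>{\<sigma>. \<sigma> permutes {..<n}} - {id}. cells_op n K \<psi> \<sigma> = 0"
    proof
      fix \<sigma> assume "\<sigma> \<in> {\<sigma>. \<sigma> permutes {..<n}} - {id}"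
      then obtain i where \<sigma>: "\<sigma> permutes {..<n}" "\<sigma> i \<noteq> i" by (auto simp: fun_eq_iff)
      then have "i < n" using permutes_not_in[OF \<sigma>(1), of i] by auto
      then show "cells_op n K \<psi> \<sigma> = 0"
        using \<sigma>(2) by (intro cells_op_absent[OF pm, of i i]) (auto simp: K_def cells_at_def)
    qed
  qed (auto simp: permutes_id)
  finally show ?thesis by (simp add: resample_def K_def card_cells_at)
qed

definition total_time :: "nat \<Rightarrow> nat" where
  "total_time n = setup_time n + (1 + (shuffle_time n + 2 + round_time n * (1 + n\<^sup>2)))"

text \<open>With all rows marked at the start, the first shuffle replaces the potential by its mean
  over all permutations, which is at most n^2.\<close>

lemma wp_program:
  fixes \<Phi> :: "(nat \<Rightarrow> nat) \<Rightarrow> ennreal"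
  assumes "raw_input n s C \<sigma>"
    and descent: "\<And>\<pi> a. \<pi> permutes {..<n} \<Longrightarrow> s < card (color_rows C n \<pi> a) \<Longrightarrow> sample_size n s \<le> s \<and>
      (\<Sum>S | S \<subseteq> color_rows C n \<pi> a \<and> card S = sample_size n s. resample n (cells_at \<pi> S) \<Phi> \<pi>)
        / of_nat (card (color_rows C n \<pi> a) choose sample_size n s) + 1 \<le> \<Phi> \<pi>"
    and \<Phi>: "(\<Sum>\<sigma> | \<sigma> permutes {..<n}. \<Phi> \<sigma>) \<le> of_nat (n\<^sup>2) * fact n"
    and f: "\<And>\<tau>. ready n s (sample_size n s) C \<tau> \<Longrightarrow> (\<And>a. card (color_rows C n (perm_of n \<tau>) a) \<le> s) \<Longrightarrow> f \<tau> \<le> 0"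
  shows "wp program f \<sigma> \<le> of_nat (total_time n)"
proof -
  define \<psi> where "\<psi> = (\<lambda>\<pi>. of_nat (round_time n) * (1 + \<Phi> \<pi>))"
  have fact: "ennreal (1 / fact n) * fact n = 1"
    by (simp add: ennreal_mult[symmetric] flip: ennreal_fact)
  have "resample n (cells_at id {..<n}) \<psi> id \<le> of_nat (round_time n * (1 + n\<^sup>2))"
  proof -
    have "resample n (cells_at id {..<n}) \<psi> id =
      ennreal (1 / fact n) * (of_nat (round_time n) * (fact n + (\<Sum>\<sigma> | \<sigma> permutes {..<n}. \<Phi> \<sigma>)))"
      unfolding resample_all \<psi>_def
      by (simp add: sum.distrib card_permutations[OF refl] flip: sum_distrib_left)
    also have "\<dots> \<le> ennreal (1 / fact n) * (of_nat (round_time n) * (fact n + of_nat (n\<^sup>2) * fact n))"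
      by (intro mult_left_mono add_left_mono \<Phi>) auto
    also have "\<dots> = (ennreal (1 / fact n) * fact n) * (of_nat (round_time n) * (1 + of_nat (n\<^sup>2)))"
      by (simp only: distrib_left distrib_right mult_ac mult_1 mult_1_right)
    finally show ?thesis unfolding fact by (simp add: distrib_left)
  qed
  then have init: "of_nat (shuffle_time n + 2) + resample n (cells_at id {..<n}) \<psi> id
    \<le> of_nat (shuffle_time n + 2 + round_time n * (1 + n\<^sup>2))"
    by (simp only: of_nat_add add_left_mono)
  have "wp setup_phase (\<lambda>\<sigma>. 1 + wp main_loop f \<sigma>) \<sigma> \<le> of_nat (setup_time n) +
    of_nat (1 + (shuffle_time n + 2 + round_time n * (1 + n\<^sup>2)))"
  proof (rule takesD[OF takes_setup_phase[OF assms(1)]])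
    fix \<tau> assume \<tau>: "ready n s (sample_size n s) C \<tau> \<and> perm_of n \<tau> = id \<and> marks n \<tau> = {..<n} \<and> 0 < \<tau> ''flag'' 0"
    have "wp main_loop f \<tau> \<le> of_nat (shuffle_time n + 2) + resample n (cells_at (perm_of n \<tau>) (marks n \<tau>)) \<psi> (perm_of n \<tau>)"
      unfolding \<psi>_def by (rule wp_main_loop[OF descent f]) (use \<tau> in auto)
    also have "\<dots> \<le> of_nat (shuffle_time n + 2 + round_time n * (1 + n\<^sup>2))" using \<tau> init by simp
    finally show "1 + wp main_loop f \<tau> \<le> of_nat (1 + (shuffle_time n + 2 + round_time n * (1 + n\<^sup>2)))"
      by (simp only: of_nat_add of_nat_1 add_left_mono)
  qed
  then show ?thesis unfolding program_def total_time_def by (simp only: wp.simps(4) of_nat_add)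
qed

lemma raw_input_input_state:
  assumes "B \<in> carrier_mat n n"
  shows "raw_input n s (\<lambda>i j. B $$ (i, j)) (input_state s B)"
proof -
  have "i * n + j < n * n" if "i < n" "j < n" for i j :: nat
  proof -
    have "i * n + j < Suc i * n" using that by simp
    also have "\<dots> \<le> n * n" using that by (intro mult_right_mono) auto
    finally show ?thesis .
  qed
  then show ?thesis using assms by (auto simp: raw_input_def input_state_def)
qed

lemma good_transversalI:
  assumes B: "B \<in> carrier_mat n n" and "ready n s k (\<lambda>i j. B $$ (i, j)) \<tau>"
    and "\<And>a. card (color_rows (\<lambda>i j. B $$ (i, j)) n (perm_of n \<tau>) a) \<le> s"
  shows "good_transversal s B (output_perm \<tau>)"
proof -
  have eq: "perm_of n \<tau> i = output_perm \<tau> i" if "i < n" for i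
    using that by (simp add: perm_of_def output_perm_def)
  have "bij_betw (perm_of n \<tau>) {..<n} {..<n}"
    using assms(2) by (simp add: ready_def permutes_imp_bij)
  then have "bij_betw (output_perm \<tau>) {..<n} {..<n}"
    using eq by (subst bij_betw_cong[of _ _ "perm_of n \<tau>"]) auto
  moreover have "transversal_appearances B (output_perm \<tau>) a =
    card (color_rows (\<lambda>i j. B $$ (i, j)) n (perm_of n \<tau>) a)" for a
    using B unfolding transversal_appearances_def color_rows_def
    by (intro arg_cong[where f = card]) (auto simp: eq)
  ultimately show ?thesis
    using B assms(3) by (auto simp: good_transversal_def is_transversal_def)
qed

lemma program_correct:
  assumes B: "B \<in> carrier_mat n n" and le: "\<And>a. appearances B a \<le> \<Delta>"
    and \<Delta>: "real \<Delta> \<le> (real s - 20 * sqrt (real s)) * real n"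
  shows "computes_in_expected_time program (input_state s B)
    (\<lambda>\<tau>. good_transversal s B (output_perm \<tau>)) (total_time n)"
proof (rule wp_sound)
  define C where "C = (\<lambda>i j. B $$ (i, j))"
  let ?f = "\<lambda>\<tau>. if good_transversal s B (output_perm \<tau>) then 0 else \<infinity> :: ennreal"
  have input: "raw_input n s C (input_state s B)"
    unfolding C_def by (rule raw_input_input_state[OF B])
  have f: "?f \<tau> \<le> 0" if "ready n s (sample_size n s) C \<tau>"
    "\<And>a. card (color_rows C n (perm_of n \<tau>) a) \<le> s" for \<tau>
    using good_transversalI[OF B, of s "sample_size n s" \<tau>] that by (simp add: C_def)
  show "wp program ?f (input_state s B) \<le> of_nat (total_time n)"
  proof (cases "s < n")
    case True
    have card: "card {(i, j). i < n \<and> j < n \<and> C i j = a} = appearances B a" for a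
      using B by (simp add: appearances_def C_def)
    have "1 \<le> \<Delta>"
    proof -
      have zero_less: "0 < n" using True by simp
      have "{(i, j). i < n \<and> j < n \<and> C i j = C 0 0} \<noteq> {}" using zero_less by blast
      moreover have "finite {(i, j). i < n \<and> j < n \<and> C i j = C 0 0}"
        by (rule finite_subset[of _ "{..<n} \<times> {..<n}"]) auto
      ultimately have "1 \<le> card {(i, j). i < n \<and> j < n \<and> C i j = C 0 0}"
        by (simp add: Suc_le_eq card_gt_0_iff)
      then show ?thesis using le[of "C 0 0"] card by simp
    qed
    then interpret colored_cells C n s "sample_size n s" \<Delta>
      using le card sample_size_bounds[OF True] True \<Delta> by unfold_locales auto
    show ?thesis
      by (rule wp_program[OF input _ sum_limit_potential_le f]) (use k_le limit_potential_descent in auto)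
  next
    case False
    have no: "card (color_rows C n \<pi> a) \<le> s" for \<pi> a
    proof -
      have "card (color_rows C n \<pi> a) \<le> card {..<n}"
        by (rule card_mono) (auto simp: color_rows_def)
      then show ?thesis using False by simp
    qed
    \<comment> \<open>With s >= n no color can be overfull, so the descent condition is vacuous and
      the zero potential works.\<close>
    show ?thesis
      by (rule wp_program[OF input, where \<Phi> = "\<lambda>_. 0"]) (use no f in \<open>auto simp: not_less[symmetric]\<close>)
  qed
qed

section \<open>Existence, arbitrary colors and the polynomial\<close>

lemma computes_mono:
  "computes_in_expected_time P \<sigma> Q t \<Longrightarrow> (\<And>\<tau>. Q \<tau> \<Longrightarrow> Q' \<tau>) \<Longrightarrow> t \<le> t' \<Longrightarrow>
    computes_in_expected_time P \<sigma> Q' t'"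
  unfolding computes_in_expected_time_def by (meson of_nat_mono order_trans)

text \<open>If no output were correct, no run could halt, so each of the first t + 1 terms of the
  expected time would be 1, more than t in total.\<close>

lemma computes_exists:
  assumes "computes_in_expected_time P \<sigma> Q t"
  shows "\<exists>\<tau>. Q \<tau>"
proof (rule ccontr)
  assume "\<nexists>\<tau>. Q \<tau>"
  then have "set_pmf (run k (P, \<sigma>)) \<subseteq> {cf. fst cf \<noteq> Skip}" for k
    using assms by (auto simp: computes_in_expected_time_def)
  then have "measure_pmf.prob (run k (P, \<sigma>)) {cf. fst cf \<noteq> Skip} = 1" for k
    by (subst measure_pmf.prob_eq_1) (auto simp: AE_measure_pmf_iff)
  then have "(\<Sum>j<Suc t. ennreal (measure_pmf.prob (run j (P, \<sigma>)) {cf. fst cf \<noteq> Skip})) = of_nat (Suc t)"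
    by simp
  moreover have "(\<Sum>j<Suc t. ennreal (measure_pmf.prob (run j (P, \<sigma>)) {cf. fst cf \<noteq> Skip})) \<le> expected_time P \<sigma>"
    unfolding expected_time_def by (rule sum_le_suminf) auto
  ultimately have "of_nat (Suc t) \<le> (of_nat t :: ennreal)"
    using assms unfolding computes_in_expected_time_def by (metis order_trans)
  then show False unfolding of_nat_le_iff by simp
qed

lemma appearances_map_mat_le:
  assumes "A \<in> carrier_mat n n" "inj_on enc (elements_mat A)" "\<And>a. appearances A a \<le> \<Delta>"
  shows "appearances (map_mat enc A) b \<le> \<Delta>"
proof (cases "\<exists>i<n. \<exists>j<n. enc (A $$ (i, j)) = b")
  case True
  then obtain i j where ij: "i < n" "j < n" "enc (A $$ (i, j)) = b" by blast
  have el: "A $$ (i', j') \<in> elements_mat A" if "i' < n" "j' < n" for i' j'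
    using assms(1) that by auto
  have "{(i, j). i < dim_row (map_mat enc A) \<and> j < dim_col (map_mat enc A) \<and> map_mat enc A $$ (i, j) = b} =
    {(i', j'). i' < dim_row A \<and> j' < dim_col A \<and> A $$ (i', j') = A $$ (i, j)}"
    using assms(1) ij inj_onD[OF assms(2)] el by auto
  then have "appearances (map_mat enc A) b = appearances A (A $$ (i, j))"
    by (simp only: appearances_def)
  then show ?thesis using assms(3) by simp
next
  case False
  then have "{(i, j). i < dim_row (map_mat enc A) \<and> j < dim_col (map_mat enc A) \<and> map_mat enc A $$ (i, j) = b} = {}"
    using assms(1) by auto
  then show ?thesis by (simp only: appearances_def card.empty le0)
qed

lemma good_transversal_map_mat:
  assumes "A \<in> carrier_mat n n" "good_transversal s (map_mat enc A) \<pi>"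
  shows "good_transversal s A \<pi>"
  unfolding good_transversal_def
proof (intro conjI allI)
  show "is_transversal (dim_row A) \<pi>" using assms by (simp add: good_transversal_def)
  then have \<pi>: "\<pi> i < n" if "i < n" for i
    using that assms(1) by (auto simp: is_transversal_def dest: bij_betwE)
  fix a
  have "transversal_appearances A \<pi> a \<le> transversal_appearances (map_mat enc A) \<pi> (enc a)"
    unfolding transversal_appearances_def using assms(1) \<pi>
    by (intro card_mono) auto
  also have "\<dots> \<le> s" using assms(2) by (simp add: good_transversal_def)
  finally show "transversal_appearances A \<pi> a \<le> s" .
qed

lemma total_time_poly: "\<exists>p :: nat poly. \<forall>n. total_time n = poly p n"
proof -
  define X :: "nat poly" where "X = [:0, 1:]"
  define D where "D = 2 * X * (8 * X + 11) + 2"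
  define p where "p = (18 * X + 15) + (1 + ((X * (D + 14) + 4) + 2 +
    ((X * (X * 7 + 16) + 6) + (X * (D + 7) + 4) + (X * (D + 14) + 4) + 8) * (1 + X * X)))"
  have "total_time n = poly p n" for n
    by (simp add: p_def D_def X_def total_time_def setup_time_def shuffle_time_def swap_time_def
        draw_time_def round_time_def check_time_def mark_time_def power2_eq_square algebra_simps)
  then show ?thesis by blast
qed

theorem theorem8p2:
  shows "\<exists>c::real. c > 0 \<and>
    (\<exists>(P::com) (p::nat poly).
      \<forall>(s::nat) (n::nat) (\<Delta>::nat) (A::'c mat).
        s \<ge> 1 \<longrightarrow> A \<in> carrier_mat n n \<longrightarrow> (\<forall>a. appearances A a \<le> \<Delta>) \<longrightarrow>
        real \<Delta> \<le> (real s - c * sqrt (real s)) * real n \<longrightarrow>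
          (\<exists>\<pi>. good_transversal s A \<pi>) \<and>
          (\<forall>enc :: 'c \<Rightarrow> nat. inj_on enc (elements_mat A) \<longrightarrow>
            computes_in_expected_time P (input_state s (map_mat enc A))
              (\<lambda>\<tau>. good_transversal s A (output_perm \<tau>)) (poly p n)))"
proof -
  obtain p :: "nat poly" where p: "\<And>n. total_time n = poly p n" using total_time_poly by blast
  have main: "computes_in_expected_time program (input_state s (map_mat enc A))
      (\<lambda>\<tau>. good_transversal s A (output_perm \<tau>)) (poly p n)"
    if "A \<in> carrier_mat n n" "\<forall>a. appearances A a \<le> \<Delta>"
      "real \<Delta> \<le> (real s - 20 * sqrt (real s)) * real n" "inj_on enc (elements_mat A)"
    for s n \<Delta> and A :: "'c mat" and enc :: "'c \<Rightarrow> nat"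
    using that p good_transversal_map_mat[OF that(1)]
    by (intro computes_mono[OF program_correct[of _ n \<Delta> s]]) (auto intro: appearances_map_mat_le)
  have ex: "\<exists>\<pi>. good_transversal s A \<pi>"
    if "A \<in> carrier_mat n n" "\<forall>a. appearances A a \<le> \<Delta>"
      "real \<Delta> \<le> (real s - 20 * sqrt (real s)) * real n"
    for s n \<Delta> and A :: "'c mat"
  proof -
    \<comment> \<open>The program needs numerical colors; a matrix has finitely many entries, so
      some injective encoding exists and existence follows from the algorithm.\<close>
    have "finite (elements_mat A)" by (simp add: elements_mat_def)
    then obtain enc :: "'c \<Rightarrow> nat" where "inj_on enc (elements_mat A)"
      using finite_imp_inj_to_nat_seg[of "elements_mat A"] by metis
    from computes_exists[OF main[OF that this]] show ?thesis by blast
  qed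
  show ?thesis
    by (rule exI[of _ 20], rule conjI, simp, rule exI[of _ program], rule exI[of _ p]) (intro allI impI conjI; (rule main | rule ex); assumption)
qed

end
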